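(* Let $\mathcal C$ be a small category and let $F=(\mathcal G_x,\mathcal X_g,\mu_{g,h})$ be a tight $\mathcal C$-shaped diagram of groupoid correspondences. Let $\Omega=\bigsqcup_{x\in\mathcal C^0}\Omega_x$ with $\Omega_x=\mathcal G_x^0$ and $r\colon\Omega_x\to\mathcal G_x^0$ the identity map, and for $g\in\mathcal C$, $\gamma\in\mathcal X_g$ let $\gamma\cdot s(\gamma)=r(\gamma)$ (so $\gamma\cdot y$ is defined for $y\in\Omega_{s(g)}$ if and only if $y=s(\gamma)$). This defines an $F$-action on $\Omega$, and this $F$-action is universal. The transformation groupoid $\mathcal I(F)\ltimes\Omega$ for the induced action of the inverse semigroup $\mathcal I(F)$ on $\Omega$ is a groupoid model for the diagram $F$.
   Context: Groupoids. All groupoids are topological groupoids $\mathcal G$ (object space $\mathcal G^0\subseteq\mathcal G$, continuous range, source, multiplication, inversion; $gh$ is defined iff $s(g)=r(h)$) that are étale: $r,s$ are local homeomorphisms. No Hausdorff or local compactness assumption is made. A right $\mathcal G$-space is a space $\mathcal X$ with a continuous anchor map $s\colon\mathcal X\to\mathcal G^0$ and a continuous map $\{(x,g): s(x)=r(g)\}\to\mathcal X$, $(x,g)\mapsto xg$, with $s(xg)=s(g)$, $(xg_1)g_2=x(g_1g_2)$, $x\,s(x)=x$; left $\mathcal G$-spaces are analogous with anchor map $r$. $\mathcal X/\mathcal G$ is the orbit space with the quotient topology. A right $\mathcal G$-space is basic if $\{(x,g):s(x)=r(g)\}\to\mathcal X\times\mathcal X$, $(x,g)\mapsto(xg,x)$,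 is a homeomorphism onto its image. A groupoid correspondence $\mathcal X\colon\mathcal H\leftarrow\mathcal G$ is a space with commuting actions of $\mathcal H$ on the left (anchor $r$) and $\mathcal G$ on the right (anchor $s$) such that $s\colon\mathcal X\to\mathcal G^0$ is a local homeomorphism and the right action is basic. (Commuting: $s(hx)=s(x)$, $r(xg)=r(x)$, $(hx)g=h(xg)$.) It is tight if the map $r_*\colon\mathcal X/\mathcal G\to\mathcal H^0$ induced by $r$ is a homeomorphism. For a right $\mathcal G$-space $\mathcal X$ and a left $\mathcal G$-space $\mathcal Y$, $\mathcal X\circ_{\mathcal G}\mathcal Y$ is the orbit space of $\{(x,y):s(x)=r(y)\}$ under $g\cdot(x,y)=(xg^{-1},gy)$; the class of $(x,y)$ is $[x,y]$. For correspondences this is the composite correspondence, with the induced outer actions. Isomorphisms of correspondences are biequivariant homeomorphisms. Diagrams. $\mathcal C$ also denotes the set of arrows, objects $\mathcal C^0$ are identified with identity arrows, $g\colon x\leftarrow y$ means $r(g)=x$, $s(g)=y$. A $\mathcal C$-shaped diagram $F=(\mathcal G_x,\mathcal X_g,\mu_{g,h})$ consists of groupoids $\mathcal G_x$ ($x\in\mathcal C^0$), correspondences $\mathcal X_g\colon\mathcal G_{r(g)}\leftarrow\mathcal G_{s(g)}$ ($g\in\mathcal C$) and isomorphisms of correspondences $\mu_{g,h}\colon\mathcal X_g\circ_{\mathcal G_{s(g)}}\mathcal X_h\to\mathcal X_{gh}$ for composable $g,h$, written $\gamma\cdot\eta=\mu_{g,h}[\gamma,\eta]$, such that $\mathcal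 X_x=\mathcal G_x$ with left and right multiplication for identity arrows $x$, $\mu_{r(g),g}$ and $\mu_{g,s(g)}$ are given by the left and right actions, and the product $\cdot$ is associative. $F$ is tight if all $\mathcal X_g$ are tight. $F$-actions. An $F$-action on a space $Y$ consists of a partition $Y=\bigsqcup_{x\in\mathcal C^0}Y_x$ into clopen subsets, continuous maps $r\colon Y_x\to\mathcal G_x^0$, and open, continuous, surjective maps $\{(\gamma,y)\in\mathcal X_g\times Y_{s(g)}: s(\gamma)=r(y)\}\to Y_{r(g)}$, $(\gamma,y)\mapsto\gamma\cdot y$, for all $g\in\mathcal C$, such that (i) $r(\gamma_2\cdot y)=r(\gamma_2)$ and $\gamma_1\cdot(\gamma_2\cdot y)=(\gamma_1\cdot\gamma_2)\cdot y$ for composable $g_1,g_2$, $\gamma_i\in\mathcal X_{g_i}$, $y\in Y_{s(g_2)}$ with $s(\gamma_1)=r(\gamma_2)$, $s(\gamma_2)=r(y)$; (ii) if $\gamma\cdot y=\gamma'\cdot y'$ with $\gamma,\gamma'\in\mathcal X_g$, $y,y'\in Y_{s(g)}$, then there is $\eta\in\mathcal G_{s(g)}$ with $\gamma'=\gamma\eta$ and $y=\eta y'$. A continuous map $\varphi\colon Y\to Y'$ between $F$-actions is $F$-equivariant if $\varphi(Y_x)\subseteq Y'_x$, $r(\varphi(y))=r(y)$ and $\varphi(\gamma\cdot y)=\gamma\cdot\varphi(y)$ whenever defined. An $F$-action $\Omega$ is universal if every $F$-action $Y$ admits a unique $F$-equivariant continuous map $Y\to\Omega$. A groupoid model for $F$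 is an étale groupoid $\mathcal U$ with natural bijections, for all spaces $Y$, between left $\mathcal U$-actions and $F$-actions on $Y$; naturality means that a continuous map $Y\to Y'$ is $\mathcal U$-equivariant iff it is $F$-equivariant. The inverse semigroup $\mathcal I(F)$. For $\xi_1,\xi_2$ in a correspondence $\mathcal X\colon \mathcal H\leftarrow\mathcal G$ with the same class in $\mathcal X/\mathcal G$, $\langle\xi_1|\xi_2\rangle$ is the unique $\gamma\in\mathcal G$ with $\xi_2=\xi_1\gamma$. A slice of $\mathcal X$ is an open subset on which both $s$ and the projection $\mathcal X\to\mathcal X/\mathcal G$ are injective. $\mathrm{Bis}(\mathcal X_g)$ is the set of slices of $\mathcal X_g$; $\mathrm{Bis}(F)$ is the disjoint union of all $\mathrm{Bis}(\mathcal X_g)$, $g\in\mathcal C$, with all empty slices identified. For $U\in\mathrm{Bis}(\mathcal X_g)$, $V\in\mathrm{Bis}(\mathcal X_h)$, let $UV=\{\gamma\cdot\eta:\gamma\in U,\eta\in V,s(\gamma)=r(\eta)\}\in\mathrm{Bis}(\mathcal X_{gh})$ if $g,h$ are composable and $UV=\emptyset$ otherwise. For $U_1,U_2\in\mathrm{Bis}(\mathcal X_g)$, $\langle U_1|U_2\rangle=\{\langle x|y\rangle:x\in U_1,y\in U_2,[x]=[y]\text{ in }\mathcal X_g/\mathcal G_{s(g)}\}\in\mathrm{Bis}(\mathcal G_{s(g)})$. $\mathcal I(F)$ is the universal inverse semigroup generated by symbols $\Theta(U)$, $U\in\mathrm{Bis}(F)$, with relations $\Theta(UV)=\Theta(U)\Theta(V)$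 for all $U,V\in\mathrm{Bis}(F)$ and $\Theta(U_1)^*\Theta(U_2)=\Theta(\langle U_1|U_2\rangle)$ for all $g\in\mathcal C$, $U_1,U_2\in\mathrm{Bis}(\mathcal X_g)$. An action of an inverse semigroup $S$ on a space $Y$ is a homomorphism $\vartheta\colon S\to I(Y)$, where $I(Y)$ is the inverse semigroup of homeomorphisms between open subsets of $Y$. An $F$-action on $Y$ induces an action $\vartheta$ of $\mathcal I(F)$ on $Y$: for $U\in\mathrm{Bis}(\mathcal X_g)$, $\vartheta(\Theta(U))$ has domain $\{y\in Y_{s(g)}:r(y)\in s(U)\}$ and maps $y$ to $\gamma\cdot y$ for the unique $\gamma\in U$ with $s(\gamma)=r(y)$. Transformation groupoid. $S\ltimes Y$ has object space $Y$ and arrows the classes $[t,y]$ of pairs with $t\in S$, $y\in\mathrm{dom}(\vartheta_t)$, where $(t,y)\sim(u,y')$ iff $y=y'$ and there is an idempotent $e\in S$ with $y\in\mathrm{dom}(\vartheta_e)$ and $te=ue$; $s[t,y]=y$, $r[t,y]=\vartheta_t(y)$, $[u,\vartheta_t(y)]\cdot[t,y]=[ut,y]$; the sets $\{[t,y]:y\in W\}$ for $t\in S$ and $W\subseteq\mathrm{dom}(\vartheta_t)$ open form a basis of its (étale) topology. *)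

theory Defs
  imports "HOL-Analysis.Analysis"
begin

section \<open>Topological preliminaries\<close>

definition local_homeomorphism :: "'a topology \<Rightarrow> 'b topology \<Rightarrow> ('a \<Rightarrow> 'b) \<Rightarrow> bool" where
  "local_homeomorphism X Y f \<longleftrightarrow>
     (\<forall>x\<in>topspace X. \<exists>U. openin X U \<and> x \<in> U \<and> openin Y (f ` U) \<and>
        homeomorphic_map (subtopology X U) (subtopology Y (f ` U)) f)"

definition quotient_topology :: "'a topology \<Rightarrow> ('a \<Rightarrow> 'b) \<Rightarrow> 'b topology" where
  "quotient_topology X q =
     topology (\<lambda>V. V \<subseteq> q ` topspace X \<and> openin X {x \<in> topspace X. q x \<in> V})"

lemma openin_quotient_topology:
  "openin (quotient_topology X q) V \<longleftrightarrow>
     V \<subseteq> q ` topspace X \<and> openin X {x \<in> topspace X. q x \<in> V}"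
proof -
  have "istopology (\<lambda>V. V \<subseteq> q ` topspace X \<and> openin X {x \<in> topspace X. q x \<in> V})"
    unfolding istopology_def
  proof (rule conjI; intro allI impI)
    fix S T assume
      S: "S \<subseteq> q ` topspace X \<and> openin X {x \<in> topspace X. q x \<in> S}" and
      T: "T \<subseteq> q ` topspace X \<and> openin X {x \<in> topspace X. q x \<in> T}"
    have "{x \<in> topspace X. q x \<in> S \<inter> T} =
        {x \<in> topspace X. q x \<in> S} \<inter> {x \<in> topspace X. q x \<in> T}" by blast
    moreover have "openin X ({x \<in> topspace X. q x \<in> S} \<inter> {x \<in> topspace X. q x \<in> T})"
      using S T by (intro openin_Int) blast+
    ultimately show "S \<inter> T \<subseteq> q ` topspace X \<and> openin X {x \<in> topspace X. q x \<in> S \<inter> T}"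
      using S by (simp only: simp_thms) blast
  next
    fix K assume K: "\<forall>S\<in>K. S \<subseteq> q ` topspace X \<and> openin X {x \<in> topspace X. q x \<in> S}"
    have "{x \<in> topspace X. q x \<in> \<Union>K} = \<Union>((\<lambda>S. {x \<in> topspace X. q x \<in> S}) ` K)" by blast
    moreover have "openin X (\<Union>((\<lambda>S. {x \<in> topspace X. q x \<in> S}) ` K))"
      using K by (intro openin_Union) blast
    ultimately show "\<Union>K \<subseteq> q ` topspace X \<and> openin X {x \<in> topspace X. q x \<in> \<Union>K}"
      using K by (simp only: simp_thms) blast
  qed
  then show ?thesis by (simp add: quotient_topology_def)
qed


section \<open>Small categories and etale groupoids\<close>

text \<open>Categories and groupoids are given by their arrows; objects are identified with identity
  arrows. The composite of \<open>g\<close> and \<open>h\<close> is meaningful if \<open>src g = rng h\<close>.\<close>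

record 'a category =
  arr :: "'a set"
  src :: "'a \<Rightarrow> 'a"
  rng :: "'a \<Rightarrow> 'a"
  cmp :: "'a \<Rightarrow> 'a \<Rightarrow> 'a"

definition obj :: "('a, 'z) category_scheme \<Rightarrow> 'a set" where
  "obj C = {x \<in> arr C. src C x = x}"

definition small_category :: "('a, 'z) category_scheme \<Rightarrow> bool" where
  "small_category C \<longleftrightarrow>
     (\<forall>g\<in>arr C. src C g \<in> arr C \<and> rng C g \<in> arr C \<and>
        src C (src C g) = src C g \<and> rng C (src C g) = src C g \<and>
        src C (rng C g) = rng C g \<and> rng C (rng C g) = rng C g \<and>
        cmp C (rng C g) g = g \<and> cmp C g (src C g) = g) \<and>
     (\<forall>g\<in>arr C. \<forall>h\<in>arr C. src C g = rng C h \<longrightarrow>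
        cmp C g h \<in> arr C \<and> src C (cmp C g h) = src C h \<and> rng C (cmp C g h) = rng C g) \<and>
     (\<forall>g\<in>arr C. \<forall>h\<in>arr C. \<forall>k\<in>arr C. src C g = rng C h \<and> src C h = rng C k \<longrightarrow>
        cmp C (cmp C g h) k = cmp C g (cmp C h k))"

record 'a tgroupoid = "'a category" +
  gtop :: "'a topology"
  ginv :: "'a \<Rightarrow> 'a"

definition unit_space :: "'a tgroupoid \<Rightarrow> 'a topology" where
  "unit_space G = subtopology (gtop G) (obj G)"

definition etale_groupoid :: "'a tgroupoid \<Rightarrow> bool" where
  "etale_groupoid G \<longleftrightarrow>
     small_category G \<and> topspace (gtop G) = arr G \<and>
     (\<forall>g\<in>arr G. ginv G g \<in> arr G \<and> src G (ginv G g) = rng G g \<and> rng G (ginv G g) = src G g \<and>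
        cmp G g (ginv G g) = rng G g \<and> cmp G (ginv G g) g = src G g) \<and>
     continuous_map (gtop G) (unit_space G) (rng G) \<and>
     continuous_map (gtop G) (unit_space G) (src G) \<and>
     continuous_map (subtopology (prod_topology (gtop G) (gtop G)) {(g, h). src G g = rng G h})
       (gtop G) (\<lambda>(g, h). cmp G g h) \<and>
     continuous_map (gtop G) (gtop G) (ginv G) \<and>
     local_homeomorphism (gtop G) (unit_space G) (rng G) \<and>
     local_homeomorphism (gtop G) (unit_space G) (src G)"


section \<open>Groupoid actions and orbit spaces\<close>

definition right_space ::
  "'g tgroupoid \<Rightarrow> 'x topology \<Rightarrow> ('x \<Rightarrow> 'g) \<Rightarrow> ('x \<Rightarrow> 'g \<Rightarrow> 'x) \<Rightarrow> bool" where
  "right_space G X s act \<longleftrightarrow>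
     continuous_map X (unit_space G) s \<and>
     continuous_map (subtopology (prod_topology X (gtop G)) {(x, g). s x = rng G g})
       X (\<lambda>(x, g). act x g) \<and>
     (\<forall>x\<in>topspace X. \<forall>g\<in>arr G. s x = rng G g \<longrightarrow> s (act x g) = src G g) \<and>
     (\<forall>x\<in>topspace X. \<forall>g\<in>arr G. \<forall>h\<in>arr G. s x = rng G g \<and> src G g = rng G h \<longrightarrow>
        act (act x g) h = act x (cmp G g h)) \<and>
     (\<forall>x\<in>topspace X. act x (s x) = x)"

definition left_space ::
  "'h tgroupoid \<Rightarrow> 'x topology \<Rightarrow> ('x \<Rightarrow> 'h) \<Rightarrow> ('h \<Rightarrow> 'x \<Rightarrow> 'x) \<Rightarrow> bool" where
  "left_space H X r act \<longleftrightarrow>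
     continuous_map X (unit_space H) r \<and>
     continuous_map (subtopology (prod_topology (gtop H) X) {(h, x). src H h = r x})
       X (\<lambda>(h, x). act h x) \<and>
     (\<forall>x\<in>topspace X. \<forall>h\<in>arr H. src H h = r x \<longrightarrow> r (act h x) = rng H h) \<and>
     (\<forall>x\<in>topspace X. \<forall>g\<in>arr H. \<forall>h\<in>arr H. src H g = rng H h \<and> src H h = r x \<longrightarrow>
        act g (act h x) = act (cmp H g h) x) \<and>
     (\<forall>x\<in>topspace X. act (r x) x = x)"

definition right_orbit :: "'g tgroupoid \<Rightarrow> ('x \<Rightarrow> 'g) \<Rightarrow> ('x \<Rightarrow> 'g \<Rightarrow> 'x) \<Rightarrow> 'x \<Rightarrow> 'x set" where
  "right_orbit G s act x = {act x g | g. g \<in> arr G \<and> s x = rng G g}"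

definition orbit_space ::
  "'g tgroupoid \<Rightarrow> 'x topology \<Rightarrow> ('x \<Rightarrow> 'g) \<Rightarrow> ('x \<Rightarrow> 'g \<Rightarrow> 'x) \<Rightarrow> 'x set topology" where
  "orbit_space G X s act = quotient_topology X (right_orbit G s act)"

definition basic_action ::
  "'g tgroupoid \<Rightarrow> 'x topology \<Rightarrow> ('x \<Rightarrow> 'g) \<Rightarrow> ('x \<Rightarrow> 'g \<Rightarrow> 'x) \<Rightarrow> bool" where
  "basic_action G X s act \<longleftrightarrow>
     embedding_map (subtopology (prod_topology X (gtop G)) {(x, g). s x = rng G g})
       (prod_topology X X) (\<lambda>(x, g). (act x g, x))"


section \<open>Groupoid correspondences\<close>

text \<open>In \<open>('h, 'x, 'g) corr\<close>, the left anchor map is the map called \<open>r\<close> and the right anchor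
  map is the map called \<open>s\<close> in the literature.\<close>

record ('h, 'x, 'g) corr =
  ctop :: "'x topology"
  ranch :: "'x \<Rightarrow> 'h"
  sanch :: "'x \<Rightarrow> 'g"
  lact :: "'h \<Rightarrow> 'x \<Rightarrow> 'x"
  ract :: "'x \<Rightarrow> 'g \<Rightarrow> 'x"

definition correspondence :: "'h tgroupoid \<Rightarrow> ('h, 'x, 'g) corr \<Rightarrow> 'g tgroupoid \<Rightarrow> bool" where
  "correspondence H X G \<longleftrightarrow>
     left_space H (ctop X) (ranch X) (lact X) \<and>
     right_space G (ctop X) (sanch X) (ract X) \<and>
     (\<forall>x\<in>topspace (ctop X). \<forall>h\<in>arr H. src H h = ranch X x \<longrightarrow>
        sanch X (lact X h x) = sanch X x) \<and>
     (\<forall>x\<in>topspace (ctop X). \<forall>g\<in>arr G. sanch X x = rng G g \<longrightarrow>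
        ranch X (ract X x g) = ranch X x) \<and>
     (\<forall>x\<in>topspace (ctop X). \<forall>h\<in>arr H. \<forall>g\<in>arr G. src H h = ranch X x \<and> sanch X x = rng G g \<longrightarrow>
        ract X (lact X h x) g = lact X h (ract X x g)) \<and>
     local_homeomorphism (ctop X) (unit_space G) (sanch X) \<and>
     basic_action G (ctop X) (sanch X) (ract X)"

abbreviation corr_orbit :: "'g tgroupoid \<Rightarrow> ('h, 'x, 'g) corr \<Rightarrow> 'x \<Rightarrow> 'x set" where
  "corr_orbit G X \<equiv> right_orbit G (sanch X) (ract X)"

abbreviation corr_orbit_space :: "'g tgroupoid \<Rightarrow> ('h, 'x, 'g) corr \<Rightarrow> 'x set topology" where
  "corr_orbit_space G X \<equiv> orbit_space G (ctop X) (sanch X) (ract X)"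

text \<open>The left anchor map is constant on right orbits, so evaluating it on a representative
  gives the map induced on the orbit space.\<close>

definition induced_ranch :: "('h, 'x, 'g) corr \<Rightarrow> 'x set \<Rightarrow> 'h" where
  "induced_ranch X c = ranch X (SOME x. x \<in> c)"

definition tight :: "'h tgroupoid \<Rightarrow> ('h, 'x, 'g) corr \<Rightarrow> 'g tgroupoid \<Rightarrow> bool" where
  "tight H X G \<longleftrightarrow> homeomorphic_map (corr_orbit_space G X) (unit_space H) (induced_ranch X)"

text \<open>The class of \<open>(x, y)\<close> in the composite correspondence, that is, its orbit under
  \<open>g \<cdot> (x, y) = (x g\<inverse>, g y)\<close>.\<close>

definition comp_class ::
  "'g tgroupoid \<Rightarrow> ('h, 'x, 'g) corr \<Rightarrow> ('g, 'y, 'k) corr \<Rightarrow> 'x \<Rightarrow> 'y \<Rightarrow> ('x \<times> 'y) set" where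
  "comp_class G X Y x y = {(ract X x (ginv G g), lact Y g y) | g. g \<in> arr G \<and> src G g = ranch Y y}"

text \<open>The outer anchor maps and actions do not depend on the choice of representatives.\<close>

definition comp_corr ::
  "'g tgroupoid \<Rightarrow> ('h, 'x, 'g) corr \<Rightarrow> ('g, 'y, 'k) corr \<Rightarrow> ('h, ('x \<times> 'y) set, 'k) corr" where
  "comp_corr G X Y =
    \<lparr> ctop = quotient_topology
        (subtopology (prod_topology (ctop X) (ctop Y)) {(x, y). sanch X x = ranch Y y})
        (\<lambda>(x, y). comp_class G X Y x y),
      ranch = (\<lambda>c. ranch X (fst (SOME p. p \<in> c))),
      sanch = (\<lambda>c. sanch Y (snd (SOME p. p \<in> c))),
      lact = (\<lambda>h c. let (x, y) = (SOME p. p \<in> c) in comp_class G X Y (lact X h x) y),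
      ract = (\<lambda>c k. let (x, y) = (SOME p. p \<in> c) in comp_class G X Y x (ract Y y k)) \<rparr>"

definition corr_iso ::
  "'h tgroupoid \<Rightarrow> ('h, 'x, 'g) corr \<Rightarrow> ('h, 'y, 'g) corr \<Rightarrow> 'g tgroupoid \<Rightarrow> ('x \<Rightarrow> 'y) \<Rightarrow> bool" where
  "corr_iso H X Y G f \<longleftrightarrow>
     homeomorphic_map (ctop X) (ctop Y) f \<and>
     (\<forall>x\<in>topspace (ctop X). ranch Y (f x) = ranch X x \<and> sanch Y (f x) = sanch X x) \<and>
     (\<forall>x\<in>topspace (ctop X). \<forall>h\<in>arr H. src H h = ranch X x \<longrightarrow> f (lact X h x) = lact Y h (f x)) \<and>
     (\<forall>x\<in>topspace (ctop X). \<forall>g\<in>arr G. sanch X x = rng G g \<longrightarrow> f (ract X x g) = ract Y (f x) g)"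


section \<open>Diagrams of groupoid correspondences\<close>

text \<open>All groupoids and correspondences in a diagram have their points in one type \<open>'a\<close>; the
  carriers for different indices need not be related. The function \<open>mu\<close> is indexed by pairs of
  composable arrows.\<close>

record ('c, 'a) diag =
  grp :: "'c \<Rightarrow> 'a tgroupoid"
  cor :: "'c \<Rightarrow> ('a, 'a, 'a) corr"
  mu :: "'c \<Rightarrow> 'c \<Rightarrow> ('a \<times> 'a) set \<Rightarrow> 'a"

abbreviation cpts :: "('c, 'a) diag \<Rightarrow> 'c \<Rightarrow> 'a set" where
  "cpts F g \<equiv> topspace (ctop (cor F g))"

definition dprod :: "'c category \<Rightarrow> ('c, 'a) diag \<Rightarrow> 'c \<Rightarrow> 'c \<Rightarrow> 'a \<Rightarrow> 'a \<Rightarrow> 'a" where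
  "dprod C F g h \<gamma> \<eta> = mu F g h (comp_class (grp F (src C g)) (cor F g) (cor F h) \<gamma> \<eta>)"

definition diagram :: "'c category \<Rightarrow> ('c, 'a) diag \<Rightarrow> bool" where
  "diagram C F \<longleftrightarrow>
     (\<forall>x\<in>obj C. etale_groupoid (grp F x)) \<and>
     (\<forall>g\<in>arr C. correspondence (grp F (rng C g)) (cor F g) (grp F (src C g))) \<and>
     (\<forall>g\<in>arr C. \<forall>h\<in>arr C. src C g = rng C h \<longrightarrow>
        corr_iso (grp F (rng C g)) (comp_corr (grp F (src C g)) (cor F g) (cor F h))
          (cor F (cmp C g h)) (grp F (src C h)) (mu F g h)) \<and>
     (\<forall>x\<in>obj C. ctop (cor F x) = gtop (grp F x) \<and>
        (\<forall>\<gamma>\<in>arr (grp F x). ranch (cor F x) \<gamma> = rng (grp F x) \<gamma> \<and>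
                           sanch (cor F x) \<gamma> = src (grp F x) \<gamma>) \<and>
        (\<forall>\<gamma>\<in>arr (grp F x). \<forall>\<eta>\<in>arr (grp F x). src (grp F x) \<gamma> = rng (grp F x) \<eta> \<longrightarrow>
           lact (cor F x) \<gamma> \<eta> = cmp (grp F x) \<gamma> \<eta> \<and> ract (cor F x) \<gamma> \<eta> = cmp (grp F x) \<gamma> \<eta>)) \<and>
     (\<forall>g\<in>arr C. \<forall>\<gamma>\<in>arr (grp F (rng C g)). \<forall>\<eta>\<in>cpts F g.
        src (grp F (rng C g)) \<gamma> = ranch (cor F g) \<eta> \<longrightarrow>
        dprod C F (rng C g) g \<gamma> \<eta> = lact (cor F g) \<gamma> \<eta>) \<and>
     (\<forall>g\<in>arr C. \<forall>\<gamma>\<in>cpts F g. \<forall>\<eta>\<in>arr (grp F (src C g)).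
        sanch (cor F g) \<gamma> = rng (grp F (src C g)) \<eta> \<longrightarrow>
        dprod C F g (src C g) \<gamma> \<eta> = ract (cor F g) \<gamma> \<eta>) \<and>
     (\<forall>g\<in>arr C. \<forall>h\<in>arr C. \<forall>k\<in>arr C. src C g = rng C h \<and> src C h = rng C k \<longrightarrow>
        (\<forall>\<gamma>\<in>cpts F g. \<forall>\<eta>\<in>cpts F h. \<forall>\<zeta>\<in>cpts F k.
           sanch (cor F g) \<gamma> = ranch (cor F h) \<eta> \<and> sanch (cor F h) \<eta> = ranch (cor F k) \<zeta> \<longrightarrow>
           dprod C F (cmp C g h) k (dprod C F g h \<gamma> \<eta>) \<zeta> =
           dprod C F g (cmp C h k) \<gamma> (dprod C F h k \<eta> \<zeta>)))"

definition tight_diagram :: "'c category \<Rightarrow> ('c, 'a) diag \<Rightarrow> bool" where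
  "tight_diagram C F \<longleftrightarrow>
     diagram C F \<and> (\<forall>g\<in>arr C. tight (grp F (rng C g)) (cor F g) (grp F (src C g)))"


section \<open>Actions of diagrams\<close>

text \<open>The anchor maps on the pieces of the partition are combined into one function.\<close>

record ('c, 'a, 'y) faction =
  part :: "'c \<Rightarrow> 'y set"
  fanch :: "'y \<Rightarrow> 'a"
  fmul :: "'c \<Rightarrow> 'a \<Rightarrow> 'y \<Rightarrow> 'y"

definition fdom ::
  "'c category \<Rightarrow> ('c, 'a) diag \<Rightarrow> ('c, 'a, 'y) faction \<Rightarrow> 'c \<Rightarrow> ('a \<times> 'y) set" where
  "fdom C F A g =
     {(\<gamma>, y). \<gamma> \<in> cpts F g \<and> y \<in> part A (src C g) \<and> sanch (cor F g) \<gamma> = fanch A y}"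

definition F_action ::
  "'c category \<Rightarrow> ('c, 'a) diag \<Rightarrow> 'y topology \<Rightarrow> ('c, 'a, 'y) faction \<Rightarrow> bool" where
  "F_action C F Y A \<longleftrightarrow>
     (\<Union>x\<in>obj C. part A x) = topspace Y \<and> disjoint_family_on (part A) (obj C) \<and>
     (\<forall>x\<in>obj C. openin Y (part A x) \<and> closedin Y (part A x)) \<and>
     (\<forall>x\<in>obj C. continuous_map (subtopology Y (part A x)) (unit_space (grp F x)) (fanch A)) \<and>
     (\<forall>g\<in>arr C.
        (let D = subtopology (prod_topology (ctop (cor F g)) Y) (fdom C F A g);
             E = subtopology Y (part A (rng C g));
             m = (\<lambda>(\<gamma>, y). fmul A g \<gamma> y)
         in continuous_map D E m \<and> open_map D E m \<and> m ` topspace D = topspace E)) \<and>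
     (\<forall>g\<in>arr C. \<forall>(\<gamma>, y)\<in>fdom C F A g. fanch A (fmul A g \<gamma> y) = ranch (cor F g) \<gamma>) \<and>
     (\<forall>g\<in>arr C. \<forall>h\<in>arr C. src C g = rng C h \<longrightarrow>
        (\<forall>\<gamma>\<in>cpts F g. \<forall>(\<eta>, y)\<in>fdom C F A h. sanch (cor F g) \<gamma> = ranch (cor F h) \<eta> \<longrightarrow>
           fmul A g \<gamma> (fmul A h \<eta> y) = fmul A (cmp C g h) (dprod C F g h \<gamma> \<eta>) y)) \<and>
     (\<forall>g\<in>arr C. \<forall>(\<gamma>, y)\<in>fdom C F A g. \<forall>(\<gamma>', y')\<in>fdom C F A g.
        fmul A g \<gamma> y = fmul A g \<gamma>' y' \<longrightarrow>
        (\<exists>\<eta>\<in>arr (grp F (src C g)).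
           sanch (cor F g) \<gamma> = rng (grp F (src C g)) \<eta> \<and> \<gamma>' = ract (cor F g) \<gamma> \<eta> \<and>
           src (grp F (src C g)) \<eta> = fanch A y' \<and> y = fmul A (src C g) \<eta> y'))"

definition F_equivariant ::
  "'c category \<Rightarrow> ('c, 'a) diag \<Rightarrow> ('c, 'a, 'y) faction \<Rightarrow> ('c, 'a, 'z) faction \<Rightarrow> ('y \<Rightarrow> 'z) \<Rightarrow> bool"
  where
  "F_equivariant C F A B \<phi> \<longleftrightarrow>
     (\<forall>x\<in>obj C. \<phi> ` part A x \<subseteq> part B x) \<and>
     (\<forall>x\<in>obj C. \<forall>y\<in>part A x. fanch B (\<phi> y) = fanch A y) \<and>
     (\<forall>g\<in>arr C. \<forall>(\<gamma>, y)\<in>fdom C F A g. \<phi> (fmul A g \<gamma> y) = fmul B g \<gamma> (\<phi> y))"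

text \<open>Here and in \<open>groupoid_model\<close> below, ``all spaces'' means all topologies on
  subsets of the type given by the last argument, which is left arbitrary in theorems.
  Spaces over different types are compared by embedding both types into a sum type.
  Maps out of a space are made unique as functions by requiring extensionality.\<close>

definition universal_F_action ::
  "'c category \<Rightarrow> ('c, 'a) diag \<Rightarrow> 'w topology \<Rightarrow> ('c, 'a, 'w) faction \<Rightarrow> 'y itself \<Rightarrow> bool" where
  "universal_F_action C F W B (_ :: 'y itself) \<longleftrightarrow>
     F_action C F W B \<and>
     (\<forall>(Y :: 'y topology) A. F_action C F Y A \<longrightarrow>
        (\<exists>!\<phi>. \<phi> \<in> extensional (topspace Y) \<and> continuous_map Y W \<phi> \<and> F_equivariant C F A B \<phi>))"


section \<open>Groupoid models\<close>

record ('u, 'y) gaction =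
  ganch :: "'y \<Rightarrow> 'u"
  gact :: "'u \<Rightarrow> 'y \<Rightarrow> 'y"

text \<open>To count actions correctly, the functions describing them are normalised outside the sets
  where they are meaningful.\<close>

definition left_actions :: "'u tgroupoid \<Rightarrow> 'y topology \<Rightarrow> ('u, 'y) gaction set" where
  "left_actions U Y =
     {a. left_space U Y (ganch a) (gact a) \<and> ganch a \<in> extensional (topspace Y) \<and>
        (\<forall>u y. \<not> (u \<in> arr U \<and> y \<in> topspace Y \<and> src U u = ganch a y) \<longrightarrow> gact a u y = undefined)}"

definition F_actions ::
  "'c category \<Rightarrow> ('c, 'a) diag \<Rightarrow> 'y topology \<Rightarrow> ('c, 'a, 'y) faction set" where
  "F_actions C F Y =
     {A. F_action C F Y A \<and> (\<forall>x. x \<notin> obj C \<longrightarrow> part A x = {}) \<and>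
        fanch A \<in> extensional (topspace Y) \<and>
        (\<forall>g \<gamma> y. \<not> (g \<in> arr C \<and> (\<gamma>, y) \<in> fdom C F A g) \<longrightarrow> fmul A g \<gamma> y = undefined)}"

definition G_equivariant ::
  "'u tgroupoid \<Rightarrow> 'y topology \<Rightarrow> ('u, 'y) gaction \<Rightarrow> ('u, 'z) gaction \<Rightarrow> ('y \<Rightarrow> 'z) \<Rightarrow> bool" where
  "G_equivariant U Y a b \<phi> \<longleftrightarrow>
     (\<forall>y\<in>topspace Y. ganch b (\<phi> y) = ganch a y) \<and>
     (\<forall>u\<in>arr U. \<forall>y\<in>topspace Y. src U u = ganch a y \<longrightarrow> \<phi> (gact a u y) = gact b u (\<phi> y))"

definition groupoid_model ::
  "'c category \<Rightarrow> ('c, 'a) diag \<Rightarrow> 'u tgroupoid \<Rightarrow> 'y itself \<Rightarrow> bool" where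
  "groupoid_model C F U (_ :: 'y itself) \<longleftrightarrow>
     etale_groupoid U \<and>
     (\<exists>\<beta> :: 'y topology \<Rightarrow> ('u, 'y) gaction \<Rightarrow> ('c, 'a, 'y) faction.
        (\<forall>Y. bij_betw (\<beta> Y) (left_actions U Y) (F_actions C F Y)) \<and>
        (\<forall>Y Y'. \<forall>a\<in>left_actions U Y. \<forall>a'\<in>left_actions U Y'. \<forall>\<phi>. continuous_map Y Y' \<phi> \<longrightarrow>
           (G_equivariant U Y a a' \<phi> \<longleftrightarrow> F_equivariant C F (\<beta> Y a) (\<beta> Y' a') \<phi>)))"


section \<open>Inverse semigroups given by generators and relations\<close>

record 's invsg =
  elems :: "'s set"
  smul :: "'s \<Rightarrow> 's \<Rightarrow> 's"
  sstar :: "'s \<Rightarrow> 's"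

datatype 'b isg_term = Gen 'b | Mul "'b isg_term" "'b isg_term" | Star "'b isg_term"

text \<open>The congruence on terms generated by \<open>R\<close> and the identities that define
  the variety of inverse semigroups.\<close>

inductive isg_cong :: "('b isg_term \<times> 'b isg_term) set \<Rightarrow> 'b isg_term \<Rightarrow> 'b isg_term \<Rightarrow> bool"
  for R where
  rel: "(t, u) \<in> R \<Longrightarrow> isg_cong R t u"
| refl: "isg_cong R t t"
| sym: "isg_cong R t u \<Longrightarrow> isg_cong R u t"
| trans: "isg_cong R t u \<Longrightarrow> isg_cong R u v \<Longrightarrow> isg_cong R t v"
| mul: "isg_cong R t t' \<Longrightarrow> isg_cong R u u' \<Longrightarrow> isg_cong R (Mul t u) (Mul t' u')"
| star: "isg_cong R t t' \<Longrightarrow> isg_cong R (Star t) (Star t')"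
| assoc: "isg_cong R (Mul (Mul t u) v) (Mul t (Mul u v))"
| star_star: "isg_cong R (Star (Star t)) t"
| star_mul: "isg_cong R (Star (Mul t u)) (Mul (Star u) (Star t))"
| regular: "isg_cong R (Mul (Mul t (Star t)) t) t"
| idem_comm: "isg_cong R (Mul (Mul t (Star t)) (Mul u (Star u))) (Mul (Mul u (Star u)) (Mul t (Star t)))"

definition isg_class ::
  "('b isg_term \<times> 'b isg_term) set \<Rightarrow> 'b isg_term \<Rightarrow> 'b isg_term set" where
  "isg_class R t = {u. isg_cong R t u}"

text \<open>The universal inverse semigroup with generators \<open>A\<close> and relations \<open>R\<close>, where \<open>R\<close> relates
  terms over \<open>A\<close>. As the two sides of each identity above involve the same generators, only terms
  over \<open>A\<close> are congruent to terms over \<open>A\<close>.\<close>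

definition presented_isg ::
  "'b set \<Rightarrow> ('b isg_term \<times> 'b isg_term) set \<Rightarrow> 'b isg_term set invsg" where
  "presented_isg A R =
    \<lparr> elems = {isg_class R t | t. set_isg_term t \<subseteq> A},
      smul = (\<lambda>a b. isg_class R (Mul (SOME t. t \<in> a) (SOME u. u \<in> b))),
      sstar = (\<lambda>a. isg_class R (Star (SOME t. t \<in> a))) \<rparr>"


section \<open>The inverse semigroup of a diagram and its actions\<close>

definition slices :: "'c category \<Rightarrow> ('c, 'a) diag \<Rightarrow> 'c \<Rightarrow> 'a set set" where
  "slices C F g = {U. openin (ctop (cor F g)) U \<and> inj_on (sanch (cor F g)) U \<and>
                      inj_on (corr_orbit (grp F (src C g)) (cor F g)) U}"

text \<open>In the disjoint union of the sets of slices, all empty slices are identified: \<open>None\<close> is the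
  empty slice.\<close>

type_synonym ('c, 'a) bis = "('c \<times> 'a set) option"

definition mk_bis :: "'c \<Rightarrow> 'a set \<Rightarrow> ('c, 'a) bis" where
  "mk_bis g U = (if U = {} then None else Some (g, U))"

definition Bis :: "'c category \<Rightarrow> ('c, 'a) diag \<Rightarrow> ('c, 'a) bis set" where
  "Bis C F = {mk_bis g U | g U. g \<in> arr C \<and> U \<in> slices C F g}"

fun bis_mul :: "'c category \<Rightarrow> ('c, 'a) diag \<Rightarrow> ('c, 'a) bis \<Rightarrow> ('c, 'a) bis \<Rightarrow> ('c, 'a) bis" where
  "bis_mul C F (Some (g, U)) (Some (h, V)) =
     (if src C g = rng C h
      then mk_bis (cmp C g h)
        {dprod C F g h \<gamma> \<eta> | \<gamma> \<eta>. \<gamma> \<in> U \<and> \<eta> \<in> V \<and> sanch (cor F g) \<gamma> = ranch (cor F h) \<eta>}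
      else None)"
| "bis_mul C F None V = None"
| "bis_mul C F (Some U) None = None"

definition inner_pt :: "'g tgroupoid \<Rightarrow> ('h, 'x, 'g) corr \<Rightarrow> 'x \<Rightarrow> 'x \<Rightarrow> 'g" where
  "inner_pt G X x y = (THE \<gamma>. \<gamma> \<in> arr G \<and> sanch X x = rng G \<gamma> \<and> y = ract X x \<gamma>)"

definition inner_slice :: "'g tgroupoid \<Rightarrow> ('h, 'x, 'g) corr \<Rightarrow> 'x set \<Rightarrow> 'x set \<Rightarrow> 'g set" where
  "inner_slice G X U V =
     {inner_pt G X x y | x y. x \<in> U \<and> y \<in> V \<and> corr_orbit G X x = corr_orbit G X y}"

definition I_rels ::
  "'c category \<Rightarrow> ('c, 'a) diag \<Rightarrow> (('c, 'a) bis isg_term \<times> ('c, 'a) bis isg_term) set" where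
  "I_rels C F =
     {(Gen (bis_mul C F u v), Mul (Gen u) (Gen v)) | u v. u \<in> Bis C F \<and> v \<in> Bis C F} \<union>
     {(Mul (Star (Gen (mk_bis g U))) (Gen (mk_bis g V)),
       Gen (mk_bis (src C g) (inner_slice (grp F (src C g)) (cor F g) U V))) | g U V.
        g \<in> arr C \<and> U \<in> slices C F g \<and> V \<in> slices C F g}"

definition I_sg :: "'c category \<Rightarrow> ('c, 'a) diag \<Rightarrow> ('c, 'a) bis isg_term set invsg" where
  "I_sg C F = presented_isg (Bis C F) (I_rels C F)"

text \<open>Partial maps on a space are represented by their graphs \<open>{(y, \<theta> y). y \<in> dom \<theta>}\<close>, so
  the inverse is the converse relation.\<close>

fun slice_graph ::
  "'c category \<Rightarrow> ('c, 'a) diag \<Rightarrow> ('c, 'a, 'y) faction \<Rightarrow> ('c, 'a) bis \<Rightarrow> ('y \<times> 'y) set" where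
  "slice_graph C F A None = {}"
| "slice_graph C F A (Some (g, U)) = {(y, fmul A g \<gamma> y) | \<gamma> y. \<gamma> \<in> U \<and> (\<gamma>, y) \<in> fdom C F A g}"

primrec term_graph :: "('b \<Rightarrow> ('y \<times> 'y) set) \<Rightarrow> 'b isg_term \<Rightarrow> ('y \<times> 'y) set" where
  "term_graph \<theta> (Gen b) = \<theta> b"
| "term_graph \<theta> (Mul t u) = term_graph \<theta> u O term_graph \<theta> t"
| "term_graph \<theta> (Star t) = (term_graph \<theta> t)\<inverse>"

text \<open>The homomorphic extension of \<open>slice_graph\<close> from the generators; congruent terms have the same
  graph, so the union below is the graph of any representative.\<close>

definition induced_action ::
  "'c category \<Rightarrow> ('c, 'a) diag \<Rightarrow> ('c, 'a, 'y) faction \<Rightarrow>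
    ('c, 'a) bis isg_term set \<Rightarrow> ('y \<times> 'y) set" where
  "induced_action C F A a = (\<Union>t\<in>a. term_graph (slice_graph C F A) t)"


section \<open>Transformation groupoids\<close>

definition idems :: "'s invsg \<Rightarrow> 's set" where
  "idems S = {e \<in> elems S. smul S e e = e}"

definition germ :: "'s invsg \<Rightarrow> ('s \<Rightarrow> ('y \<times> 'y) set) \<Rightarrow> 's \<Rightarrow> 'y \<Rightarrow> ('s \<times> 'y) set" where
  "germ S \<theta> t y = {(u, y) | u. u \<in> elems S \<and> y \<in> Domain (\<theta> u) \<and>
                      (\<exists>e\<in>idems S. y \<in> Domain (\<theta> e) \<and> smul S t e = smul S u e)}"

definition app :: "('y \<times> 'y) set \<Rightarrow> 'y \<Rightarrow> 'y" where
  "app f y = (THE z. (y, z) \<in> f)"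

text \<open>A point \<open>y\<close> of the object space is identified with the unit arrow \<open>[e, y]\<close> for any
  idempotent \<open>e\<close> with \<open>y\<close> in its domain; in particular, \<open>e = t\<^sup>* t\<close> is used for the source and
  \<open>e = t t\<^sup>*\<close> for the range of \<open>[t, y]\<close>. The operations do not depend on the choice of
  representatives.\<close>

definition transformation_groupoid ::
  "'s invsg \<Rightarrow> 'y topology \<Rightarrow> ('s \<Rightarrow> ('y \<times> 'y) set) \<Rightarrow> ('s \<times> 'y) set tgroupoid" where
  "transformation_groupoid S Y \<theta> =
    \<lparr> arr = {germ S \<theta> t y | t y. t \<in> elems S \<and> y \<in> Domain (\<theta> t)},
      src = (\<lambda>a. let (t, y) = (SOME p. p \<in> a) in germ S \<theta> (smul S (sstar S t) t) y),
      rng = (\<lambda>a. let (t, y) = (SOME p. p \<in> a) in germ S \<theta> (smul S t (sstar S t)) (app (\<theta> t) y)),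
      cmp = (\<lambda>b a. let (u, z) = (SOME p. p \<in> b); (t, y) = (SOME p. p \<in> a)
                   in germ S \<theta> (smul S u t) y),
      gtop = topology_generated_by
        {germ S \<theta> t ` W | t W. t \<in> elems S \<and> openin Y W \<and> W \<subseteq> Domain (\<theta> t)},
      ginv = (\<lambda>a. let (t, y) = (SOME p. p \<in> a) in germ S \<theta> (sstar S t) (app (\<theta> t) y)) \<rparr>"


section \<open>The action on the disjoint union of the object spaces\<close>

definition Omega :: "'c category \<Rightarrow> ('c, 'a) diag \<Rightarrow> ('c \<times> 'a) topology" where
  "Omega C F = sum_topology (\<lambda>x. unit_space (grp F x)) (obj C)"

text \<open>The map \<open>fmul\<close> is only relevant if its argument in the space is \<open>(src C g, sanch (cor F g) \<gamma>)\<close>.\<close>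

definition Omega_action :: "'c category \<Rightarrow> ('c, 'a) diag \<Rightarrow> ('c, 'a, 'c \<times> 'a) faction" where
  "Omega_action C F =
    \<lparr> part = (\<lambda>x. {x} \<times> topspace (unit_space (grp F x))),
      fanch = snd,
      fmul = (\<lambda>g \<gamma> y. (rng C g, ranch (cor F g) \<gamma>)) \<rparr>"

end

theory Submission
  imports Defs
begin

text \<open>
Write \<open>\<U> = I(F) \<ltimes> \<Omega>\<close> for the transformation groupoid, \<open>X\<^sub>g\<close> for the correspondence and \<open>G\<^sub>x\<close> for the groupoid
of the diagram at an arrow \<open>g\<close> and an object \<open>x\<close>.

\<^bold>\<open>What tightness gives.\<close> For a tight correspondence the left anchor map \<open>r\<close> is open and onto the unit space, and
\<open>r \<gamma> = r \<gamma>'\<close> holds if and only if \<open>\<gamma>' = \<gamma> \<eta>\<close> for some \<open>\<eta>\<close>. On \<open>\<Omega>\<close>, the product map of the action is \<open>r\<close> on \<open>X\<^sub>g\<close>,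
so these three properties are the openness, surjectivity and cancellation axioms of an \<open>F\<close>-action
(\<open>F_action_Omega\<close>). An equivariant map \<open>Y \<rightarrow> \<Omega>\<close> has to preserve the piece of the partition and the anchor of a point,
and these are the two coordinates of a point of \<open>\<Omega>\<close>. So \<open>y \<mapsto> (x, r y)\<close> for \<open>y \<in> Y\<^sub>x\<close> is the only such map
(\<open>F_equivariant_to_Omega_iff\<close>).

\<^bold>\<open>The groupoid.\<close> On the space of any \<open>F\<close>-action, a slice acts by a homeomorphism between open subsets, and the
defining relations of \<open>I(F)\<close> hold for these partial maps; so \<open>I(F)\<close> acts (\<open>slice_graph_rels\<close>). The transformation
groupoid of an inverse semigroup action is etale (\<open>etale_transformation_groupoid\<close>). In \<open>\<U>\<close>, each \<open>\<gamma> \<in> X\<^sub>g\<close> defines an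
arrow from \<open>s \<gamma>\<close> to \<open>r \<gamma>\<close>, the germ of any slice through \<open>\<gamma>\<close>. The resulting maps \<open>arrow g : X\<^sub>g \<rightarrow> \<U>\<close> are continuous,
open and multiplicative, and their images generate \<open>\<U>\<close> (\<open>arrow_induct\<close>).

\<^bold>\<open>From \<open>\<U>\<close>-actions to \<open>F\<close>-actions.\<close> Let \<open>\<gamma>\<close> act as \<open>arrow g \<gamma>\<close>. The product map is open because \<open>arrow g\<close> is open
and the action of an etale groupoid is an open map. If \<open>\<gamma> \<cdot> y = \<gamma>' \<cdot> y'\<close>, then \<open>r \<gamma> = r \<gamma>'\<close>, so tightness gives
\<open>\<gamma>' = \<gamma> \<eta>\<close>; cancelling the invertible arrow of \<open>\<gamma>\<close> gives \<open>y = \<eta> \<cdot> y'\<close> (\<open>F_action_A\<close>).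

\<^bold>\<open>From \<open>F\<close>-actions to \<open>\<U>\<close>-actions.\<close> Let \<open>\<phi> : Y \<rightarrow> \<Omega>\<close> be the equivariant map, and let a germ \<open>[t, \<phi> y]\<close> act on \<open>y\<close> as \<open>t\<close>
does. This makes sense if \<open>t\<close> is defined at \<open>y\<close> whenever it is defined at \<open>\<phi> y\<close>, and if germs at \<open>\<phi> y\<close> are not coarser
than germs at \<open>y\<close>. Both follow once the domain of each \<open>t \<in> I(F)\<close> on \<open>Y\<close> is the preimage of its domain on \<open>\<Omega>\<close>, the
second because two elements have the same germ if they agree on an idempotent that is defined at the point. The
statement about domains is proved by induction over words, together with the same statement for ranges; for the
range of a slice it rests on tightness (\<open>slice_graph_to_Omega\<close>, \<open>term_graph_to_Omega\<close>).

\<^bold>\<open>Naturality.\<close> The arrows of \<open>\<U>\<close> with which a map commutes are closed under products and inverses. Since the arrows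
of the \<open>X\<^sub>g\<close> generate \<open>\<U>\<close>, equivariance for \<open>F\<close> and for \<open>\<U>\<close> are the same (\<open>equivariant_iff\<close>). For the identity map
this says that a \<open>\<U>\<close>-action is determined by its \<open>F\<close>-action.
\<close>

section \<open>Open maps and local homeomorphisms\<close>

text \<open>A fibre product along an open map projects openly to the other factor. In the form below, the
  relation \<open>D\<close> need not be a fibre product; saturations of open sets and preimages under partial maps are
  shown to be open by writing them as such projections.\<close>

lemma openin_fst_image_of_fibred:
  assumes W: "openin (subtopology (prod_topology X Y) D) W"
    and D: "\<And>V. openin Y V \<Longrightarrow> openin X {x \<in> topspace X. \<exists>y\<in>V. (x, y) \<in> D}"
  shows "openin X (fst ` W)"
proof (subst openin_subopen, intro ballI)
  fix x assume "x \<in> fst ` W"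
  then obtain y where xy: "(x, y) \<in> W" by force
  obtain T where T: "openin (prod_topology X Y) T" "W = T \<inter> D"
    using W by (auto simp: openin_subtopology)
  have xyT: "(x, y) \<in> T" using xy T(2) by blast
  obtain U V where UV: "openin X U" "openin Y V" "x \<in> U" "y \<in> V" "U \<times> V \<subseteq> T"
    using T(1) xyT unfolding openin_prod_topology_alt by metis
  have "U \<inter> {x \<in> topspace X. \<exists>y\<in>V. (x, y) \<in> D} \<subseteq> fst ` W"
    using UV(5) T(2) by force
  moreover have "x \<in> U \<inter> {x \<in> topspace X. \<exists>y\<in>V. (x, y) \<in> D}"
    using UV(3,4) xy T(2) openin_subset[OF UV(1)] by blast
  ultimately show "\<exists>T. openin X T \<and> x \<in> T \<and> T \<subseteq> fst ` W"
    using openin_Int[OF UV(1) D[OF UV(2)]] by blast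
qed

lemma openin_snd_image_of_fibred:
  assumes W: "openin (subtopology (prod_topology X Y) D) W"
    and D: "\<And>U. openin X U \<Longrightarrow> openin Y {y \<in> topspace Y. \<exists>x\<in>U. (x, y) \<in> D}"
  shows "openin Y (snd ` W)"
proof (subst openin_subopen, intro ballI)
  fix y assume "y \<in> snd ` W"
  then obtain x where xy: "(x, y) \<in> W" by force
  obtain T where T: "openin (prod_topology X Y) T" "W = T \<inter> D"
    using W by (auto simp: openin_subtopology)
  have xyT: "(x, y) \<in> T" using xy T(2) by blast
  obtain U V where UV: "openin X U" "openin Y V" "x \<in> U" "y \<in> V" "U \<times> V \<subseteq> T"
    using T(1) xyT unfolding openin_prod_topology_alt by metis
  have "V \<inter> {y \<in> topspace Y. \<exists>x\<in>U. (x, y) \<in> D} \<subseteq> snd ` W"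
    using UV(5) T(2) by force
  moreover have "y \<in> V \<inter> {y \<in> topspace Y. \<exists>x\<in>U. (x, y) \<in> D}"
    using UV(3,4) xy T(2) openin_subset[OF UV(2)] by blast
  ultimately show "\<exists>T. openin Y T \<and> y \<in> T \<and> T \<subseteq> snd ` W"
    using openin_Int[OF UV(2) D[OF UV(1)]] by blast
qed

lemma local_homeomorphism_imp_open_map:
  assumes "local_homeomorphism X Y f"
  shows "open_map X Y f"
  unfolding open_map_def
proof (intro allI impI)
  fix U assume U: "openin X U"
  show "openin Y (f ` U)"
  proof (subst openin_subopen, intro ballI)
    fix y assume "y \<in> f ` U"
    then obtain x where x: "x \<in> U" "y = f x" by blast
    then obtain V where V: "openin X V" "x \<in> V" "openin Y (f ` V)"
      "homeomorphic_map (subtopology X V) (subtopology Y (f ` V)) f"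
      using assms openin_subset[OF U] unfolding local_homeomorphism_def by blast
    have "openin (subtopology X V) (U \<inter> V)" using U by (rule openin_subtopology_Int)
    then have "openin (subtopology Y (f ` V)) (f ` (U \<inter> V))"
      using V(4) by (simp add: homeomorphic_eq_everything_map open_map_def)
    then have "openin Y (f ` (U \<inter> V))" using V(3) by (rule openin_trans_full)
    then show "\<exists>T. openin Y T \<and> y \<in> T \<and> T \<subseteq> f ` U" using x V(2) by blast
  qed
qed

lemma local_homeomorphism_imp_locally_inj:
  assumes "local_homeomorphism X Y f" "x \<in> topspace X"
  obtains U where "openin X U" "x \<in> U" "inj_on f U"
proof -
  obtain V where V: "openin X V" "x \<in> V"
      "homeomorphic_map (subtopology X V) (subtopology Y (f ` V)) f"
    using assms unfolding local_homeomorphism_def by blast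
  have "inj_on f V"
    using V(3) openin_subset[OF V(1)] by (simp add: homeomorphic_eq_everything_map Int_absorb1)
  then show ?thesis using V that by blast
qed

lemma local_homeomorphismI:
  assumes cont: "continuous_map X Y f" and "open": "open_map X Y f"
    and inj: "\<And>x. x \<in> topspace X \<Longrightarrow> \<exists>U. openin X U \<and> x \<in> U \<and> inj_on f U"
  shows "local_homeomorphism X Y f"
  unfolding local_homeomorphism_def
proof
  fix x assume "x \<in> topspace X"
  then obtain U where U: "openin X U" "x \<in> U" "inj_on f U" using inj by blast
  have oU: "openin Y (f ` U)" using "open" U(1) by (simp add: open_map_def)
  have sub: "U \<subseteq> topspace X" "f ` U \<subseteq> topspace Y"
    using U(1) oU by (auto dest: openin_subset)
  have "open_map (subtopology X U) (subtopology Y (f ` U)) f"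
    unfolding open_map_def
  proof (intro allI impI)
    fix V assume "openin (subtopology X U) V"
    then have "openin X V" "V \<subseteq> U" using U(1) by (auto simp: openin_open_subtopology)
    then show "openin (subtopology Y (f ` U)) (f ` V)"
      using "open" oU by (auto simp: openin_open_subtopology open_map_def)
  qed
  then have "homeomorphic_map (subtopology X U) (subtopology Y (f ` U)) f"
    using sub U(3) cont
    by (auto simp: homeomorphic_eq_everything_map bijective_open_imp_closed_map Int_absorb1
        continuous_map_in_subtopology continuous_map_from_subtopology intro!: bijective_open_imp_closed_map)
  then show "\<exists>U. openin X U \<and> x \<in> U \<and> openin Y (f ` U) \<and>
        homeomorphic_map (subtopology X U) (subtopology Y (f ` U)) f"
    using U oU by blast
qed


section \<open>Inverse semigroups acting by partial homeomorphisms\<close>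

locale inverse_semigroup =
  fixes S :: "'s invsg"
  assumes mul_closed: "t \<in> elems S \<Longrightarrow> u \<in> elems S \<Longrightarrow> smul S t u \<in> elems S"
    and star_closed: "t \<in> elems S \<Longrightarrow> sstar S t \<in> elems S"
    and assoc: "t \<in> elems S \<Longrightarrow> u \<in> elems S \<Longrightarrow> v \<in> elems S \<Longrightarrow>
      smul S (smul S t u) v = smul S t (smul S u v)"
    and star_star: "t \<in> elems S \<Longrightarrow> sstar S (sstar S t) = t"
    and star_mul: "t \<in> elems S \<Longrightarrow> u \<in> elems S \<Longrightarrow>
      sstar S (smul S t u) = smul S (sstar S u) (sstar S t)"
    and regular: "t \<in> elems S \<Longrightarrow> smul S (smul S t (sstar S t)) t = t"
    and range_idem_comm: "t \<in> elems S \<Longrightarrow> u \<in> elems S \<Longrightarrow>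
      smul S (smul S t (sstar S t)) (smul S u (sstar S u)) =
      smul S (smul S u (sstar S u)) (smul S t (sstar S t))"
begin

abbreviation mult (infixl "\<odot>" 70) where "t \<odot> u \<equiv> smul S t u"
abbreviation inverse_elem ("_\<^sup>\<star>" [1000] 999) where "t\<^sup>\<star> \<equiv> sstar S t"

lemma idem_elems: "e \<in> idems S \<Longrightarrow> e \<in> elems S" by (simp add: idems_def)

lemma idem_square: "e \<in> idems S \<Longrightarrow> e \<odot> e = e" by (simp add: idems_def)

lemma regular_assoc: "t \<in> elems S \<Longrightarrow> t \<odot> (t\<^sup>\<star> \<odot> t) = t"
  using regular[of t] assoc[of t "t\<^sup>\<star>" t] by (simp add: star_closed)

lemma regular_star: "t \<in> elems S \<Longrightarrow> t\<^sup>\<star> \<odot> (t \<odot> t\<^sup>\<star>) = t\<^sup>\<star>"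
  using regular_assoc[of "t\<^sup>\<star>"] by (simp add: star_closed star_star)

lemma range_idem: "t \<in> elems S \<Longrightarrow> t \<odot> t\<^sup>\<star> \<in> idems S"
  using assoc[of "t \<odot> t\<^sup>\<star>" t "t\<^sup>\<star>"] by (simp add: idems_def mul_closed star_closed regular)

lemma source_idem: "t \<in> elems S \<Longrightarrow> t\<^sup>\<star> \<odot> t \<in> idems S"
  using range_idem[of "t\<^sup>\<star>"] by (simp add: star_closed star_star)

text \<open>The axiom on commuting idempotents speaks only of those of the form \<open>t t\<^sup>*\<close>. Every idempotent
  is of this form because it is its own adjoint:
  \<open>e\<^sup>* = e\<^sup>* e e\<^sup>* = (e\<^sup>* e) (e e\<^sup>*) = (e e\<^sup>*) (e\<^sup>* e) = e (e e)\<^sup>* e = e\<close>.\<close>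

lemma idem_star:
  assumes "e \<in> idems S"
  shows "e\<^sup>\<star> = e"
proof -
  have e: "e \<in> elems S" "e \<odot> e = e" "e\<^sup>\<star> \<in> elems S" using assms by (auto simp: idems_def star_closed)
  have "e\<^sup>\<star> = e\<^sup>\<star> \<odot> ((e \<odot> e) \<odot> e\<^sup>\<star>)" using regular_star[OF e(1)] e by simp
  also have "\<dots> = (e\<^sup>\<star> \<odot> e) \<odot> (e \<odot> e\<^sup>\<star>)" using e(1,3) by (simp add: assoc mul_closed)
  also have "\<dots> = (e \<odot> e\<^sup>\<star>) \<odot> (e\<^sup>\<star> \<odot> e)"
    using range_idem_comm[OF e(3,1)] e by (simp add: star_star)
  also have "\<dots> = e \<odot> ((e\<^sup>\<star> \<odot> e\<^sup>\<star>) \<odot> e)" using e(1,3) by (simp add: assoc mul_closed)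
  also have "\<dots> = e \<odot> (e\<^sup>\<star> \<odot> e)" using star_mul[OF e(1) e(1)] e by simp
  also have "\<dots> = e" using regular_assoc[OF e(1)] .
  finally show ?thesis .
qed

lemma idem_comm:
  assumes "e \<in> idems S" "f \<in> idems S"
  shows "e \<odot> f = f \<odot> e"
  using range_idem_comm[of e f] assms by (simp add: idem_star idem_square idem_elems)

lemma idem_mult:
  assumes "e \<in> idems S" "f \<in> idems S"
  shows "e \<odot> f \<in> idems S"
proof -
  have "(e \<odot> f) \<odot> (e \<odot> f) = e \<odot> ((f \<odot> e) \<odot> f)"
    using assms by (simp add: assoc mul_closed idem_elems)
  also have "\<dots> = e \<odot> ((e \<odot> f) \<odot> f)" using idem_comm[OF assms] by simp
  also have "\<dots> = (e \<odot> e) \<odot> (f \<odot> f)" using assms by (simp add: assoc mul_closed idem_elems)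
  finally show ?thesis using assms by (simp add: idems_def mul_closed)
qed

text \<open>The conjugate \<open>t\<^sup>* f t\<close> is what the idempotent \<open>f\<close> becomes when it is moved from the left of \<open>t\<close> to its
  right.\<close>

lemma conjugate_idem:
  assumes t: "t \<in> elems S" and f: "f \<in> idems S"
  shows "t\<^sup>\<star> \<odot> (f \<odot> t) \<in> idems S" and "t \<odot> (t\<^sup>\<star> \<odot> (f \<odot> t)) = f \<odot> t"
proof -
  have c: "f \<in> elems S" "t\<^sup>\<star> \<in> elems S" using t f by (auto simp: idem_elems star_closed)
  have "t \<odot> (t\<^sup>\<star> \<odot> (f \<odot> t)) = ((t \<odot> t\<^sup>\<star>) \<odot> f) \<odot> t" using t c by (simp add: assoc mul_closed)
  also have "\<dots> = (f \<odot> (t \<odot> t\<^sup>\<star>)) \<odot> t" using idem_comm[OF range_idem[OF t] f] by simp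
  also have "\<dots> = f \<odot> ((t \<odot> t\<^sup>\<star>) \<odot> t)" using t c by (simp add: assoc mul_closed)
  also have "\<dots> = f \<odot> t" using regular[OF t] by simp
  finally show *: "t \<odot> (t\<^sup>\<star> \<odot> (f \<odot> t)) = f \<odot> t" .
  have "(t\<^sup>\<star> \<odot> (f \<odot> t)) \<odot> (t\<^sup>\<star> \<odot> (f \<odot> t)) = t\<^sup>\<star> \<odot> (f \<odot> (t \<odot> (t\<^sup>\<star> \<odot> (f \<odot> t))))"
    using t c by (simp add: assoc mul_closed)
  also have "\<dots> = t\<^sup>\<star> \<odot> ((f \<odot> f) \<odot> t)" using * t c by (simp add: assoc mul_closed)
  also have "\<dots> = t\<^sup>\<star> \<odot> (f \<odot> t)" using f by (simp add: idem_square)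
  finally show "t\<^sup>\<star> \<odot> (f \<odot> t) \<in> idems S" using t c by (simp add: idems_def mul_closed)
qed

end

text \<open>For graphs, being a homeomorphism between open subsets is best expressed by saying that images and
  preimages of open sets are open, because this is visibly inherited by composites and converses.\<close>

definition partial_homeo :: "'y topology \<Rightarrow> ('y \<times> 'y) set \<Rightarrow> bool" where
  "partial_homeo Y f \<longleftrightarrow> f \<subseteq> topspace Y \<times> topspace Y \<and> single_valued f \<and> single_valued (f\<inverse>) \<and>
     (\<forall>W. openin Y W \<longrightarrow> openin Y (f `` W) \<and> openin Y (f\<inverse> `` W))"

lemma partial_homeo_relcomp:
  assumes "partial_homeo Y f" "partial_homeo Y g"
  shows "partial_homeo Y (f O g)"
  using assms unfolding partial_homeo_def
  by (auto simp: relcomp_Image converse_relcomp intro: single_valued_relcomp)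

lemma partial_homeo_converse: "partial_homeo Y f \<Longrightarrow> partial_homeo Y (f\<inverse>)"
  unfolding partial_homeo_def by auto

lemma partial_homeo_openin_Domain: "partial_homeo Y f \<Longrightarrow> openin Y (Domain f)"
proof -
  assume f: "partial_homeo Y f"
  then have "f\<inverse> `` topspace Y = Domain f" unfolding partial_homeo_def by blast
  then show ?thesis using f openin_topspace[of Y] unfolding partial_homeo_def by metis
qed

lemma partial_homeo_single:
  "partial_homeo Y f \<Longrightarrow> (y, z) \<in> f \<Longrightarrow> (y, z') \<in> f \<Longrightarrow> z = z'"
  "partial_homeo Y f \<Longrightarrow> (y, z) \<in> f \<Longrightarrow> (y', z) \<in> f \<Longrightarrow> y = y'"
  unfolding partial_homeo_def single_valued_def by auto

lemma partial_homeo_app: "partial_homeo Y f \<Longrightarrow> (y, z) \<in> f \<Longrightarrow> app f y = z"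
  unfolding app_def by (blast intro: the_equality partial_homeo_single)

locale isg_action = inverse_semigroup S
  for S :: "'s invsg" +
  fixes Y :: "'y topology" and \<theta> :: "'s \<Rightarrow> ('y \<times> 'y) set"
  assumes homeo: "t \<in> elems S \<Longrightarrow> partial_homeo Y (\<theta> t)"
    and action_mul: "t \<in> elems S \<Longrightarrow> u \<in> elems S \<Longrightarrow> \<theta> (smul S t u) = \<theta> u O \<theta> t"
    and action_star: "t \<in> elems S \<Longrightarrow> \<theta> (sstar S t) = (\<theta> t)\<inverse>"
    and covers: "y \<in> topspace Y \<Longrightarrow> \<exists>t\<in>elems S. y \<in> Domain (\<theta> t)"
begin

lemmas theta_single = partial_homeo_single[OF homeo]

lemma theta_space: "t \<in> elems S \<Longrightarrow> (y, z) \<in> \<theta> t \<Longrightarrow> y \<in> topspace Y \<and> z \<in> topspace Y"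
  using homeo unfolding partial_homeo_def by blast

lemma theta_Domain_space: "t \<in> elems S \<Longrightarrow> y \<in> Domain (\<theta> t) \<Longrightarrow> y \<in> topspace Y"
  using theta_space by blast

lemma openin_Domain: "t \<in> elems S \<Longrightarrow> openin Y (Domain (\<theta> t))"
  by (simp add: homeo partial_homeo_openin_Domain)

lemma theta_idem: "e \<in> idems S \<Longrightarrow> (y, z) \<in> \<theta> e \<Longrightarrow> z = y"
proof -
  assume e: "e \<in> idems S" and yz: "(y, z) \<in> \<theta> e"
  then have "(y, z) \<in> \<theta> e O \<theta> e" using action_mul[of e e] by (simp add: idem_elems idem_square)
  then obtain w where w: "(y, w) \<in> \<theta> e" "(w, z) \<in> \<theta> e" by blast
  have "w = z" using w yz e by (metis theta_single(1) idem_elems)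
  then show ?thesis using w yz e by (metis theta_single(2) idem_elems)
qed

lemma theta_idem_Domain: "e \<in> idems S \<Longrightarrow> y \<in> Domain (\<theta> e) \<Longrightarrow> (y, y) \<in> \<theta> e"
  using theta_idem by blast

lemma theta_idem_mult:
  assumes "e \<in> idems S" "f \<in> idems S" "y \<in> Domain (\<theta> e)" "y \<in> Domain (\<theta> f)"
  shows "y \<in> Domain (\<theta> (e \<odot> f))"
  using assms theta_idem_Domain[of e y] theta_idem_Domain[of f y]
  by (auto simp: action_mul idem_elems)

text \<open>Germs are compared by the relation below; \<open>germ_eq_iff\<close> identifies it with equality of germs.\<close>

definition germ_equiv :: "'s \<Rightarrow> 's \<Rightarrow> 'y \<Rightarrow> bool" where
  "germ_equiv t u y \<longleftrightarrow> (\<exists>e\<in>idems S. y \<in> Domain (\<theta> e) \<and> t \<odot> e = u \<odot> e)"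

lemma germ_equiv_refl:
  assumes "t \<in> elems S" "y \<in> topspace Y"
  shows "germ_equiv t t y"
proof -
  obtain u z where u: "u \<in> elems S" "(y, z) \<in> \<theta> u" using covers[OF assms(2)] by blast
  then have "y \<in> Domain (\<theta> (u\<^sup>\<star> \<odot> u))" by (auto simp: action_mul action_star star_closed)
  then show ?thesis unfolding germ_equiv_def using source_idem[OF u(1)] by blast
qed

lemma germ_equiv_sym: "germ_equiv t u y \<Longrightarrow> germ_equiv u t y"
  unfolding germ_equiv_def by metis

lemma germ_equiv_trans:
  assumes "t \<in> elems S" "u \<in> elems S" "v \<in> elems S" "germ_equiv t u y" "germ_equiv u v y"
  shows "germ_equiv t v y"
proof -
  obtain e f where e: "e \<in> idems S" "y \<in> Domain (\<theta> e)" "t \<odot> e = u \<odot> e"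
    and f: "f \<in> idems S" "y \<in> Domain (\<theta> f)" "u \<odot> f = v \<odot> f"
    using assms(4,5) unfolding germ_equiv_def by blast
  have c: "e \<in> elems S" "f \<in> elems S" using e f by (auto simp: idem_elems)
  have "t \<odot> (e \<odot> f) = (t \<odot> e) \<odot> f" using assms c by (simp add: assoc)
  also have "\<dots> = u \<odot> (e \<odot> f)" using e assms c by (simp add: assoc)
  also have "\<dots> = (u \<odot> f) \<odot> e" using idem_comm[OF e(1) f(1)] assms c by (simp add: assoc)
  also have "\<dots> = v \<odot> (e \<odot> f)" using f idem_comm[OF e(1) f(1)] assms c by (simp add: assoc)
  finally show ?thesis
    unfolding germ_equiv_def using idem_mult[OF e(1) f(1)] theta_idem_mult[OF e(1) f(1)] e f by blast
qed

lemma germ_equiv_idem: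
  assumes "e \<in> idems S" "f \<in> idems S" "y \<in> Domain (\<theta> e)" "y \<in> Domain (\<theta> f)"
  shows "germ_equiv e f y"
proof -
  have c: "e \<in> elems S" "f \<in> elems S" using assms by (auto simp: idem_elems)
  have "e \<odot> (e \<odot> f) = e \<odot> f" using assoc[of e e f] assms c by (simp add: idem_square)
  moreover have "f \<odot> (e \<odot> f) = e \<odot> f"
    using assoc[of f f e] assms c by (simp add: idem_square idem_comm[of e f])
  ultimately have "e \<odot> (e \<odot> f) = f \<odot> (e \<odot> f)" by simp
  then show ?thesis
    unfolding germ_equiv_def using idem_mult theta_idem_mult assms by blast
qed

lemma germ_equiv_theta:
  assumes "t \<in> elems S" "u \<in> elems S" "germ_equiv t u y" "(y, z) \<in> \<theta> t"
  shows "(y, z) \<in> \<theta> u"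
proof -
  obtain e where e: "e \<in> idems S" "y \<in> Domain (\<theta> e)" "t \<odot> e = u \<odot> e"
    using assms(3) unfolding germ_equiv_def by blast
  have "(y, z) \<in> \<theta> e O \<theta> t" using assms(4) theta_idem_Domain[OF e(1,2)] by blast
  then have "(y, z) \<in> \<theta> (t \<odot> e)" using assms(1) e(1) by (simp add: action_mul idem_elems)
  then have "(y, z) \<in> \<theta> e O \<theta> u"
    unfolding e(3) using assms(2) e(1) by (simp add: action_mul idem_elems)
  then show ?thesis using theta_idem[OF e(1)] by blast
qed

text \<open>Suppose \<open>t e = t' e\<close> and \<open>u f = u' f\<close>. The conjugates \<open>d\<close> and \<open>d'\<close> of \<open>f\<close> by \<open>t\<close> and by \<open>t'\<close> are defined at \<open>y\<close>,
  because \<open>f\<close> is defined at \<open>z\<close>. On the idempotent \<open>d e d'\<close>, both products become \<open>w = u f t e = u' f t' e\<close>.\<close>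

lemma germ_equiv_mult:
  assumes c: "t \<in> elems S" "t' \<in> elems S" "u \<in> elems S" "u' \<in> elems S"
    and t: "germ_equiv t t' y" and u: "germ_equiv u u' z" and yz: "(y, z) \<in> \<theta> t"
  shows "germ_equiv (u \<odot> t) (u' \<odot> t') y"
proof -
  obtain e where e: "e \<in> idems S" "y \<in> Domain (\<theta> e)" "t \<odot> e = t' \<odot> e"
    using t unfolding germ_equiv_def by blast
  obtain f where f: "f \<in> idems S" "z \<in> Domain (\<theta> f)" "u \<odot> f = u' \<odot> f"
    using u unfolding germ_equiv_def by blast
  have yz': "(y, z) \<in> \<theta> t'" using germ_equiv_theta[OF c(1,2) t yz] .
  define d where "d = t\<^sup>\<star> \<odot> (f \<odot> t)"
  define d' where "d' = t'\<^sup>\<star> \<odot> (f \<odot> t')"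
  have d: "d \<in> idems S" "t \<odot> d = f \<odot> t" using conjugate_idem[OF c(1) f(1)] by (auto simp: d_def)
  have d': "d' \<in> idems S" "t' \<odot> d' = f \<odot> t'" using conjugate_idem[OF c(2) f(1)] by (auto simp: d'_def)
  have cc: "e \<in> elems S" "f \<in> elems S" "d \<in> elems S" "d' \<in> elems S"
    using e f d d' by (auto simp: idem_elems)
  have zz: "(z, z) \<in> \<theta> f" using theta_idem_Domain[OF f(1,2)] .
  have yd: "y \<in> Domain (\<theta> d)"
    unfolding d_def using c cc yz zz by (auto simp: action_mul action_star star_closed mul_closed)
  have yd': "y \<in> Domain (\<theta> d')"
    unfolding d'_def using c cc yz' zz by (auto simp: action_mul action_star star_closed mul_closed)
  define w where "w = u \<odot> (f \<odot> (t \<odot> e))"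
  have w': "w = u' \<odot> (f \<odot> (t' \<odot> e))"
    using assoc[of u f "t \<odot> e"] assoc[of u' f "t' \<odot> e"] e(3) f(3) c cc
    by (simp add: w_def mul_closed)
  have de: "d \<odot> e = e \<odot> d" "d' \<odot> e = e \<odot> d'" "d' \<odot> d = d \<odot> d'" using idem_comm e d d' by auto
  have A: "(u \<odot> t) \<odot> (d \<odot> e) = w"
  proof -
    have "(u \<odot> t) \<odot> (d \<odot> e) = u \<odot> ((t \<odot> d) \<odot> e)" using c cc by (simp add: assoc mul_closed)
    then show ?thesis using d(2) c cc by (simp add: assoc mul_closed w_def)
  qed
  have A': "(u' \<odot> t') \<odot> (d' \<odot> e) = w"
  proof -
    have "(u' \<odot> t') \<odot> (d' \<odot> e) = u' \<odot> ((t' \<odot> d') \<odot> e)" using c cc by (simp add: assoc mul_closed)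
    then show ?thesis using d'(2) c cc by (simp add: assoc mul_closed w')
  qed
  have B: "w \<odot> d = w"
  proof -
    have "w \<odot> d = (u \<odot> t) \<odot> ((d \<odot> e) \<odot> d)" using A c cc by (metis assoc mul_closed)
    also have "(d \<odot> e) \<odot> d = d \<odot> e" using de cc by (metis assoc idem_square d(1))
    finally show ?thesis using A by simp
  qed
  have B': "w \<odot> d' = w"
  proof -
    have "w \<odot> d' = (u' \<odot> t') \<odot> ((d' \<odot> e) \<odot> d')" using A' c cc by (metis assoc mul_closed)
    also have "(d' \<odot> e) \<odot> d' = d' \<odot> e" using de cc by (metis assoc idem_square d'(1))
    finally show ?thesis using A' by simp
  qed
  have "(u \<odot> t) \<odot> ((d \<odot> e) \<odot> d') = w"
    using A B' c cc by (metis assoc mul_closed)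
  moreover have "(u' \<odot> t') \<odot> ((d' \<odot> e) \<odot> d) = w"
    using A' B c cc by (metis assoc mul_closed)
  moreover have "(d' \<odot> e) \<odot> d = (d \<odot> e) \<odot> d'"
    using de cc by (metis assoc)
  ultimately have "(u \<odot> t) \<odot> ((d \<odot> e) \<odot> d') = (u' \<odot> t') \<odot> ((d \<odot> e) \<odot> d')" by simp
  moreover have "(d \<odot> e) \<odot> d' \<in> idems S" using d d' e by (simp add: idem_mult)
  moreover have "y \<in> Domain (\<theta> ((d \<odot> e) \<odot> d'))"
    using d d' e yd yd' by (intro theta_idem_mult idem_mult) auto
  ultimately show ?thesis unfolding germ_equiv_def by blast
qed

text \<open>If \<open>t e = u e\<close>, then \<open>t e t\<^sup>* = u e u\<^sup>*\<close>, and \<open>t\<^sup>*\<close> and \<open>u\<^sup>*\<close> agree on this idempotent.\<close>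

lemma germ_equiv_star:
  assumes c: "t \<in> elems S" "u \<in> elems S" and tu: "germ_equiv t u y" and yz: "(y, z) \<in> \<theta> t"
  shows "germ_equiv (t\<^sup>\<star>) (u\<^sup>\<star>) z"
proof -
  obtain e where e: "e \<in> idems S" "y \<in> Domain (\<theta> e)" "t \<odot> e = u \<odot> e"
    using tu unfolding germ_equiv_def by blast
  have ee: "e\<^sup>\<star> = e" "e \<in> elems S" using e by (auto simp: idem_star idem_elems)
  have eq: "e \<odot> t\<^sup>\<star> = e \<odot> u\<^sup>\<star>"
    using star_mul[of t e] star_mul[of u e] e(3) c ee by simp
  have X: "v\<^sup>\<star> \<odot> (v \<odot> (e \<odot> v\<^sup>\<star>)) = e \<odot> v\<^sup>\<star>" "v \<odot> (e \<odot> v\<^sup>\<star>) \<in> idems S" if "v \<in> elems S" for v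
    using conjugate_idem[of "v\<^sup>\<star>" e] that e by (auto simp: star_closed star_star)
  have same: "t \<odot> (e \<odot> t\<^sup>\<star>) = u \<odot> (e \<odot> u\<^sup>\<star>)"
  proof -
    have "t \<odot> (e \<odot> t\<^sup>\<star>) = (t \<odot> e) \<odot> u\<^sup>\<star>" using eq c ee by (simp add: assoc star_closed)
    then show ?thesis using e(3) c ee by (simp add: assoc star_closed)
  qed
  have "z \<in> Domain (\<theta> (t \<odot> (e \<odot> t\<^sup>\<star>)))"
    using c ee yz theta_idem_Domain[OF e(1,2)]
    by (auto simp: action_mul action_star star_closed mul_closed)
  moreover have "t\<^sup>\<star> \<odot> (t \<odot> (e \<odot> t\<^sup>\<star>)) = u\<^sup>\<star> \<odot> (t \<odot> (e \<odot> t\<^sup>\<star>))"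
    using X(1)[OF c(1)] X(1)[OF c(2)] eq same by simp
  ultimately show ?thesis unfolding germ_equiv_def using X(2)[OF c(1)] by blast
qed

end

section \<open>The transformation groupoid of an inverse semigroup action\<close>

context isg_action
begin

abbreviation TG where "TG \<equiv> transformation_groupoid S Y \<theta>"
abbreviation gm where "gm \<equiv> germ S \<theta>"

lemma germ_alt:
  "gm t y = {(u, y) | u. u \<in> elems S \<and> y \<in> Domain (\<theta> u) \<and> germ_equiv t u y}"
  unfolding germ_def germ_equiv_def ..

lemma germ_eq_iff:
  assumes "t \<in> elems S" "y \<in> Domain (\<theta> t)" "u \<in> elems S" "y' \<in> Domain (\<theta> u)"
  shows "gm t y = gm u y' \<longleftrightarrow> y = y' \<and> germ_equiv t u y"
proof
  assume "gm t y = gm u y'"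
  moreover have "(u, y') \<in> gm u y'"
    using assms germ_equiv_refl theta_Domain_space by (auto simp: germ_alt)
  ultimately have "(u, y') \<in> gm t y" by simp
  then show "y = y' \<and> germ_equiv t u y" by (simp add: germ_alt)
next
  assume *: "y = y' \<and> germ_equiv t u y"
  then have "germ_equiv t v y \<longleftrightarrow> germ_equiv u v y" if "v \<in> elems S" for v
    using germ_equiv_trans germ_equiv_sym assms that by meson
  then show "gm t y = gm u y'" using * by (auto simp: germ_alt)
qed

lemma germ_representative:
  assumes "t \<in> elems S" "(y, z) \<in> \<theta> t"
  obtains u where "(SOME p. p \<in> gm t y) = (u, y)" "u \<in> elems S" "(y, z) \<in> \<theta> u" "germ_equiv t u y"
proof -
  have "(t, y) \<in> gm t y"
    using assms germ_equiv_refl theta_space by (auto simp: germ_alt)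
  then have "(SOME p. p \<in> gm t y) \<in> gm t y" by (rule someI)
  then obtain u where "(SOME p. p \<in> gm t y) = (u, y)" "u \<in> elems S" "germ_equiv t u y"
    by (auto simp: germ_alt)
  then show ?thesis using that germ_equiv_theta assms by blast
qed

text \<open>The unit arrow at \<open>y\<close>. All idempotents whose domain contains \<open>y\<close> have the same germ at \<open>y\<close>, so the
  choice does not matter.\<close>

definition unit_germ :: "'y \<Rightarrow> ('s \<times> 'y) set" where
  "unit_germ y = gm (SOME e. e \<in> idems S \<and> y \<in> Domain (\<theta> e)) y"

lemma idem_at:
  assumes "y \<in> topspace Y"
  obtains e where "e \<in> idems S" "y \<in> Domain (\<theta> e)"
proof -
  obtain u z where u: "u \<in> elems S" "(y, z) \<in> \<theta> u" using covers[OF assms] by blast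
  then have "y \<in> Domain (\<theta> (u\<^sup>\<star> \<odot> u))" by (auto simp: action_mul action_star star_closed)
  then show ?thesis using that source_idem[OF u(1)] by blast
qed

lemma unit_germ_eq:
  assumes "e \<in> idems S" "y \<in> Domain (\<theta> e)"
  shows "unit_germ y = gm e y"
proof -
  have "(SOME e. e \<in> idems S \<and> y \<in> Domain (\<theta> e)) \<in> idems S \<and>
      y \<in> Domain (\<theta> (SOME e. e \<in> idems S \<and> y \<in> Domain (\<theta> e)))"
    by (rule someI) (use assms in blast)
  then show ?thesis
    unfolding unit_germ_def using assms by (subst germ_eq_iff) (auto simp: idem_elems germ_equiv_idem)
qed

lemma unit_germ_inj: "y \<in> topspace Y \<Longrightarrow> y' \<in> topspace Y \<Longrightarrow> unit_germ y = unit_germ y' \<Longrightarrow> y = y'"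
  by (elim idem_at) (simp add: unit_germ_eq germ_eq_iff idem_elems)

lemma source_germ: "t \<in> elems S \<Longrightarrow> (y, z) \<in> \<theta> t \<Longrightarrow> unit_germ y = gm (t\<^sup>\<star> \<odot> t) y"
  by (rule unit_germ_eq) (auto simp: source_idem action_mul action_star star_closed)

lemma range_germ: "t \<in> elems S \<Longrightarrow> (y, z) \<in> \<theta> t \<Longrightarrow> unit_germ z = gm (t \<odot> t\<^sup>\<star>) z"
  by (rule unit_germ_eq) (auto simp: range_idem action_mul action_star star_closed)

lemma src_germ: "t \<in> elems S \<Longrightarrow> (y, z) \<in> \<theta> t \<Longrightarrow> src TG (gm t y) = unit_germ y"
  by (erule (1) germ_representative)
    (simp add: transformation_groupoid_def source_germ)

lemma rng_germ: "t \<in> elems S \<Longrightarrow> (y, z) \<in> \<theta> t \<Longrightarrow> rng TG (gm t y) = unit_germ z"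
  by (erule (1) germ_representative)
    (simp add: transformation_groupoid_def range_germ partial_homeo_app[OF homeo])

lemma cmp_germ:
  assumes "t \<in> elems S" "(y, z) \<in> \<theta> t" "u \<in> elems S" "(z, w) \<in> \<theta> u"
  shows "cmp TG (gm u z) (gm t y) = gm (u \<odot> t) y"
proof -
  obtain u' where u': "(SOME p. p \<in> gm u z) = (u', z)" "u' \<in> elems S" "(z, w) \<in> \<theta> u'" "germ_equiv u u' z"
    using germ_representative[OF assms(3,4)] .
  obtain t' where t': "(SOME p. p \<in> gm t y) = (t', y)" "t' \<in> elems S" "(y, z) \<in> \<theta> t'" "germ_equiv t t' y"
    using germ_representative[OF assms(1,2)] .
  have "cmp TG (gm u z) (gm t y) = gm (u' \<odot> t') y"
    by (simp add: transformation_groupoid_def t' u')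
  also have "gm (u' \<odot> t') y = gm (u \<odot> t) y"
    using assms u' t' germ_equiv_mult[of t t' u u' y z]
    by (subst germ_eq_iff) (auto simp: mul_closed action_mul intro: germ_equiv_sym)
  finally show ?thesis .
qed

lemma ginv_germ:
  assumes "t \<in> elems S" "(y, z) \<in> \<theta> t"
  shows "ginv TG (gm t y) = gm (t\<^sup>\<star>) z"
proof -
  obtain t' where t': "(SOME p. p \<in> gm t y) = (t', y)" "t' \<in> elems S" "(y, z) \<in> \<theta> t'" "germ_equiv t t' y"
    using germ_representative[OF assms(1,2)] .
  have "ginv TG (gm t y) = gm (t'\<^sup>\<star>) z"
    by (simp add: transformation_groupoid_def t' partial_homeo_app[OF homeo[OF t'(2)] t'(3)])
  also have "gm (t'\<^sup>\<star>) z = gm (t\<^sup>\<star>) z"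
    using assms t' germ_equiv_star[of t t' y z]
    by (subst germ_eq_iff) (auto simp: star_closed action_star intro: germ_equiv_sym)
  finally show ?thesis .
qed

lemma arr_germ: "t \<in> elems S \<Longrightarrow> (y, z) \<in> \<theta> t \<Longrightarrow> gm t y \<in> arr TG"
  by (auto simp: transformation_groupoid_def)

lemma arrE:
  assumes "a \<in> arr TG"
  obtains t y z where "a = gm t y" "t \<in> elems S" "(y, z) \<in> \<theta> t"
  using assms by (auto simp: transformation_groupoid_def)

lemma unit_germ_arr: "y \<in> topspace Y \<Longrightarrow> unit_germ y \<in> arr TG"
  by (erule idem_at) (auto simp: unit_germ_eq idem_elems intro: arr_germ)

lemma src_unit_germ: "y \<in> topspace Y \<Longrightarrow> src TG (unit_germ y) = unit_germ y"
  by (erule idem_at) (metis unit_germ_eq src_germ theta_idem_Domain idem_elems)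

lemma rng_unit_germ: "y \<in> topspace Y \<Longrightarrow> rng TG (unit_germ y) = unit_germ y"
  by (erule idem_at) (metis unit_germ_eq rng_germ theta_idem_Domain idem_elems)

lemma obj_TG: "obj TG = unit_germ ` topspace Y"
proof
  show "obj TG \<subseteq> unit_germ ` topspace Y"
  proof
    fix a assume a: "a \<in> obj TG"
    then obtain t y z where t: "a = gm t y" "t \<in> elems S" "(y, z) \<in> \<theta> t"
      by (auto simp: obj_def elim: arrE)
    then have "a = unit_germ y" using a src_germ by (simp add: obj_def)
    then show "a \<in> unit_germ ` topspace Y" using t theta_space by blast
  qed
  show "unit_germ ` topspace Y \<subseteq> obj TG" by (auto simp: obj_def unit_germ_arr src_unit_germ)
qed

lemma composable_germs:
  assumes "src TG b = rng TG a" "a \<in> arr TG" "b \<in> arr TG"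
  obtains t u y z w where "a = gm t y" "t \<in> elems S" "(y, z) \<in> \<theta> t"
    "b = gm u z" "u \<in> elems S" "(z, w) \<in> \<theta> u"
proof -
  obtain t y z where t: "a = gm t y" "t \<in> elems S" "(y, z) \<in> \<theta> t" using assms by (blast elim: arrE)
  obtain u z' w where u: "b = gm u z'" "u \<in> elems S" "(z', w) \<in> \<theta> u" using assms by (blast elim: arrE)
  have "z' = z"
    using assms(1) t u theta_space by (simp add: src_germ rng_germ unit_germ_inj)
  then show ?thesis using t u that by blast
qed

lemma theta_mul: "t \<in> elems S \<Longrightarrow> u \<in> elems S \<Longrightarrow> (y, z) \<in> \<theta> t \<Longrightarrow> (z, w) \<in> \<theta> u \<Longrightarrow> (y, w) \<in> \<theta> (u \<odot> t)"
  by (auto simp: action_mul)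

lemma theta_star: "t \<in> elems S \<Longrightarrow> (y, z) \<in> \<theta> t \<Longrightarrow> (z, y) \<in> \<theta> (t\<^sup>\<star>)"
  by (auto simp: action_star)

lemma small_category_TG: "small_category TG"
  unfolding small_category_def
proof (intro conjI ballI impI)
  fix g assume "g \<in> arr TG"
  then obtain t y z where t: "g = gm t y" "t \<in> elems S" "(y, z) \<in> \<theta> t" by (blast elim: arrE)
  have yz: "y \<in> topspace Y" "z \<in> topspace Y" using t theta_space by auto
  show "src TG g \<in> arr TG" "rng TG g \<in> arr TG" "src TG (src TG g) = src TG g" "rng TG (src TG g) = src TG g"
    "src TG (rng TG g) = rng TG g" "rng TG (rng TG g) = rng TG g"
    using t yz by (simp_all add: src_germ rng_germ unit_germ_arr src_unit_germ rng_unit_germ)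
  have "cmp TG (gm (t \<odot> t\<^sup>\<star>) z) (gm t y) = gm (t \<odot> t\<^sup>\<star> \<odot> t) y"
    using t by (intro cmp_germ) (auto intro: mul_closed star_closed theta_mul theta_star)
  then show "cmp TG (rng TG g) g = g" using t by (simp add: rng_germ range_germ regular)
  have "cmp TG (gm t y) (gm (t\<^sup>\<star> \<odot> t) y) = gm (t \<odot> (t\<^sup>\<star> \<odot> t)) y"
    using t by (intro cmp_germ) (auto intro: mul_closed star_closed theta_mul theta_star)
  then show "cmp TG g (src TG g) = g" using t by (simp add: src_germ source_germ regular_assoc)
next
  fix g h assume "g \<in> arr TG" "h \<in> arr TG" "src TG g = rng TG h"
  then obtain t u y z w where "h = gm t y" "t \<in> elems S" "(y, z) \<in> \<theta> t"
    "g = gm u z" "u \<in> elems S" "(z, w) \<in> \<theta> u" by (metis composable_germs)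
  moreover have "(y, w) \<in> \<theta> (u \<odot> t)" "u \<odot> t \<in> elems S" using calculation by (auto intro: theta_mul mul_closed)
  ultimately show "cmp TG g h \<in> arr TG" "src TG (cmp TG g h) = src TG h" "rng TG (cmp TG g h) = rng TG g"
    by (simp_all add: cmp_germ src_germ rng_germ arr_germ)
next
  fix g h k assume "g \<in> arr TG" "h \<in> arr TG" "k \<in> arr TG" "src TG g = rng TG h \<and> src TG h = rng TG k"
  then have g': "g \<in> arr TG" "src TG g = rng TG h" and hk: "h \<in> arr TG" "k \<in> arr TG" "src TG h = rng TG k"
    by auto
  obtain t u y z w where t: "k = gm t y" "t \<in> elems S" "(y, z) \<in> \<theta> t"
    "h = gm u z" "u \<in> elems S" "(z, w) \<in> \<theta> u"
    by (rule composable_germs[OF hk(3,2,1)])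
  obtain v w' x where v: "g = gm v w'" "v \<in> elems S" "(w', x) \<in> \<theta> v" by (rule arrE[OF g'(1)])
  have "w' = w"
    using g' t v theta_space by (simp add: src_germ rng_germ unit_germ_inj)
  moreover have "(y, w) \<in> \<theta> (u \<odot> t)" "(z, x) \<in> \<theta> (v \<odot> u)" if "w' = w"
    using t v that by (auto intro: theta_mul)
  ultimately show "cmp TG (cmp TG g h) k = cmp TG g (cmp TG h k)"
    using t v by (simp add: cmp_germ mul_closed assoc)
qed

text \<open>Two bisections \<open>[t, W]\<close> and \<open>[u, V]\<close> that meet at a germ agree near it, since an idempotent on which \<open>t\<close> and \<open>u\<close>
  agree has an open domain. So a neighbourhood of a germ contains a piece of every bisection through it, for
  whichever representative \<open>t\<close> is chosen.\<close>

lemma openin_TG: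
  "openin (gtop TG) N \<longleftrightarrow> N \<subseteq> arr TG \<and>
     (\<forall>t\<in>elems S. \<forall>y\<in>Domain (\<theta> t). gm t y \<in> N \<longrightarrow>
        (\<exists>W. openin Y W \<and> y \<in> W \<and> W \<subseteq> Domain (\<theta> t) \<and> gm t ` W \<subseteq> N))" (is "_ \<longleftrightarrow> ?P N")
proof
  define B where "B = {gm t ` W | t W. t \<in> elems S \<and> openin Y W \<and> W \<subseteq> Domain (\<theta> t)}"
  have top: "gtop TG = topology_generated_by B" by (simp add: transformation_groupoid_def B_def)
  show "?P N" if "openin (gtop TG) N"
  proof -
    have "generate_topology_on B N" using that top openin_topology_generated_by by metis
    then show "?P N"
    proof induction
      case Empty
      then show ?case by simp
    next
      case (Int M N)
      show ?case
      proof (intro conjI ballI impI)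
        show "M \<inter> N \<subseteq> arr TG" using Int by blast
        fix t y assume t: "t \<in> elems S" "y \<in> Domain (\<theta> t)" "gm t y \<in> M \<inter> N"
        obtain V where V: "openin Y V" "y \<in> V" "V \<subseteq> Domain (\<theta> t)" "gm t ` V \<subseteq> M"
          using Int.IH(1) t by blast
        obtain W where W: "openin Y W" "y \<in> W" "W \<subseteq> Domain (\<theta> t)" "gm t ` W \<subseteq> N"
          using Int.IH(2) t by blast
        show "\<exists>W. openin Y W \<and> y \<in> W \<and> W \<subseteq> Domain (\<theta> t) \<and> gm t ` W \<subseteq> M \<inter> N"
          by (rule exI[of _ "V \<inter> W"]) (use V W in auto)
      qed
    next
      case (UN K)
      show ?case
      proof (intro conjI ballI impI)
        show "\<Union>K \<subseteq> arr TG" using UN by blast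
        fix t y assume t: "t \<in> elems S" "y \<in> Domain (\<theta> t)" "gm t y \<in> \<Union>K"
        then obtain k where k: "k \<in> K" "gm t y \<in> k" by blast
        then obtain W where W: "openin Y W" "y \<in> W" "W \<subseteq> Domain (\<theta> t)" "gm t ` W \<subseteq> k"
          using UN.IH[OF k(1)] t(1,2) by meson
        have "gm t ` W \<subseteq> \<Union>K" by (rule order_trans[OF W(4) Union_upper[OF k(1)]])
        then show "\<exists>W. openin Y W \<and> y \<in> W \<and> W \<subseteq> Domain (\<theta> t) \<and> gm t ` W \<subseteq> \<Union>K"
          using W(1-3) by meson
      qed
    next
      case (Basis N)
      then obtain u V where u: "N = gm u ` V" "u \<in> elems S" "openin Y V" "V \<subseteq> Domain (\<theta> u)"
        unfolding B_def by blast
      show ?case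
      proof (intro conjI ballI impI)
        show "N \<subseteq> arr TG" using u arr_germ by blast
        fix t y assume t: "t \<in> elems S" "y \<in> Domain (\<theta> t)" "gm t y \<in> N"
        then obtain y' where y': "y' \<in> V" "gm t y = gm u y'" using u by blast
        then have "y' = y" "germ_equiv t u y" using germ_eq_iff[of t y u y'] t u by auto
        then obtain e where e: "e \<in> idems S" "y \<in> Domain (\<theta> e)" "t \<odot> e = u \<odot> e"
          unfolding germ_equiv_def by blast
        define W where "W = V \<inter> Domain (\<theta> t) \<inter> Domain (\<theta> e)"
        have "openin Y W"
          unfolding W_def using u t e by (intro openin_Int openin_Domain) (auto simp: idem_elems)
        moreover have "gm t x = gm u x" if "x \<in> W" for x
          using that e t u unfolding W_def by (subst germ_eq_iff) (auto simp: germ_equiv_def)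
        then have "gm t ` W \<subseteq> N" unfolding u(1) W_def by blast
        moreover have "y \<in> W" using y'(1) \<open>y' = y\<close> t(2) e(2) by (simp add: W_def)
        moreover have "W \<subseteq> Domain (\<theta> t)" unfolding W_def by blast
        ultimately show "\<exists>W. openin Y W \<and> y \<in> W \<and> W \<subseteq> Domain (\<theta> t) \<and> gm t ` W \<subseteq> N" by blast
      qed
    qed
  qed
  show "openin (gtop TG) N" if N: "?P N"
  proof (subst openin_subopen, intro ballI)
    fix a assume a: "a \<in> N"
    then obtain t y z where t: "a = gm t y" "t \<in> elems S" "(y, z) \<in> \<theta> t" using N by (blast elim: arrE)
    then obtain W where W: "openin Y W" "y \<in> W" "W \<subseteq> Domain (\<theta> t)" "gm t ` W \<subseteq> N"
      using N a by blast
    have "openin (gtop TG) (gm t ` W)"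
      unfolding top by (rule topology_generated_by_Basis) (use W t in \<open>auto simp: B_def\<close>)
    then show "\<exists>T. openin (gtop TG) T \<and> a \<in> T \<and> T \<subseteq> N" using W t by blast
  qed
qed

lemma openin_germ_image:
  assumes "t \<in> elems S" "openin Y W" "W \<subseteq> Domain (\<theta> t)"
  shows "openin (gtop TG) (gm t ` W)"
  unfolding transformation_groupoid_def
  by (simp, rule topology_generated_by_Basis) (use assms in auto)

lemma topspace_TG: "topspace (gtop TG) = arr TG"
proof
  show "topspace (gtop TG) \<subseteq> arr TG" using openin_topspace[of "gtop TG"] openin_TG by blast
  show "arr TG \<subseteq> topspace (gtop TG)"
  proof
    fix a assume "a \<in> arr TG"
    then obtain t y z where t: "a = gm t y" "t \<in> elems S" "(y, z) \<in> \<theta> t" by (blast elim: arrE)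
    then show "a \<in> topspace (gtop TG)"
      using openin_subset[OF openin_germ_image[of t "Domain (\<theta> t)"]] openin_Domain by blast
  qed
qed

lemma openin_germ_vimage:
  assumes t: "t \<in> elems S" and N: "openin (gtop TG) N"
  shows "openin Y {y \<in> Domain (\<theta> t). gm t y \<in> N}"
proof (subst openin_subopen, intro ballI)
  fix y assume "y \<in> {y \<in> Domain (\<theta> t). gm t y \<in> N}"
  then obtain W where "openin Y W \<and> y \<in> W \<and> W \<subseteq> Domain (\<theta> t) \<and> gm t ` W \<subseteq> N"
    using N t unfolding openin_TG by blast
  then show "\<exists>T. openin Y T \<and> y \<in> T \<and> T \<subseteq> {y \<in> Domain (\<theta> t). gm t y \<in> N}" by blast
qed

lemma openin_unit_germ_vimage:
  assumes N: "openin (gtop TG) N"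
  shows "openin Y {y \<in> topspace Y. unit_germ y \<in> N}"
proof (subst openin_subopen, intro ballI)
  fix y assume "y \<in> {y \<in> topspace Y. unit_germ y \<in> N}"
  then have y: "y \<in> topspace Y" "unit_germ y \<in> N" by auto
  then obtain e where e: "e \<in> idems S" "y \<in> Domain (\<theta> e)" using idem_at by blast
  have "{x \<in> Domain (\<theta> e). gm e x \<in> N} \<subseteq> {y \<in> topspace Y. unit_germ y \<in> N}"
    by (simp add: subset_iff unit_germ_eq[OF e(1)] theta_Domain_space[OF idem_elems[OF e(1)]])
  moreover have "y \<in> {x \<in> Domain (\<theta> e). gm e x \<in> N}" using e y by (simp add: unit_germ_eq)
  ultimately show "\<exists>T. openin Y T \<and> y \<in> T \<and> T \<subseteq> {y \<in> topspace Y. unit_germ y \<in> N}"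
    using openin_germ_vimage[OF _ N, of e] e idem_elems by blast
qed

lemma openin_unit_germ_image:
  assumes "openin Y W"
  shows "openin (gtop TG) (unit_germ ` W)"
proof -
  have "unit_germ ` W = (\<Union>e\<in>idems S. gm e ` (W \<inter> Domain (\<theta> e)))" (is "?L = ?R")
  proof
    show "?L \<subseteq> ?R"
    proof
      fix a assume "a \<in> ?L"
      then obtain y where y: "y \<in> W" "a = unit_germ y" by blast
      then obtain e where "e \<in> idems S" "y \<in> Domain (\<theta> e)"
        using idem_at openin_subset[OF assms] by blast
      then show "a \<in> ?R" using y by (auto simp: unit_germ_eq)
    qed
    show "?R \<subseteq> ?L" by (auto simp: unit_germ_eq[symmetric])
  qed
  moreover have "openin (gtop TG) ?R"
    by (intro openin_Union ballI, clarify, intro openin_germ_image openin_Int openin_Domain)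
      (auto simp: idem_elems assms)
  ultimately show ?thesis by simp
qed

lemma openin_obj_TG: "openin (gtop TG) (obj TG)"
  using openin_unit_germ_image[OF openin_topspace] by (simp add: obj_TG)

lemma openin_unit_space_TG: "openin (unit_space TG) N \<longleftrightarrow> openin (gtop TG) N \<and> N \<subseteq> obj TG"
  unfolding unit_space_def by (rule openin_open_subtopology[OF openin_obj_TG])

lemma continuous_src_TG: "continuous_map (gtop TG) (unit_space TG) (src TG)"
  unfolding unit_space_def continuous_map_in_subtopology
proof (intro conjI)
  show "src TG \<in> topspace (gtop TG) \<rightarrow> obj TG"
    using theta_space by (auto simp: topspace_TG obj_TG src_germ elim!: arrE)
  show "continuous_map (gtop TG) (gtop TG) (src TG)"
    unfolding continuous_map_def topspace_TG
  proof (intro conjI allI impI)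
    show "src TG \<in> arr TG \<rightarrow> arr TG" using small_category_TG by (auto simp: small_category_def)
    fix N assume N: "openin (gtop TG) N"
    show "openin (gtop TG) {x \<in> arr TG. src TG x \<in> N}"
      unfolding openin_TG
    proof (intro conjI ballI impI)
      fix t y assume t: "t \<in> elems S" "y \<in> Domain (\<theta> t)" "gm t y \<in> {x \<in> arr TG. src TG x \<in> N}"
      let ?W = "{y \<in> topspace Y. unit_germ y \<in> N} \<inter> Domain (\<theta> t)"
      have "openin Y ?W" using t openin_unit_germ_vimage[OF N] by (simp add: openin_Int openin_Domain)
      moreover have "gm t ` ?W \<subseteq> {x \<in> arr TG. src TG x \<in> N}"
        using t by (auto simp: src_germ intro: arr_germ)
      moreover have "y \<in> ?W" using t theta_space by (auto simp: src_germ)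
      ultimately show "\<exists>W. openin Y W \<and> y \<in> W \<and> W \<subseteq> Domain (\<theta> t) \<and> gm t ` W \<subseteq> {x \<in> arr TG. src TG x \<in> N}"
        by blast
    qed auto
  qed
qed

lemma openin_theta_vimage:
  assumes "t \<in> elems S" "openin Y W"
  shows "openin Y ((\<theta> t)\<inverse> `` W)"
  using homeo[OF assms(1)] assms(2) by (simp add: partial_homeo_def)

lemma continuous_ginv_TG: "continuous_map (gtop TG) (gtop TG) (ginv TG)"
  unfolding continuous_map_def topspace_TG
proof (intro conjI allI impI)
  show "ginv TG \<in> arr TG \<rightarrow> arr TG"
    by (auto elim!: arrE simp: ginv_germ intro!: arr_germ star_closed theta_star)
  fix N assume N: "openin (gtop TG) N"
  show "openin (gtop TG) {x \<in> arr TG. ginv TG x \<in> N}"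
    unfolding openin_TG
  proof (intro conjI ballI impI)
    fix t y assume t: "t \<in> elems S" "y \<in> Domain (\<theta> t)" "gm t y \<in> {x \<in> arr TG. ginv TG x \<in> N}"
    let ?W = "(\<theta> t)\<inverse> `` {z \<in> Domain (\<theta> (t\<^sup>\<star>)). gm (t\<^sup>\<star>) z \<in> N}"
    have "openin Y ?W" using t N by (intro openin_theta_vimage openin_germ_vimage) (auto simp: star_closed)
    moreover have "gm t ` ?W \<subseteq> {x \<in> arr TG. ginv TG x \<in> N}"
      using t by (auto simp: ginv_germ intro: arr_germ)
    moreover have "y \<in> ?W" using t by (auto simp: ginv_germ action_star)
    moreover have "?W \<subseteq> Domain (\<theta> t)" by blast
    ultimately show "\<exists>W. openin Y W \<and> y \<in> W \<and> W \<subseteq> Domain (\<theta> t) \<and> gm t ` W \<subseteq> {x \<in> arr TG. ginv TG x \<in> N}"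
      by blast
  qed auto
qed

lemma ginv_TG:
  assumes "g \<in> arr TG"
  shows "ginv TG g \<in> arr TG" "src TG (ginv TG g) = rng TG g" "rng TG (ginv TG g) = src TG g"
    "cmp TG g (ginv TG g) = rng TG g" "cmp TG (ginv TG g) g = src TG g" "ginv TG (ginv TG g) = g"
proof -
  obtain t y z where t: "g = gm t y" "t \<in> elems S" "(y, z) \<in> \<theta> t" using assms by (blast elim: arrE)
  have t': "t\<^sup>\<star> \<in> elems S" "(z, y) \<in> \<theta> (t\<^sup>\<star>)" using t by (auto intro: star_closed theta_star)
  show "ginv TG g \<in> arr TG" "src TG (ginv TG g) = rng TG g" "rng TG (ginv TG g) = src TG g"
    "cmp TG g (ginv TG g) = rng TG g" "cmp TG (ginv TG g) g = src TG g" "ginv TG (ginv TG g) = g"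
    using t t' by (simp_all add: ginv_germ src_germ rng_germ cmp_germ arr_germ star_star
        range_germ[of t y z] source_germ[of t y z])
qed

lemma continuous_cmp_TG:
  "continuous_map (subtopology (prod_topology (gtop TG) (gtop TG)) {(g, h). src TG g = rng TG h})
       (gtop TG) (\<lambda>(g, h). cmp TG g h)" (is "continuous_map ?D _ _")
  unfolding continuous_map_def
proof (intro conjI allI impI)
  show "(\<lambda>(g, h). cmp TG g h) \<in> topspace ?D \<rightarrow> topspace (gtop TG)"
    using small_category_TG by (auto simp: topspace_TG small_category_def)
  fix N assume N: "openin (gtop TG) N"
  show "openin ?D {p \<in> topspace ?D. (case p of (g, h) \<Rightarrow> cmp TG g h) \<in> N}" (is "openin _ ?M")
  proof (subst openin_subopen, intro ballI)
    fix p assume p: "p \<in> ?M"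
    obtain g h where gh: "p = (g, h)" by force
    have comp: "src TG g = rng TG h" "h \<in> arr TG" "g \<in> arr TG" "cmp TG g h \<in> N"
      using p gh by (auto simp: topspace_TG)
    obtain t u y z w where t: "h = gm t y" "t \<in> elems S" "(y, z) \<in> \<theta> t"
      and u: "g = gm u z" "u \<in> elems S" "(z, w) \<in> \<theta> u"
      by (rule composable_germs[OF comp(1-3)])
    have ut: "gm (u \<odot> t) y \<in> N" using comp(4) t u by (simp add: cmp_germ)
    define V where "V = gm t ` {y \<in> Domain (\<theta> (u \<odot> t)). gm (u \<odot> t) y \<in> N}"
    define U where "U = gm u ` Domain (\<theta> u)"
    have "openin (gtop TG) U" "openin (gtop TG) V"
      unfolding U_def V_def using t u N
      by (auto intro!: openin_germ_image openin_Domain openin_germ_vimage mul_closed)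
        (auto simp: action_mul)
    then have "openin ?D ((U \<times> V) \<inter> {(g, h). src TG g = rng TG h})"
      by (simp add: openin_subtopology_Int openin_prod_Times_iff)
    moreover have "p \<in> (U \<times> V) \<inter> {(g, h). src TG g = rng TG h}"
      using t u ut gh comp(1) by (auto simp: U_def V_def intro: theta_mul)
    moreover have "(U \<times> V) \<inter> {(g, h). src TG g = rng TG h} \<subseteq> ?M"
    proof
      fix q assume q: "q \<in> (U \<times> V) \<inter> {(g, h). src TG g = rng TG h}"
      then obtain z' y' where q': "q = (gm u z', gm t y')" "z' \<in> Domain (\<theta> u)"
        "y' \<in> Domain (\<theta> (u \<odot> t))" "gm (u \<odot> t) y' \<in> N" unfolding U_def V_def by auto
      then obtain z'' w' where w': "(y', z'') \<in> \<theta> t" "(z'', w') \<in> \<theta> u" using t u by (auto simp: action_mul)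
      obtain v where v: "(z', v) \<in> \<theta> u" using q'(2) by blast
      have "src TG (gm u z') = rng TG (gm t y')" using q q'(1) by simp
      then have "unit_germ z' = unit_germ z''"
        unfolding src_germ[OF u(2) v] rng_germ[OF t(2) w'(1)] .
      then have "z' = z''"
        using theta_space[OF u(2) v] theta_space[OF t(2) w'(1)] by (intro unit_germ_inj) auto
      then show "q \<in> ?M" using q q' w' t u by (auto simp: topspace_TG cmp_germ arr_germ)
    qed
    ultimately show "\<exists>T. openin ?D T \<and> p \<in> T \<and> T \<subseteq> ?M" by blast
  qed
qed

text \<open>The map \<open>unit_germ\<close> is an open embedding of \<open>Y\<close>, and the source map sends \<open>gm t y\<close> to \<open>unit_germ y\<close>. So it is
  enough that the points at which some germ lies in a given open set form an open set.\<close>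

lemma open_map_src_TG: "open_map (gtop TG) (unit_space TG) (src TG)"
  unfolding open_map_def
proof (intro allI impI)
  fix N assume N: "openin (gtop TG) N"
  have "src TG ` N = unit_germ ` (\<Union>t\<in>elems S. {y \<in> Domain (\<theta> t). gm t y \<in> N})" (is "?L = ?R")
  proof
    show "?L \<subseteq> ?R"
    proof
      fix a assume "a \<in> ?L"
      then obtain g where g: "g \<in> N" "a = src TG g" by blast
      then have "g \<in> arr TG" using N openin_TG by blast
      then obtain t y z where t: "g = gm t y" "t \<in> elems S" "(y, z) \<in> \<theta> t" by (blast elim: arrE)
      then show "a \<in> ?R" using g by (auto simp: src_germ)
    qed
    show "?R \<subseteq> ?L" by (auto simp: src_germ[symmetric])
  qed
  moreover have "openin (gtop TG) ?R"
    by (intro openin_unit_germ_image openin_Union) (auto intro: openin_germ_vimage N)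
  moreover have "?R \<subseteq> obj TG" using theta_space by (auto simp: obj_TG)
  ultimately show "openin (unit_space TG) (src TG ` N)" by (simp add: openin_unit_space_TG)
qed

lemma ginv_image_eq_vimage: "N \<subseteq> arr TG \<Longrightarrow> ginv TG ` N = {x \<in> arr TG. ginv TG x \<in> N}"
  using ginv_TG(1,6) by (force intro: rev_image_eqI)

lemma openin_ginv_image: "openin (gtop TG) N \<Longrightarrow> openin (gtop TG) (ginv TG ` N)"
  using continuous_ginv_TG openin_subset[of "gtop TG" N]
  by (simp add: ginv_image_eq_vimage continuous_map_def topspace_TG)

theorem etale_transformation_groupoid: "etale_groupoid TG"
proof -
  have loc: "\<exists>U. openin (gtop TG) U \<and> a \<in> U \<and> inj_on (src TG) U" if a: "a \<in> arr TG" for a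
  proof -
    obtain t y z where t: "a = gm t y" "t \<in> elems S" "(y, z) \<in> \<theta> t" using a by (blast elim: arrE)
    have "inj_on (src TG) (gm t ` Domain (\<theta> t))"
      unfolding inj_on_def using t(2) theta_space by (auto simp: src_germ) (metis unit_germ_inj)+
    then show ?thesis using openin_germ_image[OF t(2) openin_Domain[OF t(2)]] t by blast
  qed
  have src: "local_homeomorphism (gtop TG) (unit_space TG) (src TG)"
    by (intro local_homeomorphismI continuous_src_TG open_map_src_TG loc) (simp add: topspace_TG)
  have rng: "rng TG x = (src TG \<circ> ginv TG) x" if "x \<in> topspace (gtop TG)" for x
    using that by (simp add: topspace_TG ginv_TG(2))
  have cont: "continuous_map (gtop TG) (unit_space TG) (rng TG)"
    using continuous_map_eq[OF continuous_map_compose[OF continuous_ginv_TG continuous_src_TG]] rng by metis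
  have "open_map (gtop TG) (unit_space TG) (rng TG)"
    unfolding open_map_def
  proof (intro allI impI)
    fix N assume N: "openin (gtop TG) N"
    have "rng TG ` N = src TG ` (ginv TG ` N)"
      unfolding image_comp using rng openin_subset[OF N] by (intro image_cong) auto
    then show "openin (unit_space TG) (rng TG ` N)"
      using open_map_src_TG openin_ginv_image[OF N] by (simp add: open_map_def)
  qed
  moreover have "\<exists>U. openin (gtop TG) U \<and> a \<in> U \<and> inj_on (rng TG) U" if a: "a \<in> arr TG" for a
  proof -
    obtain U where U: "openin (gtop TG) U" "ginv TG a \<in> U" "inj_on (src TG) U"
      using loc ginv_TG(1)[OF a] by blast
    have sub: "U \<subseteq> arr TG" using openin_subset[OF U(1)] by (simp add: topspace_TG)
    have "inj_on (rng TG) (ginv TG ` U)"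
    proof (rule inj_onI, clarify)
      fix x y assume xy: "x \<in> U" "y \<in> U" "rng TG (ginv TG x) = rng TG (ginv TG y)"
      then have "src TG x = src TG y" using sub by (simp add: ginv_TG(3) subsetD)
      then have "x = y" using U(3) xy by (simp add: inj_onD)
      then show "ginv TG x = ginv TG y" by simp
    qed
    moreover have "a \<in> ginv TG ` U" using U(2) ginv_TG(6)[OF a] by (metis imageI)
    ultimately show ?thesis using openin_ginv_image[OF U(1)] by blast
  qed
  ultimately have "local_homeomorphism (gtop TG) (unit_space TG) (rng TG)"
    using cont by (intro local_homeomorphismI) (auto simp: topspace_TG)
  then show ?thesis
    unfolding etale_groupoid_def
    by (intro conjI ballI)
      (simp_all add: small_category_TG topspace_TG ginv_TG cont continuous_src_TG continuous_cmp_TG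
        continuous_ginv_TG src)
qed

end

section \<open>Presented inverse semigroups\<close>

lemma isg_class_eq_iff: "isg_class R t = isg_class R u \<longleftrightarrow> isg_cong R t u"
  unfolding isg_class_def by (blast intro: isg_cong.refl isg_cong.sym isg_cong.trans)

lemma isg_cong_representative: "isg_cong R t (SOME u. u \<in> isg_class R t)"
proof -
  have "t \<in> isg_class R t" by (simp add: isg_class_def isg_cong.refl)
  then have "(SOME u. u \<in> isg_class R t) \<in> isg_class R t" by (rule someI)
  then show ?thesis by (simp add: isg_class_def)
qed

lemma smul_isg_class [simp]:
  "smul (presented_isg A R) (isg_class R t) (isg_class R u) = isg_class R (Mul t u)"
  by (simp add: presented_isg_def isg_class_eq_iff)
    (blast intro: isg_cong.sym isg_cong.mul isg_cong_representative)

lemma sstar_isg_class [simp]: "sstar (presented_isg A R) (isg_class R t) = isg_class R (Star t)"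
  by (simp add: presented_isg_def isg_class_eq_iff)
    (blast intro: isg_cong.sym isg_cong.star isg_cong_representative)

lemma isg_class_elems: "set_isg_term t \<subseteq> A \<Longrightarrow> isg_class R t \<in> elems (presented_isg A R)"
  by (auto simp: presented_isg_def)

lemma isg_class_elemsE:
  assumes "a \<in> elems (presented_isg A R)"
  obtains t where "a = isg_class R t" "set_isg_term t \<subseteq> A"
  using assms by (auto simp: presented_isg_def)

lemma inverse_semigroup_presented: "inverse_semigroup (presented_isg A R)"
  by unfold_locales
    (elim isg_class_elemsE, simp add: isg_class_elems isg_class_eq_iff isg_cong.assoc
      isg_cong.star_star isg_cong.star_mul isg_cong.regular isg_cong.idem_comm)+

text \<open>Since the relations involve only terms over \<open>A\<close>, a class contains either only terms over \<open>A\<close> or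
  none. Hence relations that hold for the graphs of the generators in \<open>A\<close> carry over to classes.\<close>

lemma isg_cong_over:
  assumes R: "\<And>t u. (t, u) \<in> R \<Longrightarrow> set_isg_term t \<subseteq> A \<and> set_isg_term u \<subseteq> A"
    and "isg_cong R t u"
  shows "set_isg_term t \<subseteq> A \<longleftrightarrow> set_isg_term u \<subseteq> A"
  using assms(2) by induction (use R in auto)

lemma partial_homeo_term_graph:
  assumes "\<And>b. b \<in> A \<Longrightarrow> partial_homeo Y (\<theta> b)" "set_isg_term t \<subseteq> A"
  shows "partial_homeo Y (term_graph \<theta> t)"
  using assms(2) by (induction t) (auto intro: partial_homeo_relcomp partial_homeo_converse assms(1))

lemma partial_homeo_converse_relcomp:
  assumes "partial_homeo Y f"
  shows "f\<inverse> O f = Id_on (Range f)"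
proof (intro equalityI subsetI)
  fix p assume "p \<in> f\<inverse> O f"
  then obtain x y z where p: "p = (y, z)" "(x, y) \<in> f" "(x, z) \<in> f" by auto
  then have "y = z" using partial_homeo_single(1)[OF assms] by blast
  then show "p \<in> Id_on (Range f)" using p by auto
qed auto

lemma partial_homeo_regular:
  assumes "partial_homeo Y f"
  shows "f O (f\<inverse> O f) = f"
  unfolding partial_homeo_converse_relcomp[OF assms] by auto

lemma partial_homeo_idem_comm:
  assumes "partial_homeo Y f" "partial_homeo Y g"
  shows "(g\<inverse> O g) O (f\<inverse> O f) = (f\<inverse> O f) O (g\<inverse> O g)"
  unfolding partial_homeo_converse_relcomp[OF assms(1)] partial_homeo_converse_relcomp[OF assms(2)] by auto

lemma term_graph_cong:
  assumes \<theta>: "\<And>b. b \<in> A \<Longrightarrow> partial_homeo Y (\<theta> b)"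
    and R: "\<And>t u. (t, u) \<in> R \<Longrightarrow>
      set_isg_term t \<subseteq> A \<and> set_isg_term u \<subseteq> A \<and> term_graph \<theta> t = term_graph \<theta> u"
    and "isg_cong R t u" "set_isg_term t \<subseteq> A"
  shows "term_graph \<theta> t = term_graph \<theta> u"
  using assms(3,4)
proof induction
  case (sym t u)
  then show ?case using isg_cong_over[of R A t u] R by metis
next
  case (trans t u v)
  then show ?case using isg_cong_over[of R A t u] R by metis
next
  case (regular t)
  then show ?case using partial_homeo_regular[OF partial_homeo_term_graph[of A Y \<theta> t, OF \<theta>]] by simp
next
  case (idem_comm t u)
  then show ?case
    using partial_homeo_idem_comm[OF partial_homeo_term_graph[of A Y \<theta> t, OF \<theta>] partial_homeo_term_graph[of A Y \<theta> u, OF \<theta>]]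
    by simp
qed (use R in \<open>auto simp: O_assoc converse_relcomp\<close>)

context
  fixes A :: "'b set" and R Y and \<theta> :: "'b \<Rightarrow> ('y \<times> 'y) set"
  assumes \<theta>: "\<And>b. b \<in> A \<Longrightarrow> partial_homeo Y (\<theta> b)"
    and R: "\<And>t u. (t, u) \<in> R \<Longrightarrow>
      set_isg_term t \<subseteq> A \<and> set_isg_term u \<subseteq> A \<and> term_graph \<theta> t = term_graph \<theta> u"
begin

lemma class_graph:
  assumes "set_isg_term t \<subseteq> A"
  shows "(\<Union>u\<in>isg_class R t. term_graph \<theta> u) = term_graph \<theta> t"
  using term_graph_cong[OF \<theta> R _ assms] isg_cong.refl[of R t] unfolding isg_class_def by blast

lemma isg_action_presented:
  assumes "\<And>y. y \<in> topspace Y \<Longrightarrow> \<exists>b\<in>A. y \<in> Domain (\<theta> b)"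
  shows "isg_action (presented_isg A R) Y (\<lambda>a. \<Union>t\<in>a. term_graph \<theta> t)"
proof -
  interpret inverse_semigroup "presented_isg A R" by (rule inverse_semigroup_presented)
  show ?thesis
  proof unfold_locales
    fix a assume "a \<in> elems (presented_isg A R)"
    then obtain t where t: "a = isg_class R t" "set_isg_term t \<subseteq> A" by (rule isg_class_elemsE)
    show "partial_homeo Y (\<Union>t\<in>a. term_graph \<theta> t)"
      unfolding t(1) class_graph[OF t(2)] using \<theta> t(2) by (rule partial_homeo_term_graph)
    have "set_isg_term (Star t) \<subseteq> A" using t(2) by simp
    then show "(\<Union>t\<in>sstar (presented_isg A R) a. term_graph \<theta> t) = (\<Union>t\<in>a. term_graph \<theta> t)\<inverse>"
      unfolding t(1) sstar_isg_class using class_graph t(2) by simp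
    fix b assume "b \<in> elems (presented_isg A R)"
    then obtain u where u: "b = isg_class R u" "set_isg_term u \<subseteq> A" by (rule isg_class_elemsE)
    have "set_isg_term (Mul t u) \<subseteq> A" using t(2) u(2) by simp
    then show "(\<Union>t\<in>smul (presented_isg A R) a b. term_graph \<theta> t) =
        (\<Union>t\<in>b. term_graph \<theta> t) O (\<Union>t\<in>a. term_graph \<theta> t)"
      unfolding t(1) u(1) smul_isg_class using class_graph t(2) u(2) by simp
  next
    fix y assume "y \<in> topspace Y"
    then obtain b where b: "b \<in> A" "y \<in> Domain (\<theta> b)" using assms by blast
    then have "y \<in> Domain (\<Union>t\<in>isg_class R (Gen b). term_graph \<theta> t)"
      using class_graph[of "Gen b"] by simp
    then show "\<exists>a\<in>elems (presented_isg A R). y \<in> Domain (\<Union>t\<in>a. term_graph \<theta> t)"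
      using isg_class_elems[of "Gen b" A R] b by auto
  qed
qed

end

section \<open>Etale groupoids and correspondences\<close>

locale etale =
  fixes G :: "'g tgroupoid"
  assumes etale: "etale_groupoid G"
begin

lemma category: "small_category G" using etale by (simp add: etale_groupoid_def)

lemma topspace_gtop: "topspace (gtop G) = arr G" using etale by (simp add: etale_groupoid_def)

lemma arr_facts:
  assumes "g \<in> arr G"
  shows "src G g \<in> arr G" "rng G g \<in> arr G" "src G (src G g) = src G g" "rng G (src G g) = src G g"
    "src G (rng G g) = rng G g" "rng G (rng G g) = rng G g" "cmp G (rng G g) g = g" "cmp G g (src G g) = g"
    "ginv G g \<in> arr G" "src G (ginv G g) = rng G g" "rng G (ginv G g) = src G g"
    "cmp G g (ginv G g) = rng G g" "cmp G (ginv G g) g = src G g"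
  using assms etale by (simp_all add: etale_groupoid_def small_category_def)

lemma src_obj: "g \<in> arr G \<Longrightarrow> src G g \<in> obj G"
  by (simp add: obj_def arr_facts)

lemma obj_facts:
  assumes "e \<in> obj G"
  shows "e \<in> arr G" "src G e = e" "rng G e = e"
  using assms arr_facts(4)[of e] by (auto simp: obj_def)

lemma cmp_facts:
  assumes "g \<in> arr G" "h \<in> arr G" "src G g = rng G h"
  shows "cmp G g h \<in> arr G" "src G (cmp G g h) = src G h" "rng G (cmp G g h) = rng G g"
  using assms category by (simp_all add: small_category_def)

lemma cmp_assoc:
  assumes "g \<in> arr G" "h \<in> arr G" "k \<in> arr G" "src G g = rng G h" "src G h = rng G k"
  shows "cmp G (cmp G g h) k = cmp G g (cmp G h k)"
  using assms category by (simp add: small_category_def)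

lemma ginv_unique:
  assumes "g \<in> arr G" "h \<in> arr G" "src G g = rng G h" "cmp G g h = rng G g"
  shows "h = ginv G g"
proof -
  have "cmp G (cmp G (ginv G g) g) h = cmp G (ginv G g) (cmp G g h)"
    using assms by (intro cmp_assoc) (simp_all add: arr_facts)
  then show ?thesis using assms arr_facts(7)[of h] arr_facts(8)[of "ginv G g"] by (simp add: arr_facts)
qed

lemma ginv_ginv: "g \<in> arr G \<Longrightarrow> ginv G (ginv G g) = g"
  using ginv_unique[of "ginv G g" g] by (simp add: arr_facts)

lemma ginv_cmp:
  assumes "g \<in> arr G" "h \<in> arr G" "src G g = rng G h"
  shows "ginv G (cmp G g h) = cmp G (ginv G h) (ginv G g)"
proof -
  have "cmp G (cmp G g h) (cmp G (ginv G h) (ginv G g)) = cmp G g (cmp G h (cmp G (ginv G h) (ginv G g)))"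
    using assms by (intro cmp_assoc) (simp_all add: arr_facts cmp_facts)
  also have "cmp G h (cmp G (ginv G h) (ginv G g)) = cmp G (cmp G h (ginv G h)) (ginv G g)"
    using assms by (intro cmp_assoc[symmetric]) (simp_all add: arr_facts)
  also have "\<dots> = ginv G g" using assms arr_facts(7)[of "ginv G g"] by (simp add: arr_facts)
  finally show ?thesis using assms
    by (intro ginv_unique[symmetric]) (simp_all add: arr_facts cmp_facts)
qed

lemma ginv_obj: "e \<in> obj G \<Longrightarrow> ginv G e = e"
  using ginv_unique[of e e] arr_facts(8)[of e] by (simp add: obj_facts)

lemma continuous_ginv: "continuous_map (gtop G) (gtop G) (ginv G)"
  using etale by (simp add: etale_groupoid_def)

lemma continuous_src: "continuous_map (gtop G) (unit_space G) (src G)"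
  and continuous_rng: "continuous_map (gtop G) (unit_space G) (rng G)"
  using etale by (simp_all add: etale_groupoid_def)

lemma continuous_src': "continuous_map (gtop G) (gtop G) (src G)"
  and continuous_rng': "continuous_map (gtop G) (gtop G) (rng G)"
  using continuous_src continuous_rng by (simp_all add: unit_space_def continuous_map_in_subtopology)

text \<open>Let the source map be injective on a neighbourhood \<open>U\<close> of a unit. An arrow \<open>g \<in> U\<close> whose source lies in \<open>U\<close> is
  a unit, because \<open>g\<close> and \<open>src G g\<close> have the same source.\<close>

lemma openin_obj: "openin (gtop G) (obj G)"
proof (subst openin_subopen, intro ballI)
  fix e assume e: "e \<in> obj G"
  have "local_homeomorphism (gtop G) (unit_space G) (src G)"
    using etale by (simp add: etale_groupoid_def)
  then obtain U where U: "openin (gtop G) U" "e \<in> U" "inj_on (src G) U"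
    using local_homeomorphism_imp_locally_inj e obj_facts(1) topspace_gtop by metis
  let ?V = "U \<inter> {g \<in> topspace (gtop G). src G g \<in> U}"
  have "openin (gtop G) ?V"
    by (intro openin_Int openin_continuous_map_preimage[OF continuous_src'] U(1))
  moreover have "e \<in> ?V" using e U(2) by (simp add: obj_facts topspace_gtop)
  moreover have "?V \<subseteq> obj G"
  proof
    fix g assume g: "g \<in> ?V"
    then have ga: "g \<in> arr G" by (simp add: topspace_gtop)
    have "src G (src G g) = src G g" "src G g \<in> U" "g \<in> U" using g arr_facts(3)[OF ga] by simp_all
    then have "src G g = g" by (rule inj_onD[OF U(3)])
    then show "g \<in> obj G" using src_obj[OF ga] by simp
  qed
  ultimately show "\<exists>T. openin (gtop G) T \<and> e \<in> T \<and> T \<subseteq> obj G" by blast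
qed

lemma obj_sub: "obj G \<subseteq> arr G" by (auto simp: obj_def)

lemma topspace_unit_space: "topspace (unit_space G) = obj G"
  using obj_sub by (auto simp: unit_space_def topspace_gtop)

lemma openin_unit_space: "openin (unit_space G) U \<longleftrightarrow> openin (gtop G) U \<and> U \<subseteq> obj G"
  unfolding unit_space_def by (rule openin_open_subtopology[OF openin_obj])

lemma openin_src_image: "openin (gtop G) U \<Longrightarrow> openin (gtop G) (src G ` U)"
  and openin_rng_image: "openin (gtop G) U \<Longrightarrow> openin (gtop G) (rng G ` U)"
  using local_homeomorphism_imp_open_map[of "gtop G" "unit_space G" "src G"]
    local_homeomorphism_imp_open_map[of "gtop G" "unit_space G" "rng G"] etale
  by (simp_all add: etale_groupoid_def open_map_def openin_unit_space)

end

locale grpd_corr = left: etale H + right: etale G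
  for H :: "'h tgroupoid" and G :: "'g tgroupoid" +
  fixes X :: "('h, 'x, 'g) corr"
  assumes corr: "correspondence H X G"
begin

abbreviation pts where "pts \<equiv> topspace (ctop X)"

lemma left_sp: "left_space H (ctop X) (ranch X) (lact X)"
  and right_sp: "right_space G (ctop X) (sanch X) (ract X)"
  and sanch_local: "local_homeomorphism (ctop X) (unit_space G) (sanch X)"
  and basic: "basic_action G (ctop X) (sanch X) (ract X)"
  using corr by (simp_all add: correspondence_def)

lemma continuous_sanch: "continuous_map (ctop X) (unit_space G) (sanch X)"
  using right_sp by (simp add: right_space_def)

lemma continuous_ranch: "continuous_map (ctop X) (unit_space H) (ranch X)"
  using left_sp by (simp add: left_space_def)

lemma continuous_sanch': "continuous_map (ctop X) (gtop G) (sanch X)"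
  using continuous_sanch by (simp add: unit_space_def continuous_map_in_subtopology)

lemma continuous_ranch': "continuous_map (ctop X) (gtop H) (ranch X)"
  using continuous_ranch by (simp add: unit_space_def continuous_map_in_subtopology)

lemma sanch_obj: "x \<in> pts \<Longrightarrow> sanch X x \<in> obj G"
  using continuous_sanch right.topspace_unit_space by (auto simp: continuous_map_def)

lemma ranch_obj: "x \<in> pts \<Longrightarrow> ranch X x \<in> obj H"
  using continuous_ranch left.topspace_unit_space by (auto simp: continuous_map_def)

lemma continuous_ract:
  "continuous_map (subtopology (prod_topology (ctop X) (gtop G)) {(x, g). sanch X x = rng G g})
    (ctop X) (\<lambda>(x, g). ract X x g)"
  using right_sp by (simp add: right_space_def)

lemma continuous_lact:
  "continuous_map (subtopology (prod_topology (gtop H) (ctop X)) {(h, x). src H h = ranch X x})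
    (ctop X) (\<lambda>(h, x). lact X h x)"
  using left_sp by (simp add: left_space_def)

lemma ract_pts: "x \<in> pts \<Longrightarrow> g \<in> arr G \<Longrightarrow> sanch X x = rng G g \<Longrightarrow> ract X x g \<in> pts"
  using funcset_mem[OF continuous_map_funspace[OF continuous_ract], of "(x, g)"]
  by (simp add: right.topspace_gtop)

lemma lact_pts: "x \<in> pts \<Longrightarrow> h \<in> arr H \<Longrightarrow> src H h = ranch X x \<Longrightarrow> lact X h x \<in> pts"
  using funcset_mem[OF continuous_map_funspace[OF continuous_lact], of "(h, x)"]
  by (simp add: left.topspace_gtop)

lemma ract_facts:
  assumes "x \<in> pts" "g \<in> arr G" "sanch X x = rng G g"
  shows "sanch X (ract X x g) = src G g" "ranch X (ract X x g) = ranch X x"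
  using assms corr right_sp by (auto simp: correspondence_def right_space_def)

lemma ract_assoc:
  assumes "x \<in> pts" "g \<in> arr G" "h \<in> arr G" "sanch X x = rng G g" "src G g = rng G h"
  shows "ract X (ract X x g) h = ract X x (cmp G g h)"
  using assms right_sp by (simp add: right_space_def)

lemma ract_unit: "x \<in> pts \<Longrightarrow> ract X x (sanch X x) = x"
  using right_sp by (simp add: right_space_def)

lemma lact_facts:
  assumes "x \<in> pts" "h \<in> arr H" "src H h = ranch X x"
  shows "ranch X (lact X h x) = rng H h" "sanch X (lact X h x) = sanch X x"
  using assms corr left_sp by (auto simp: correspondence_def left_space_def)

lemma lact_assoc:
  assumes "x \<in> pts" "g \<in> arr H" "h \<in> arr H" "src H g = rng H h" "src H h = ranch X x"
  shows "lact X g (lact X h x) = lact X (cmp H g h) x"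
  using assms left_sp by (simp add: left_space_def)

lemma lact_unit: "x \<in> pts \<Longrightarrow> lact X (ranch X x) x = x"
  using left_sp by (simp add: left_space_def)

lemma ract_ginv:
  assumes "x \<in> pts" "g \<in> arr G" "sanch X x = rng G g"
  shows "ract X (ract X x g) (ginv G g) = x"
  using assms ract_assoc[of x g "ginv G g"] ract_unit[of x] by (simp add: right.arr_facts)

lemma ract_free:
  assumes "x \<in> pts" "g \<in> arr G" "h \<in> arr G" "sanch X x = rng G g" "sanch X x = rng G h"
    "ract X x g = ract X x h"
  shows "g = h"
proof -
  let ?D = "subtopology (prod_topology (ctop X) (gtop G)) {(x, g). sanch X x = rng G g}"
  have "inj_on (\<lambda>(x, g). (ract X x g, x)) (topspace ?D)"
    using basic homeomorphic_imp_injective_map unfolding basic_action_def embedding_map_def by blast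
  then have "(x, g) = (x, h)"
    by (rule inj_onD) (use assms in \<open>auto simp: right.topspace_gtop\<close>)
  then show ?thesis by simp
qed

lemma orbit_refl: "x \<in> pts \<Longrightarrow> x \<in> corr_orbit G X x"
  using sanch_obj[of x] right.obj_facts ract_unit[of x] unfolding right_orbit_def by force

lemma orbit_act_sub:
  assumes "x \<in> pts" "g \<in> arr G" "sanch X x = rng G g"
  shows "corr_orbit G X (ract X x g) \<subseteq> corr_orbit G X x"
proof
  fix z assume "z \<in> corr_orbit G X (ract X x g)"
  then obtain h where h: "h \<in> arr G" "src G g = rng G h" "z = ract X (ract X x g) h"
    using assms by (auto simp: right_orbit_def ract_facts)
  then have "z = ract X x (cmp G g h)" "sanch X x = rng G (cmp G g h)" "cmp G g h \<in> arr G"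
    using assms by (simp_all add: ract_assoc right.cmp_facts)
  then show "z \<in> corr_orbit G X x" by (auto simp: right_orbit_def)
qed

lemma orbit_act:
  assumes "x \<in> pts" "g \<in> arr G" "sanch X x = rng G g"
  shows "corr_orbit G X (ract X x g) = corr_orbit G X x"
proof
  show "corr_orbit G X x \<subseteq> corr_orbit G X (ract X x g)"
    using orbit_act_sub[of "ract X x g" "ginv G g"] assms
    by (simp add: ract_pts ract_facts right.arr_facts ract_ginv)
qed (use assms in \<open>rule orbit_act_sub\<close>)

lemma orbit_eq_iff:
  assumes "x \<in> pts" "y \<in> pts"
  shows "corr_orbit G X x = corr_orbit G X y \<longleftrightarrow>
    (\<exists>g\<in>arr G. sanch X x = rng G g \<and> y = ract X x g)"
proof
  assume "corr_orbit G X x = corr_orbit G X y"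
  then have "y \<in> corr_orbit G X x" using orbit_refl[OF assms(2)] by simp
  then show "\<exists>g\<in>arr G. sanch X x = rng G g \<and> y = ract X x g" by (auto simp: right_orbit_def)
qed (use assms orbit_act in auto)

lemma openin_sanch_image: "openin (ctop X) U \<Longrightarrow> openin (gtop G) (sanch X ` U)"
  using local_homeomorphism_imp_open_map[OF sanch_local]
  unfolding open_map_def right.openin_unit_space by blast

lemma openin_act_domain:
  assumes "openin (ctop X) U"
  shows "openin (gtop G) {g \<in> topspace (gtop G). \<exists>x\<in>U. (x, g) \<in> {(x, g). sanch X x = rng G g}}"
proof -
  have "{g \<in> topspace (gtop G). \<exists>x\<in>U. (x, g) \<in> {(x, g). sanch X x = rng G g}} =
      {g \<in> topspace (gtop G). rng G g \<in> sanch X ` U}"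
    by (auto simp: image_iff) metis
  then show ?thesis
    using openin_continuous_map_preimage[OF right.continuous_rng' openin_sanch_image[OF assms]] by simp
qed

text \<open>The unit space is open in \<open>G\<close>, so the pairs \<open>(x, x)\<close> are open among the pairs of points in the
  same orbit. Hence some neighbourhood of \<open>(x, x)\<close> contains no other such pairs. For a free action that is not
  basic, the map \<open>(x, g) \<mapsto> (x g, x)\<close> need not be open onto its image, and the argument fails.\<close>

lemma locally_orbit_injective:
  assumes x: "x \<in> pts"
  obtains U where "openin (ctop X) U" "x \<in> U" "inj_on (corr_orbit G X) U"
proof -
  let ?D = "subtopology (prod_topology (ctop X) (gtop G)) {(x, g). sanch X x = rng G g}"
  let ?f = "\<lambda>(x, g). (ract X x g, x)"
  let ?I = "subtopology (prod_topology (ctop X) (ctop X)) (?f ` topspace ?D)"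
  have "homeomorphic_map ?D ?I ?f" using basic by (simp add: basic_action_def embedding_map_def)
  then have "open_map ?D ?I ?f" by (rule homeomorphic_imp_open_map)
  moreover have "openin ?D ((pts \<times> obj G) \<inter> {(x, g). sanch X x = rng G g})"
    using right.openin_obj by (simp add: openin_subtopology_Int openin_prod_Times_iff)
  ultimately have "openin ?I (?f ` ((pts \<times> obj G) \<inter> {(x, g). sanch X x = rng G g}))"
    unfolding open_map_def by blast
  moreover have "?f ` ((pts \<times> obj G) \<inter> {(x, g). sanch X x = rng G g}) = {(x, x) | x. x \<in> pts}"
    using sanch_obj by (force simp: right.obj_facts ract_unit)
  ultimately have "openin ?I {(x, x) | x. x \<in> pts}" by simp
  then obtain T where T: "openin (prod_topology (ctop X) (ctop X)) T"
    "{(x, x) | x. x \<in> pts} = T \<inter> ?f ` topspace ?D"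
    by (auto simp only: openin_subtopology)
  have "(x, x) \<in> T" using T(2) x by blast
  then obtain U V where UV: "openin (ctop X) U" "openin (ctop X) V" "x \<in> U" "x \<in> V" "U \<times> V \<subseteq> T"
    using T(1) unfolding openin_prod_topology_alt by metis
  have "inj_on (corr_orbit G X) (U \<inter> V)"
  proof (rule inj_onI)
    fix a b assume ab: "a \<in> U \<inter> V" "b \<in> U \<inter> V" "corr_orbit G X a = corr_orbit G X b"
    then have p: "a \<in> pts" "b \<in> pts" using openin_subset UV(1) by blast+
    then obtain g where g: "g \<in> arr G" "sanch X a = rng G g" "b = ract X a g"
      using ab(3) orbit_eq_iff by blast
    have "(a, g) \<in> topspace ?D" using g p by (simp add: right.topspace_gtop)
    then have "?f (a, g) \<in> ?f ` topspace ?D" by (rule imageI)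
    then have "(b, a) \<in> T \<inter> ?f ` topspace ?D" using g(3) ab UV(5) by auto
    then show "a = b" unfolding T(2)[symmetric] by blast
  qed
  then show ?thesis using that[of "U \<inter> V"] UV by blast
qed

lemma inner_pt_eq:
  assumes "x \<in> pts" "g \<in> arr G" "sanch X x = rng G g"
  shows "inner_pt G X x (ract X x g) = g"
  unfolding inner_pt_def by (rule the_equality) (use assms ract_free in auto)

lemma inner_slice_eq:
  assumes "U \<subseteq> pts" "V \<subseteq> pts"
  shows "inner_slice G X U V = {g \<in> arr G. \<exists>x\<in>U. sanch X x = rng G g \<and> ract X x g \<in> V}" (is "_ = ?R")
proof
  show "inner_slice G X U V \<subseteq> ?R"
  proof
    fix g assume "g \<in> inner_slice G X U V"
    then obtain x y where xy: "x \<in> U" "y \<in> V" "corr_orbit G X x = corr_orbit G X y" "g = inner_pt G X x y"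
      by (auto simp: inner_slice_def)
    then obtain h where "h \<in> arr G" "sanch X x = rng G h" "y = ract X x h"
      using orbit_eq_iff[of x y] assms by blast
    moreover have "x \<in> pts" using xy(1) assms(1) by blast
    ultimately have "g = h" using xy(4) inner_pt_eq by simp
    then show "g \<in> ?R" using xy(1,2) \<open>h \<in> arr G\<close> \<open>sanch X x = rng G h\<close> \<open>y = ract X x h\<close> by blast
  qed
  show "?R \<subseteq> inner_slice G X U V"
  proof
    fix g assume "g \<in> ?R"
    then obtain x where x: "x \<in> U" "g \<in> arr G" "sanch X x = rng G g" "ract X x g \<in> V" by blast
    then have "x \<in> pts" using assms by blast
    then show "g \<in> inner_slice G X U V"
      using x inner_pt_eq[of x g] orbit_act[of x g] unfolding inner_slice_def
      by (intro CollectI exI[of _ x] exI[of _ "ract X x g"]) simp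
  qed
qed

lemma openin_inner_slice:
  assumes U: "openin (ctop X) U" and V: "openin (ctop X) V"
  shows "openin (gtop G) (inner_slice G X U V)"
proof -
  let ?D = "{(x, g). sanch X x = rng G g}"
  let ?T = "subtopology (prod_topology (ctop X) (gtop G)) ?D"
  let ?W = "{p \<in> topspace ?T. (case p of (x, g) \<Rightarrow> ract X x g) \<in> V} \<inter> (U \<times> arr G)"
  have oT: "openin ?T ((U \<times> arr G) \<inter> ?D)"
    using U openin_topspace[of "gtop G"]
    by (intro openin_subtopology_Int) (simp add: openin_prod_Times_iff right.topspace_gtop)
  have "?W = {p \<in> topspace ?T. (case p of (x, g) \<Rightarrow> ract X x g) \<in> V} \<inter> ((U \<times> arr G) \<inter> ?D)" by auto
  then have "openin ?T ?W"
    using openin_Int[OF openin_continuous_map_preimage[OF continuous_ract V] oT] by simp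
  then have "openin (gtop G) (snd ` ?W)" by (rule openin_snd_image_of_fibred[OF _ openin_act_domain])
  moreover have "snd ` ?W = inner_slice G X U V"
    using openin_subset[OF U] unfolding inner_slice_eq[OF openin_subset[OF U] openin_subset[OF V]]
    by (force simp: right.topspace_gtop)
  ultimately show ?thesis by simp
qed

text \<open>The saturation of \<open>U\<close> is the projection to \<open>X\<close> of the open set of all \<open>(x, g)\<close> with \<open>x g \<in> U\<close>. This
  projection is open because the range map of \<open>G\<close> is open.\<close>

lemma openin_orbit_image:
  assumes U: "openin (ctop X) U"
  shows "openin (corr_orbit_space G X) (corr_orbit G X ` U)"
  unfolding orbit_space_def openin_quotient_topology
proof
  show "corr_orbit G X ` U \<subseteq> corr_orbit G X ` pts" using openin_subset[OF U] by blast
  let ?D = "{(x, g). sanch X x = rng G g}"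
  let ?T = "subtopology (prod_topology (ctop X) (gtop G)) ?D"
  let ?W = "{p \<in> topspace ?T. (case p of (x, g) \<Rightarrow> ract X x g) \<in> U}"
  have "openin (ctop X) (fst ` ?W)"
  proof (rule openin_fst_image_of_fibred)
    show "openin ?T ?W" by (rule openin_continuous_map_preimage[OF continuous_ract U])
    fix V assume "openin (gtop G) V"
    moreover have "{x \<in> pts. \<exists>g\<in>V. (x, g) \<in> ?D} = {x \<in> pts. sanch X x \<in> rng G ` V}" by auto
    ultimately show "openin (ctop X) {x \<in> pts. \<exists>g\<in>V. (x, g) \<in> ?D}"
      using openin_continuous_map_preimage[OF continuous_sanch' right.openin_rng_image] by simp
  qed
  moreover have "fst ` ?W = {x \<in> pts. corr_orbit G X x \<in> corr_orbit G X ` U}" (is "_ = ?R")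
  proof
    show "fst ` ?W \<subseteq> ?R"
      by (auto simp: right.topspace_gtop orbit_act[symmetric])
    show "?R \<subseteq> fst ` ?W"
    proof
      fix x assume "x \<in> ?R"
      then obtain y where y: "x \<in> pts" "y \<in> U" "corr_orbit G X x = corr_orbit G X y" by blast
      then obtain g where g: "g \<in> arr G" "sanch X x = rng G g" "y = ract X x g"
        using orbit_eq_iff[of x y] openin_subset[OF U] by blast
      then have "(x, g) \<in> ?W" using y by (simp add: right.topspace_gtop)
      then show "x \<in> fst ` ?W" by force
    qed
  qed
  ultimately show "openin (ctop X) {x \<in> pts. corr_orbit G X x \<in> corr_orbit G X ` U}" by simp
qed

end

text \<open>For a tight correspondence, the left anchor map is a model of the projection to the orbit space: it is open and
  surjective, and its fibres are the orbits. So open sets on which both anchor maps are injective are the same as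
  slices.\<close>

locale tight_corr = grpd_corr +
  assumes tight: "tight H X G"
begin

lemma induced_ranch_orbit:
  assumes "x \<in> pts"
  shows "induced_ranch X (corr_orbit G X x) = ranch X x"
proof -
  have "(SOME y. y \<in> corr_orbit G X x) \<in> corr_orbit G X x"
    using orbit_refl[OF assms] by (rule someI)
  then show ?thesis using assms by (auto simp: induced_ranch_def right_orbit_def ract_facts)
qed

lemma topspace_orbit_space: "topspace (corr_orbit_space G X) = corr_orbit G X ` pts"
proof
  show "corr_orbit G X ` pts \<subseteq> topspace (corr_orbit_space G X)"
    by (rule openin_subset[OF openin_orbit_image[OF openin_topspace]])
  show "topspace (corr_orbit_space G X) \<subseteq> corr_orbit G X ` pts"
    using openin_topspace[of "corr_orbit_space G X"]
    unfolding orbit_space_def openin_quotient_topology by blast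
qed

lemma ranch_eq_iff_orbit:
  assumes "x \<in> pts" "y \<in> pts"
  shows "ranch X x = ranch X y \<longleftrightarrow> corr_orbit G X x = corr_orbit G X y"
proof
  assume "ranch X x = ranch X y"
  moreover have "inj_on (induced_ranch X) (corr_orbit G X ` pts)"
    using tight homeomorphic_imp_injective_map topspace_orbit_space unfolding tight_def by metis
  ultimately show "corr_orbit G X x = corr_orbit G X y"
    using assms by (metis inj_onD imageI induced_ranch_orbit)
qed (metis assms induced_ranch_orbit)

lemma ranch_eqD:
  assumes "x \<in> pts" "y \<in> pts" "ranch X x = ranch X y"
  obtains g where "g \<in> arr G" "sanch X x = rng G g" "y = ract X x g" "src G g = sanch X y"
  using assms ranch_eq_iff_orbit orbit_eq_iff by (metis ract_facts(1))

lemma openin_ranch_image: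
  assumes "openin (ctop X) U"
  shows "openin (gtop H) (ranch X ` U)"
proof -
  have "open_map (corr_orbit_space G X) (unit_space H) (induced_ranch X)"
    using tight unfolding tight_def by (rule homeomorphic_imp_open_map)
  then have "openin (unit_space H) (induced_ranch X ` corr_orbit G X ` U)"
    using openin_orbit_image[OF assms] unfolding open_map_def by blast
  moreover have "induced_ranch X ` corr_orbit G X ` U = ranch X ` U"
    unfolding image_comp using openin_subset[OF assms]
    by (intro image_cong refl) (auto simp: induced_ranch_orbit)
  ultimately show ?thesis by (simp add: left.openin_unit_space)
qed

lemma ranch_surj: "ranch X ` pts = obj H"
proof -
  have "induced_ranch X ` corr_orbit G X ` pts = obj H"
    using tight homeomorphic_imp_surjective_map unfolding tight_def
    by (metis left.topspace_unit_space topspace_orbit_space)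
  moreover have "induced_ranch X ` corr_orbit G X ` pts = ranch X ` pts"
    unfolding image_comp by (intro image_cong refl) (auto simp: induced_ranch_orbit)
  ultimately show ?thesis by simp
qed

lemma inj_on_orbit_iff: "U \<subseteq> pts \<Longrightarrow> inj_on (corr_orbit G X) U \<longleftrightarrow> inj_on (ranch X) U"
  unfolding inj_on_def using ranch_eq_iff_orbit by (metis subsetD)

end

section \<open>Composites of correspondences\<close>

locale composable_corrs = X: grpd_corr H G X + Y: grpd_corr G K Y
  for H :: "'h tgroupoid" and G :: "'g tgroupoid" and K :: "'k tgroupoid"
    and X :: "('h, 'x, 'g) corr" and Y :: "('g, 'y, 'k) corr"
begin

abbreviation pairs :: "('x \<times> 'y) topology" where
  "pairs \<equiv> subtopology (prod_topology (ctop X) (ctop Y)) {(x, y). sanch X x = ranch Y y}"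

abbreviation cls where "cls \<equiv> comp_class G X Y"

lemma class_refl:
  assumes "x \<in> X.pts" "y \<in> Y.pts" "sanch X x = ranch Y y"
  shows "(x, y) \<in> cls x y"
proof -
  have "ranch Y y \<in> obj G" using assms by (simp add: Y.ranch_obj)
  then have "ranch Y y \<in> arr G" "src G (ranch Y y) = ranch Y y" "ginv G (ranch Y y) = ranch Y y"
    by (auto simp: X.right.obj_facts X.right.ginv_obj)
  moreover have "ract X x (ranch Y y) = x" using X.ract_unit[of x] assms by simp
  moreover have "lact Y (ranch Y y) y = y" using Y.lact_unit[of y] assms by simp
  ultimately show ?thesis unfolding comp_class_def by (intro CollectI exI[of _ "ranch Y y"]) simp
qed

lemma act_pair:
  assumes "x \<in> X.pts" "y \<in> Y.pts" "sanch X x = ranch Y y" "g \<in> arr G" "src G g = ranch Y y"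
  shows "ract X x (ginv G g) \<in> X.pts" "lact Y g y \<in> Y.pts"
    "sanch X (ract X x (ginv G g)) = rng G g" "ranch Y (lact Y g y) = rng G g"
    "ranch X (ract X x (ginv G g)) = ranch X x" "sanch Y (lact Y g y) = sanch Y y"
  using assms
  by (simp_all add: X.ract_pts X.right.arr_facts Y.lact_pts X.ract_facts Y.lact_facts)

lemma class_act_sub:
  assumes "x \<in> X.pts" "y \<in> Y.pts" "sanch X x = ranch Y y" "g \<in> arr G" "src G g = ranch Y y"
  shows "cls (ract X x (ginv G g)) (lact Y g y) \<subseteq> cls x y"
proof
  fix p assume "p \<in> cls (ract X x (ginv G g)) (lact Y g y)"
  then obtain k where k: "k \<in> arr G" "src G k = rng G g"
    "p = (ract X (ract X x (ginv G g)) (ginv G k), lact Y k (lact Y g y))"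
    using act_pair(4)[OF assms] by (auto simp: comp_class_def)
  have "ract X (ract X x (ginv G g)) (ginv G k) = ract X x (cmp G (ginv G g) (ginv G k))"
    using assms k by (intro X.ract_assoc) (simp_all add: X.right.arr_facts)
  then have "p = (ract X x (ginv G (cmp G k g)), lact Y (cmp G k g) y)"
    using assms k by (simp add: X.right.ginv_cmp Y.lact_assoc)
  moreover have "cmp G k g \<in> arr G" "src G (cmp G k g) = ranch Y y"
    using assms k by (simp_all add: X.right.cmp_facts)
  ultimately show "p \<in> cls x y" by (auto simp: comp_class_def)
qed

lemma class_act:
  assumes "x \<in> X.pts" "y \<in> Y.pts" "sanch X x = ranch Y y" "g \<in> arr G" "src G g = ranch Y y"
  shows "cls (ract X x (ginv G g)) (lact Y g y) = cls x y"
proof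
  note p = act_pair[OF assms]
  have "cls (ract X (ract X x (ginv G g)) (ginv G (ginv G g))) (lact Y (ginv G g) (lact Y g y))
      \<subseteq> cls (ract X x (ginv G g)) (lact Y g y)"
    using assms p by (intro class_act_sub) (simp_all add: X.right.arr_facts)
  moreover have "ract X (ract X x (ginv G g)) (ginv G (ginv G g)) = x"
    using assms by (intro X.ract_ginv) (simp_all add: X.right.arr_facts)
  moreover have "lact Y (ginv G g) (lact Y g y) = y"
    using assms Y.lact_unit[of y] by (simp add: Y.lact_assoc X.right.arr_facts)
  ultimately show "cls x y \<subseteq> cls (ract X x (ginv G g)) (lact Y g y)" by simp
qed (use assms in \<open>rule class_act_sub\<close>)

lemma class_representative:
  assumes "x \<in> X.pts" "y \<in> Y.pts" "sanch X x = ranch Y y"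
  obtains g where "g \<in> arr G" "src G g = ranch Y y"
    "(SOME p. p \<in> cls x y) = (ract X x (ginv G g), lact Y g y)"
proof -
  have "(SOME p. p \<in> cls x y) \<in> cls x y" using class_refl[OF assms] by (rule someI)
  then show ?thesis using that unfolding comp_class_def by blast
qed

lemma comp_corr_anchors:
  assumes "x \<in> X.pts" "y \<in> Y.pts" "sanch X x = ranch Y y"
  shows "ranch (comp_corr G X Y) (cls x y) = ranch X x"
    "sanch (comp_corr G X Y) (cls x y) = sanch Y y"
  by (rule class_representative[OF assms]; simp add: comp_corr_def act_pair[OF assms])+

lemma continuous_act_pair:
  defines "E \<equiv> subtopology (prod_topology (gtop G) pairs) {(g, x, y). src G g = ranch Y y}"
  shows "continuous_map E (ctop X) (\<lambda>(g, x, y). ract X x (ginv G g))"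
    and "continuous_map E (ctop Y) (\<lambda>(g, x, y). lact Y g y)"
proof -
  have g: "continuous_map E (gtop G) fst"
    unfolding E_def by (rule continuous_map_from_subtopology[OF continuous_map_fst])
  have p: "continuous_map E pairs snd"
    unfolding E_def by (rule continuous_map_from_subtopology[OF continuous_map_snd])
  have "continuous_map pairs (ctop X) fst" "continuous_map pairs (ctop Y) snd"
    by (rule continuous_map_from_subtopology[OF continuous_map_fst]
        continuous_map_from_subtopology[OF continuous_map_snd])+
  then have x: "continuous_map E (ctop X) (fst \<circ> snd)" and y: "continuous_map E (ctop Y) (snd \<circ> snd)"
    using continuous_map_compose[OF p] by blast+
  have gi: "continuous_map E (gtop G) (ginv G \<circ> fst)"
    by (rule continuous_map_compose[OF g X.right.continuous_ginv])
  have "continuous_map E (subtopology (prod_topology (ctop X) (gtop G)) {(x, g). sanch X x = rng G g})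
      (\<lambda>p. ((fst \<circ> snd) p, (ginv G \<circ> fst) p))"
    unfolding continuous_map_in_subtopology
    using continuous_map_pairedI[OF x gi]
    by (auto simp: E_def X.right.topspace_gtop X.right.arr_facts)
  from continuous_map_compose[OF this X.continuous_ract]
  show "continuous_map E (ctop X) (\<lambda>(g, x, y). ract X x (ginv G g))"
    by (simp add: o_def case_prod_unfold)
  have "continuous_map E (subtopology (prod_topology (gtop G) (ctop Y)) {(g, y). src G g = ranch Y y})
      (\<lambda>p. (fst p, (snd \<circ> snd) p))"
    unfolding continuous_map_in_subtopology
    using continuous_map_pairedI[OF g y] by (auto simp: E_def)
  from continuous_map_compose[OF this Y.continuous_lact]
  show "continuous_map E (ctop Y) (\<lambda>(g, x, y). lact Y g y)"
    by (simp add: o_def case_prod_unfold)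
qed

text \<open>The quotient map to the composite is open because \<open>G\<close> is etale: the saturation of an open set consists of the
  pairs \<open>p\<close> that some arrow \<open>g\<close> moves into the set, so it is the projection of an open set of pairs \<open>(g, p)\<close>, and
  this projection is open because the source map of \<open>G\<close> is open.\<close>

lemma openin_class_image:
  assumes U: "openin (ctop X) U" and V: "openin (ctop Y) V"
  shows "openin (ctop (comp_corr G X Y)) {cls x y | x y. x \<in> U \<and> y \<in> V \<and> sanch X x = ranch Y y}"
    (is "openin _ ?Q")
proof -
  have sub: "U \<subseteq> X.pts" "V \<subseteq> Y.pts" using U V openin_subset by blast+
  let ?D = "{(g, x, y). src G g = ranch Y y}"
  let ?E = "subtopology (prod_topology (gtop G) pairs) ?D"
  let ?W = "{p \<in> topspace ?E. (case p of (g, x, y) \<Rightarrow> ract X x (ginv G g)) \<in> U} \<inter>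
            {p \<in> topspace ?E. (case p of (g, x, y) \<Rightarrow> lact Y g y) \<in> V}"
  have "openin pairs (snd ` ?W)"
  proof (rule openin_snd_image_of_fibred)
    show "openin ?E ?W"
      by (intro openin_Int openin_continuous_map_preimage[OF continuous_act_pair(1) U]
          openin_continuous_map_preimage[OF continuous_act_pair(2) V])
    fix N assume N: "openin (gtop G) N"
    have "continuous_map pairs (gtop G) (ranch Y \<circ> snd)"
      by (rule continuous_map_compose[OF continuous_map_from_subtopology[OF continuous_map_snd] Y.continuous_ranch'])
    then have "openin pairs {p \<in> topspace pairs. (ranch Y \<circ> snd) p \<in> src G ` N}"
      using X.right.openin_src_image[OF N] by (rule openin_continuous_map_preimage)
    moreover have "{p \<in> topspace pairs. (ranch Y \<circ> snd) p \<in> src G ` N} =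
        {p \<in> topspace pairs. \<exists>g\<in>N. (g, p) \<in> ?D}" by force
    ultimately show "openin pairs {p \<in> topspace pairs. \<exists>g\<in>N. (g, p) \<in> ?D}" by simp
  qed
  moreover have "snd ` ?W = {p \<in> topspace pairs. (case p of (x, y) \<Rightarrow> cls x y) \<in> ?Q}" (is "_ = ?R")
  proof
    show "snd ` ?W \<subseteq> ?R"
    proof
      fix p assume "p \<in> snd ` ?W"
      then obtain g x y where p: "p = (x, y)" "g \<in> arr G" "src G g = ranch Y y" "x \<in> X.pts" "y \<in> Y.pts"
        "sanch X x = ranch Y y" "ract X x (ginv G g) \<in> U" "lact Y g y \<in> V"
        by (auto simp: X.right.topspace_gtop)
      have "cls x y = cls (ract X x (ginv G g)) (lact Y g y)"
        using class_act[of x y g] p by simp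
      moreover have "sanch X (ract X x (ginv G g)) = ranch Y (lact Y g y)"
        using act_pair[of x y g] p by simp
      ultimately show "p \<in> ?R" using p by auto
    qed
    show "?R \<subseteq> snd ` ?W"
    proof
      fix p assume "p \<in> ?R"
      then obtain x y x' y' where p: "p = (x, y)" "x \<in> X.pts" "y \<in> Y.pts" "sanch X x = ranch Y y"
        "x' \<in> U" "y' \<in> V" "sanch X x' = ranch Y y'" "cls x y = cls x' y'" by auto
      then have "(x', y') \<in> cls x y" using class_refl[of x' y'] sub by auto
      then obtain g where g: "g \<in> arr G" "src G g = ranch Y y" "x' = ract X x (ginv G g)" "y' = lact Y g y"
        by (auto simp: comp_class_def)
      have "(g, x, y) \<in> ?W" using p g by (simp add: X.right.topspace_gtop)
      then show "p \<in> snd ` ?W" using p(1) by force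
    qed
  qed
  moreover have "?Q \<subseteq> (\<lambda>(x, y). cls x y) ` topspace pairs" using sub by force
  ultimately show ?thesis by (simp add: comp_corr_def openin_quotient_topology)
qed

lemma class_in_comp_corr:
  assumes "x \<in> X.pts" "y \<in> Y.pts" "sanch X x = ranch Y y"
  shows "cls x y \<in> topspace (ctop (comp_corr G X Y))"
  using openin_subset[OF openin_class_image[OF openin_topspace openin_topspace]] assms by blast

lemma corr_iso_class:
  assumes iso: "corr_iso H (comp_corr G X Y) Z K f"
    and "x \<in> X.pts" "y \<in> Y.pts" "sanch X x = ranch Y y"
  shows "f (cls x y) \<in> topspace (ctop Z)" "ranch Z (f (cls x y)) = ranch X x"
    "sanch Z (f (cls x y)) = sanch Y y"
proof -
  have "homeomorphic_map (ctop (comp_corr G X Y)) (ctop Z) f" using iso by (simp add: corr_iso_def)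
  then show "f (cls x y) \<in> topspace (ctop Z)"
    using class_in_comp_corr[OF assms(2-4)] homeomorphic_imp_surjective_map by blast
  show "ranch Z (f (cls x y)) = ranch X x" "sanch Z (f (cls x y)) = sanch Y y"
    using iso class_in_comp_corr[OF assms(2-4)] comp_corr_anchors[OF assms(2-4)]
    by (simp_all add: corr_iso_def)
qed

lemma corr_iso_openin:
  assumes iso: "corr_iso H (comp_corr G X Y) Z K f"
    and "openin (ctop X) U" "openin (ctop Y) V"
  shows "openin (ctop Z) {f (cls x y) | x y. x \<in> U \<and> y \<in> V \<and> sanch X x = ranch Y y}"
proof -
  have "open_map (ctop (comp_corr G X Y)) (ctop Z) f"
    using iso unfolding corr_iso_def by (blast intro: homeomorphic_imp_open_map)
  then have "openin (ctop Z) (f ` {cls x y | x y. x \<in> U \<and> y \<in> V \<and> sanch X x = ranch Y y})"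
    using openin_class_image[OF assms(2,3)] unfolding open_map_def by blast
  moreover have "f ` {cls x y | x y. x \<in> U \<and> y \<in> V \<and> sanch X x = ranch Y y} =
      {f (cls x y) | x y. x \<in> U \<and> y \<in> V \<and> sanch X x = ranch Y y}" by blast
  ultimately show ?thesis by simp
qed

end

section \<open>Tight diagrams and their slices\<close>

locale tight_diag =
  fixes C :: "'c category" and F :: "('c, 'a) diag"
  assumes small: "small_category C" and tight_F: "tight_diagram C F"
begin

lemma diagram: "diagram C F" using tight_F by (simp add: tight_diagram_def)

lemma arr_C:
  assumes "g \<in> arr C"
  shows "src C g \<in> arr C" "rng C g \<in> arr C" "src C (src C g) = src C g" "rng C (src C g) = src C g"
    "src C (rng C g) = rng C g" "rng C (rng C g) = rng C g" "cmp C (rng C g) g = g" "cmp C g (src C g) = g"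
  using assms small by (simp_all add: small_category_def)

lemma obj_C: assumes "x \<in> obj C" shows "x \<in> arr C" "src C x = x" "rng C x = x" "cmp C x x = x"
  using assms arr_C(4,8)[of x] by (auto simp: obj_def)

lemma src_obj_C: "g \<in> arr C \<Longrightarrow> src C g \<in> obj C" and rng_obj_C: "g \<in> arr C \<Longrightarrow> rng C g \<in> obj C"
  by (simp_all add: obj_def arr_C)

lemma cmp_C:
  assumes "g \<in> arr C" "h \<in> arr C" "src C g = rng C h"
  shows "cmp C g h \<in> arr C" "src C (cmp C g h) = src C h" "rng C (cmp C g h) = rng C g"
  using assms small by (simp_all add: small_category_def)

abbreviation Gr where "Gr \<equiv> grp F"
abbreviation s where "s g \<equiv> sanch (cor F g)"
abbreviation r where "r g \<equiv> ranch (cor F g)"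
abbreviation ctp where "ctp g \<equiv> ctop (cor F g)"
abbreviation ra where "ra g \<equiv> ract (cor F g)"
abbreviation prd where "prd \<equiv> dprod C F"

lemma etale_Gr: "x \<in> obj C \<Longrightarrow> etale (Gr x)"
  using diagram by (simp add: diagram_def etale_def)

lemma tight_corr_F:
  assumes "g \<in> arr C"
  shows "tight_corr (Gr (rng C g)) (Gr (src C g)) (cor F g)"
proof -
  have "correspondence (Gr (rng C g)) (cor F g) (Gr (src C g))" using diagram assms by (simp add: diagram_def)
  moreover have "tight (Gr (rng C g)) (cor F g) (Gr (src C g))"
    using tight_F assms by (simp add: tight_diagram_def)
  ultimately show ?thesis
    using assms by (intro tight_corr.intro grpd_corr.intro grpd_corr_axioms.intro tight_corr_axioms.intro
        etale_Gr rng_obj_C src_obj_C)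
qed

lemmas grpd_corr_F = tight_corr_F[THEN tight_corr.axioms(1)]

lemma composable_F:
  assumes "g \<in> arr C" "h \<in> arr C" "src C g = rng C h"
  shows "composable_corrs (Gr (rng C g)) (Gr (src C g)) (Gr (src C h)) (cor F g) (cor F h)"
  using grpd_corr_F[OF assms(1)] grpd_corr_F[OF assms(2)] assms(3) by (simp add: composable_corrs_def)

lemma mu_iso:
  assumes "g \<in> arr C" "h \<in> arr C" "src C g = rng C h"
  shows "corr_iso (Gr (rng C g)) (comp_corr (Gr (src C g)) (cor F g) (cor F h))
          (cor F (cmp C g h)) (Gr (src C h)) (mu F g h)"
  using diagram assms by (simp add: diagram_def)

lemma prd_facts:
  assumes "g \<in> arr C" "h \<in> arr C" "src C g = rng C h"
    "\<gamma> \<in> cpts F g" "\<eta> \<in> cpts F h" "s g \<gamma> = r h \<eta>"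
  shows "prd g h \<gamma> \<eta> \<in> cpts F (cmp C g h)" "r (cmp C g h) (prd g h \<gamma> \<eta>) = r g \<gamma>"
    "s (cmp C g h) (prd g h \<gamma> \<eta>) = s h \<eta>"
  using composable_corrs.corr_iso_class[OF composable_F[OF assms(1-3)] mu_iso[OF assms(1-3)] assms(4-6)]
  by (simp_all add: dprod_def)

lemma openin_prd:
  assumes "g \<in> arr C" "h \<in> arr C" "src C g = rng C h" "openin (ctp g) U" "openin (ctp h) V"
  shows "openin (ctp (cmp C g h)) {prd g h \<gamma> \<eta> | \<gamma> \<eta>. \<gamma> \<in> U \<and> \<eta> \<in> V \<and> s g \<gamma> = r h \<eta>}"
  using composable_corrs.corr_iso_openin[OF composable_F[OF assms(1-3)] mu_iso[OF assms(1-3)] assms(4,5)]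
  by (simp add: dprod_def)

lemma unit_cor:
  assumes "x \<in> obj C"
  shows "ctp x = gtop (Gr x)" "cpts F x = arr (Gr x)"
    "\<gamma> \<in> arr (Gr x) \<Longrightarrow> r x \<gamma> = rng (Gr x) \<gamma>" "\<gamma> \<in> arr (Gr x) \<Longrightarrow> s x \<gamma> = src (Gr x) \<gamma>"
proof -
  show *: "ctp x = gtop (Gr x)" using diagram assms by (simp add: diagram_def)
  show "cpts F x = arr (Gr x)" unfolding * by (rule etale.topspace_gtop[OF etale_Gr[OF assms]])
  show "\<gamma> \<in> arr (Gr x) \<Longrightarrow> r x \<gamma> = rng (Gr x) \<gamma>" "\<gamma> \<in> arr (Gr x) \<Longrightarrow> s x \<gamma> = src (Gr x) \<gamma>"
    using diagram assms by (simp_all add: diagram_def)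
qed

lemma prd_unit_right:
  assumes "g \<in> arr C" "\<gamma> \<in> cpts F g" "\<eta> \<in> arr (Gr (src C g))" "s g \<gamma> = rng (Gr (src C g)) \<eta>"
  shows "prd g (src C g) \<gamma> \<eta> = ra g \<gamma> \<eta>"
  using diagram assms by (simp add: diagram_def)

lemma s_obj: "g \<in> arr C \<Longrightarrow> \<gamma> \<in> cpts F g \<Longrightarrow> s g \<gamma> \<in> obj (Gr (src C g))"
  and r_obj: "g \<in> arr C \<Longrightarrow> \<gamma> \<in> cpts F g \<Longrightarrow> r g \<gamma> \<in> obj (Gr (rng C g))"
  by (simp_all add: grpd_corr.sanch_obj[OF grpd_corr_F] grpd_corr.ranch_obj[OF grpd_corr_F])

lemma slices_iff:
  assumes "g \<in> arr C"
  shows "U \<in> slices C F g \<longleftrightarrow> openin (ctp g) U \<and> inj_on (s g) U \<and> inj_on (r g) U"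
  unfolding slices_def mem_Collect_eq
  using tight_corr.inj_on_orbit_iff[OF tight_corr_F[OF assms]] openin_subset by metis

lemma slice_sub: "U \<in> slices C F g \<Longrightarrow> U \<subseteq> cpts F g"
  unfolding slices_def using openin_subset by blast

lemma slice_open: "U \<in> slices C F g \<Longrightarrow> openin (ctp g) U"
  by (simp add: slices_def)

lemma slice_openin_sub:
  assumes "U \<in> slices C F g" "openin (ctp g) V"
  shows "U \<inter> V \<in> slices C F g"
  using assms unfolding slices_def by (auto intro: inj_on_subset openin_Int)

lemma slice_at:
  assumes "g \<in> arr C" "\<gamma> \<in> cpts F g"
  obtains U where "U \<in> slices C F g" "\<gamma> \<in> U"
proof -
  obtain U where U: "openin (ctp g) U" "\<gamma> \<in> U" "inj_on (corr_orbit (Gr (src C g)) (cor F g)) U"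
    using grpd_corr.locally_orbit_injective[OF grpd_corr_F[OF assms(1)] assms(2)] .
  obtain V where V: "openin (ctp g) V" "\<gamma> \<in> V" "inj_on (s g) V"
    using local_homeomorphism_imp_locally_inj[OF grpd_corr.sanch_local[OF grpd_corr_F[OF assms(1)]] assms(2)] .
  have "U \<inter> V \<in> slices C F g"
    using U V unfolding slices_def by (auto intro: inj_on_subset openin_Int)
  then show ?thesis using that U V by blast
qed

lemma mk_bis_Bis: "g \<in> arr C \<Longrightarrow> U \<in> slices C F g \<Longrightarrow> mk_bis g U \<in> Bis C F"
  by (auto simp: Bis_def)

lemma Bis_Some: "Some (g, U) \<in> Bis C F \<longleftrightarrow> g \<in> arr C \<and> U \<in> slices C F g \<and> U \<noteq> {}"
  by (auto simp: Bis_def mk_bis_def)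

lemma None_Bis: "g \<in> arr C \<Longrightarrow> None \<in> Bis C F"
proof -
  assume "g \<in> arr C"
  then have "mk_bis g {} \<in> Bis C F" by (intro mk_bis_Bis) (auto simp: slices_def)
  then show ?thesis by (simp add: mk_bis_def)
qed

text \<open>The source of \<open>\<gamma> \<cdot> \<eta>\<close> is that of \<open>\<eta>\<close>, so it determines \<open>\<eta>\<close> in the slice \<open>V\<close>. Then \<open>s \<gamma> = r \<eta>\<close> determines \<open>\<gamma>\<close>.
  Injectivity of the range map follows in the same way, starting with \<open>\<gamma>\<close>.\<close>

lemma prd_slice:
  assumes gh: "g \<in> arr C" "h \<in> arr C" "src C g = rng C h" and U: "U \<in> slices C F g" and V: "V \<in> slices C F h"
  shows "{prd g h \<gamma> \<eta> | \<gamma> \<eta>. \<gamma> \<in> U \<and> \<eta> \<in> V \<and> s g \<gamma> = r h \<eta>} \<in> slices C F (cmp C g h)" (is "?W \<in> _")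
proof -
  have inj: "inj_on (s g) U" "inj_on (r g) U" "inj_on (s h) V" "inj_on (r h) V"
    using U V slices_iff gh by auto
  have eq: "s (cmp C g h) (prd g h \<gamma> \<eta>) = s h \<eta>" "r (cmp C g h) (prd g h \<gamma> \<eta>) = r g \<gamma>"
    if "\<gamma> \<in> U" "\<eta> \<in> V" "s g \<gamma> = r h \<eta>" for \<gamma> \<eta>
    using prd_facts[OF gh, of \<gamma> \<eta>] that slice_sub[OF U] slice_sub[OF V] by auto
  have "inj_on (s (cmp C g h)) ?W"
  proof (rule inj_onI, clarify)
    fix \<gamma> \<eta> \<gamma>' \<eta>' assume *: "\<gamma> \<in> U" "\<eta> \<in> V" "s g \<gamma> = r h \<eta>" "\<gamma>' \<in> U" "\<eta>' \<in> V" "s g \<gamma>' = r h \<eta>'"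
      "s (cmp C g h) (prd g h \<gamma> \<eta>) = s (cmp C g h) (prd g h \<gamma>' \<eta>')"
    then have "\<eta> = \<eta>'" using eq inj_onD[OF inj(3)] by simp
    then have "s g \<gamma> = s g \<gamma>'" using *(3,6) by simp
    then have "\<gamma> = \<gamma>'" by (rule inj_onD[OF inj(1) _ *(1,4)])
    then show "prd g h \<gamma> \<eta> = prd g h \<gamma>' \<eta>'" using \<open>\<eta> = \<eta>'\<close> by simp
  qed
  moreover have "inj_on (r (cmp C g h)) ?W"
  proof (rule inj_onI, clarify)
    fix \<gamma> \<eta> \<gamma>' \<eta>' assume *: "\<gamma> \<in> U" "\<eta> \<in> V" "s g \<gamma> = r h \<eta>" "\<gamma>' \<in> U" "\<eta>' \<in> V" "s g \<gamma>' = r h \<eta>'"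
      "r (cmp C g h) (prd g h \<gamma> \<eta>) = r (cmp C g h) (prd g h \<gamma>' \<eta>')"
    then have "\<gamma> = \<gamma>'" using eq inj_onD[OF inj(2)] by simp
    then have "r h \<eta> = r h \<eta>'" using *(3,6) by simp
    then have "\<eta> = \<eta>'" by (rule inj_onD[OF inj(4) _ *(2,5)])
    then show "prd g h \<gamma> \<eta> = prd g h \<gamma>' \<eta>'" using \<open>\<gamma> = \<gamma>'\<close> by simp
  qed
  ultimately show ?thesis
    using openin_prd[OF gh slice_open[OF U] slice_open[OF V]] slices_iff[OF cmp_C(1)[OF gh]] by blast
qed

lemma bis_mul_Bis:
  assumes "u \<in> Bis C F" "v \<in> Bis C F"
  shows "bis_mul C F u v \<in> Bis C F"
proof (cases u; cases v)
  fix p q assume pq: "u = Some p" "v = Some q"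
  obtain g U h V where gU: "p = (g, U)" "q = (h, V)" by force
  then have "g \<in> arr C" "U \<in> slices C F g" "h \<in> arr C" "V \<in> slices C F h"
    using assms pq Bis_Some by auto
  then show ?thesis using pq gU prd_slice[of g h U V] None_Bis by (auto intro: mk_bis_Bis cmp_C)
qed (use assms None_Bis in \<open>auto simp: Bis_def mk_bis_def split: if_splits\<close>)

text \<open>An element \<open>a\<close> of the inner product of \<open>U\<close> and \<open>V\<close> is determined by \<open>\<gamma> \<in> U\<close> and \<open>\<gamma> a \<in> V\<close>, because the action is
  free. The source of \<open>a\<close> is that of \<open>\<gamma> a\<close> and its range is the source of \<open>\<gamma>\<close>; since \<open>\<gamma>\<close> and \<open>\<gamma> a\<close> have the same
  left anchor, each of the two points determines the other.\<close>

lemma inner_slice_slice: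
  assumes g: "g \<in> arr C" and U: "U \<in> slices C F g" and V: "V \<in> slices C F g"
  shows "inner_slice (Gr (src C g)) (cor F g) U V \<in> slices C F (src C g)"
proof -
  interpret tight_corr "Gr (rng C g)" "Gr (src C g)" "cor F g" by (rule tight_corr_F[OF g])
  let ?W = "inner_slice (Gr (src C g)) (cor F g) U V"
  have inj: "inj_on (s g) U" "inj_on (r g) U" "inj_on (s g) V" "inj_on (r g) V"
    using U V slices_iff g by auto
  note W = inner_slice_eq[OF slice_sub[OF U] slice_sub[OF V]]
  note x = src_obj_C[OF g]
  have "inj_on (s (src C g)) ?W"
  proof (rule inj_onI)
    fix a b assume ab: "a \<in> ?W" "b \<in> ?W" "s (src C g) a = s (src C g) b"
    then obtain \<gamma> \<delta> where *: "\<gamma> \<in> U" "\<delta> \<in> U" "s g \<gamma> = rng (Gr (src C g)) a" "s g \<delta> = rng (Gr (src C g)) b"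
      "ra g \<gamma> a \<in> V" "ra g \<delta> b \<in> V" "a \<in> arr (Gr (src C g))" "b \<in> arr (Gr (src C g))" unfolding W by blast
    have p: "\<gamma> \<in> pts" "\<delta> \<in> pts" using * slice_sub[OF U] by auto
    have "s g (ra g \<gamma> a) = s g (ra g \<delta> b)" using * p ab(3) by (simp add: ract_facts unit_cor[OF x])
    then have eq: "ra g \<gamma> a = ra g \<delta> b" using * inj_onD[OF inj(3)] by blast
    then have "r g \<gamma> = r g \<delta>" using * p ract_facts(2)[of \<gamma> a] ract_facts(2)[of \<delta> b] by simp
    then have "\<gamma> = \<delta>" using * inj_onD[OF inj(2)] by blast
    then show "a = b" using ract_free[of \<gamma> a b] eq * p by simp
  qed
  moreover have "inj_on (r (src C g)) ?W"
  proof (rule inj_onI)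
    fix a b assume ab: "a \<in> ?W" "b \<in> ?W" "r (src C g) a = r (src C g) b"
    then obtain \<gamma> \<delta> where *: "\<gamma> \<in> U" "\<delta> \<in> U" "s g \<gamma> = rng (Gr (src C g)) a" "s g \<delta> = rng (Gr (src C g)) b"
      "ra g \<gamma> a \<in> V" "ra g \<delta> b \<in> V" "a \<in> arr (Gr (src C g))" "b \<in> arr (Gr (src C g))" unfolding W by blast
    have p: "\<gamma> \<in> pts" "\<delta> \<in> pts" using * slice_sub[OF U] by auto
    have "s g \<gamma> = s g \<delta>" using * ab(3) by (simp add: unit_cor[OF x])
    then have eq: "\<gamma> = \<delta>" using * inj_onD[OF inj(1)] by blast
    then have "r g (ra g \<gamma> a) = r g (ra g \<delta> b)" using * p by (simp add: ract_facts)
    then have "ra g \<gamma> a = ra g \<delta> b" using * inj_onD[OF inj(4)] by blast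
    then show "a = b" using ract_free[of \<gamma> a b] eq * p by simp
  qed
  moreover have "openin (ctp (src C g)) ?W"
    unfolding unit_cor(1)[OF x] by (rule openin_inner_slice[OF slice_open[OF U] slice_open[OF V]])
  ultimately show ?thesis using slices_iff[OF arr_C(1)[OF g]] by blast
qed

lemma unit_slice:
  assumes "x \<in> obj C" "openin (gtop (Gr x)) E" "E \<subseteq> obj (Gr x)"
  shows "E \<in> slices C F x"
proof -
  interpret etale "Gr x" by (rule etale_Gr[OF assms(1)])
  have "s x e = e \<and> r x e = e" if "e \<in> E" for e
    using that assms obj_facts[of e] unit_cor[OF assms(1)] by auto
  then have "inj_on (s x) E" "inj_on (r x) E" unfolding inj_on_def by metis+
  then show ?thesis using assms slices_iff[OF obj_C(1)] unit_cor by simp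
qed

lemma I_rels_over:
  assumes "(t, u) \<in> I_rels C F"
  shows "set_isg_term t \<subseteq> Bis C F \<and> set_isg_term u \<subseteq> Bis C F"
  using assms unfolding I_rels_def
  by (auto simp: bis_mul_Bis mk_bis_Bis arr_C inner_slice_slice)

end

section \<open>Actions of tight diagrams\<close>

locale diag_action = tight_diag C F
  for C :: "'c category" and F :: "('c, 'a) diag" +
  fixes Z :: "'y topology" and A :: "('c, 'a, 'y) faction"
  assumes action: "F_action C F Z A"
begin

abbreviation fd where "fd \<equiv> fdom C F A"
abbreviation fm where "fm \<equiv> fmul A"
abbreviation fdtop where "fdtop g \<equiv> subtopology (prod_topology (ctp g) Z) (fd g)"

lemma part_cover: "y \<in> topspace Z \<longleftrightarrow> (\<exists>x\<in>obj C. y \<in> part A x)"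
proof -
  have "(\<Union>x\<in>obj C. part A x) = topspace Z" using action by (simp add: F_action_def)
  then show ?thesis by blast
qed

lemma part_unique: "x \<in> obj C \<Longrightarrow> x' \<in> obj C \<Longrightarrow> y \<in> part A x \<Longrightarrow> y \<in> part A x' \<Longrightarrow> x = x'"
  using action unfolding F_action_def disjoint_family_on_def by blast

lemma part_sub: "x \<in> obj C \<Longrightarrow> part A x \<subseteq> topspace Z"
  using part_cover by blast

lemma openin_part: "x \<in> obj C \<Longrightarrow> openin Z (part A x)"
  using action by (simp add: F_action_def)

lemma continuous_fanch: "x \<in> obj C \<Longrightarrow> continuous_map (subtopology Z (part A x)) (unit_space (Gr x)) (fanch A)"
  using action by (simp add: F_action_def)

lemma fanch_obj:
  assumes "x \<in> obj C" "y \<in> part A x"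
  shows "fanch A y \<in> obj (Gr x)"
  using funcset_mem[OF continuous_map_funspace[OF continuous_fanch[OF assms(1)]], of y] assms part_sub[OF assms(1)]
  by (auto simp: etale.topspace_unit_space[OF etale_Gr[OF assms(1)]])

lemma openin_fanch_vimage:
  assumes x: "x \<in> obj C" and N: "openin (gtop (Gr x)) N"
  shows "openin Z {y \<in> part A x. fanch A y \<in> N}"
proof -
  have "continuous_map (subtopology Z (part A x)) (gtop (Gr x)) (fanch A)"
    using continuous_fanch[OF x] by (simp add: unit_space_def continuous_map_in_subtopology)
  then have "openin (subtopology Z (part A x)) {y \<in> topspace (subtopology Z (part A x)). fanch A y \<in> N}"
    using N by (rule openin_continuous_map_preimage)
  moreover have "{y \<in> topspace (subtopology Z (part A x)). fanch A y \<in> N} = {y \<in> part A x. fanch A y \<in> N}"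
    using part_sub[OF x] by auto
  ultimately show ?thesis using openin_open_subtopology[OF openin_part[OF x]] by simp
qed

lemma fdom_iff: "(\<gamma>, y) \<in> fd g \<longleftrightarrow> \<gamma> \<in> cpts F g \<and> y \<in> part A (src C g) \<and> s g \<gamma> = fanch A y"
  by (simp add: fdom_def)

lemma topspace_fdtop: "g \<in> arr C \<Longrightarrow> topspace (fdtop g) = fd g"
  using subsetD[OF part_sub[OF src_obj_C[of g]]] by (auto simp: fdom_iff)

lemma mult_map:
  assumes "g \<in> arr C"
  shows "continuous_map (fdtop g) (subtopology Z (part A (rng C g))) (\<lambda>(\<gamma>, y). fm g \<gamma> y)"
    "open_map (fdtop g) (subtopology Z (part A (rng C g))) (\<lambda>(\<gamma>, y). fm g \<gamma> y)"
    "(\<lambda>(\<gamma>, y). fm g \<gamma> y) ` fd g = part A (rng C g)"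
proof -
  have *: "let D = fdtop g; E = subtopology Z (part A (rng C g)); m = (\<lambda>(\<gamma>, y). fm g \<gamma> y)
         in continuous_map D E m \<and> open_map D E m \<and> m ` topspace D = topspace E"
    using action assms by (simp add: F_action_def)
  then show "continuous_map (fdtop g) (subtopology Z (part A (rng C g))) (\<lambda>(\<gamma>, y). fm g \<gamma> y)"
    "open_map (fdtop g) (subtopology Z (part A (rng C g))) (\<lambda>(\<gamma>, y). fm g \<gamma> y)"
    by (simp_all add: Let_def)
  show "(\<lambda>(\<gamma>, y). fm g \<gamma> y) ` fd g = part A (rng C g)"
    using * part_sub[OF rng_obj_C[OF assms]] unfolding Let_def topspace_fdtop[OF assms]
    by (auto simp: Int_absorb1)
qed

lemma fmul_part: "g \<in> arr C \<Longrightarrow> (\<gamma>, y) \<in> fd g \<Longrightarrow> fm g \<gamma> y \<in> part A (rng C g)"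
  using mult_map(3)[of g] by force

lemma fmul_surj:
  assumes "g \<in> arr C" "z \<in> part A (rng C g)"
  obtains \<gamma> y where "(\<gamma>, y) \<in> fd g" "z = fm g \<gamma> y"
  using mult_map(3)[OF assms(1)] assms(2) by force

lemma openin_fmul_image:
  assumes g: "g \<in> arr C" and W: "openin (fdtop g) W"
  shows "openin Z ((\<lambda>(\<gamma>, y). fm g \<gamma> y) ` W)"
  using mult_map(2)[OF g] W openin_open_subtopology[OF openin_part[OF rng_obj_C[OF g]]]
  unfolding open_map_def by blast

lemma openin_fmul_vimage:
  assumes g: "g \<in> arr C" and V: "openin Z V"
  shows "openin (fdtop g) {p \<in> fd g. (case p of (\<gamma>, y) \<Rightarrow> fm g \<gamma> y) \<in> V}"
proof -
  have "continuous_map (fdtop g) Z (\<lambda>(\<gamma>, y). fm g \<gamma> y)"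
    using mult_map(1)[OF g] continuous_map_into_fulltopology by blast
  from openin_continuous_map_preimage[OF this V] show ?thesis by (simp only: topspace_fdtop[OF g])
qed

lemma fmul_anch: "g \<in> arr C \<Longrightarrow> (\<gamma>, y) \<in> fd g \<Longrightarrow> fanch A (fm g \<gamma> y) = r g \<gamma>"
  using action by (auto simp: F_action_def)

lemma fmul_assoc:
  assumes "g \<in> arr C" "h \<in> arr C" "src C g = rng C h" "\<gamma> \<in> cpts F g" "(\<eta>, y) \<in> fd h" "s g \<gamma> = r h \<eta>"
  shows "fm g \<gamma> (fm h \<eta> y) = fm (cmp C g h) (prd g h \<gamma> \<eta>) y"
proof -
  have "\<forall>\<gamma>\<in>cpts F g. \<forall>(\<eta>, y)\<in>fd h. s g \<gamma> = r h \<eta> \<longrightarrow>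
      fm g \<gamma> (fm h \<eta> y) = fm (cmp C g h) (prd g h \<gamma> \<eta>) y"
    using action assms(1-3) by (simp add: F_action_def)
  from bspec[OF bspec[OF this assms(4)] assms(5)] show ?thesis using assms(6) by simp
qed

lemma fmul_cancel:
  assumes "g \<in> arr C" "(\<gamma>, y) \<in> fd g" "(\<gamma>', y') \<in> fd g" "fm g \<gamma> y = fm g \<gamma>' y'"
  obtains \<eta> where "\<eta> \<in> arr (Gr (src C g))" "s g \<gamma> = rng (Gr (src C g)) \<eta>" "\<gamma>' = ra g \<gamma> \<eta>"
    "src (Gr (src C g)) \<eta> = fanch A y'" "y = fm (src C g) \<eta> y'"
proof -
  have "\<forall>(\<gamma>, y)\<in>fd g. \<forall>(\<gamma>', y')\<in>fd g. fm g \<gamma> y = fm g \<gamma>' y' \<longrightarrow>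
      (\<exists>\<eta>\<in>arr (Gr (src C g)). s g \<gamma> = rng (Gr (src C g)) \<eta> \<and> \<gamma>' = ra g \<gamma> \<eta> \<and>
        src (Gr (src C g)) \<eta> = fanch A y' \<and> y = fm (src C g) \<eta> y')"
    using action assms(1) by (simp add: F_action_def)
  from bspec[OF this assms(2), simplified, THEN bspec, OF assms(3)]
  show ?thesis using assms(4) that by auto
qed

text \<open>Units act trivially because the product map is surjective: every point of \<open>part A x\<close> is a product \<open>\<gamma> \<cdot> y\<close> with
  \<open>\<gamma>\<close> in the groupoid at \<open>x\<close>, and multiplication by the unit \<open>r \<gamma>\<close> fixes \<open>\<gamma>\<close>.\<close>

lemma fmul_unit:
  assumes x: "x \<in> obj C" and y: "y \<in> part A x"
  shows "fm x (fanch A y) y = y"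
proof -
  interpret G: etale "Gr x" by (rule etale_Gr[OF x])
  note xC = obj_C[OF x] and uc = unit_cor(2-4)[OF x]
  obtain \<gamma> w where w: "(\<gamma>, w) \<in> fd x" "y = fm x \<gamma> w"
    using fmul_surj[of x y] xC y by auto
  have \<gamma>: "\<gamma> \<in> arr (Gr x)" using w(1) by (simp add: fdom_iff uc)
  have e: "fanch A y = rng (Gr x) \<gamma>" "rng (Gr x) \<gamma> \<in> arr (Gr x)"
    using fmul_anch[OF xC(1) w(1)] w(2) \<gamma> by (simp_all add: uc G.arr_facts)
  have "fm x (rng (Gr x) \<gamma>) y = fm x (prd x x (rng (Gr x) \<gamma>) \<gamma>) w"
    using fmul_assoc[OF xC(1) xC(1) _ _ w(1), of "rng (Gr x) \<gamma>"] xC \<gamma> e w(2)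
    by (simp add: uc G.arr_facts)
  also have "prd x x (rng (Gr x) \<gamma>) \<gamma> = \<gamma>"
  proof -
    have "prd x x (rng (Gr x) \<gamma>) \<gamma> = ra x (rng (Gr x) \<gamma>) \<gamma>"
      using prd_unit_right[OF xC(1), of "rng (Gr x) \<gamma>" \<gamma>] xC \<gamma> e by (simp add: uc G.arr_facts)
    also have "\<dots> = cmp (Gr x) (rng (Gr x) \<gamma>) \<gamma>"
      using diagram x \<gamma> e by (simp add: diagram_def G.arr_facts)
    finally show ?thesis using \<gamma> by (simp add: G.arr_facts)
  qed
  finally show ?thesis using e w(2) by simp
qed

lemma fmul_ract:
  assumes g: "g \<in> arr C" and \<gamma>: "\<gamma> \<in> cpts F g" and \<eta>: "\<eta> \<in> arr (Gr (src C g))"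
    and eq: "s g \<gamma> = rng (Gr (src C g)) \<eta>" and y: "(\<eta>, y) \<in> fd (src C g)"
  shows "fm g (ra g \<gamma> \<eta>) y = fm g \<gamma> (fm (src C g) \<eta> y)" "(\<gamma>, fm (src C g) \<eta> y) \<in> fd g"
proof -
  note x = src_obj_C[OF g]
  have "s g \<gamma> = r (src C g) \<eta>" using unit_cor[OF x] eq \<eta> by simp
  then show "fm g (ra g \<gamma> \<eta>) y = fm g \<gamma> (fm (src C g) \<eta> y)"
    using fmul_assoc[of g "src C g" \<gamma> \<eta> y] assms by (simp add: arr_C prd_unit_right)
  have "fm (src C g) \<eta> y \<in> part A (src C g)" "fanch A (fm (src C g) \<eta> y) = r (src C g) \<eta>"
    using fmul_part[of "src C g" \<eta> y] fmul_anch[of "src C g" \<eta> y] y g by (simp_all add: arr_C)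
  then show "(\<gamma>, fm (src C g) \<eta> y) \<in> fd g"
    using \<open>s g \<gamma> = r (src C g) \<eta>\<close> \<gamma> by (simp add: fdom_iff)
qed

lemma fdom_unit_iff:
  assumes "x \<in> obj C"
  shows "(\<eta>, y) \<in> fd x \<longleftrightarrow> \<eta> \<in> arr (Gr x) \<and> y \<in> part A x \<and> src (Gr x) \<eta> = fanch A y"
  using unit_cor[OF assms] obj_C[OF assms] by (auto simp: fdom_iff)

abbreviation gr where "gr \<equiv> slice_graph C F A"

lemma slice_graph_mk_bis: "gr (mk_bis g W) = {(y, fm g \<gamma> y) | \<gamma> y. \<gamma> \<in> W \<and> (\<gamma>, y) \<in> fd g}"
  by (auto simp: mk_bis_def)

lemma slice_graph_iff: "(y, z) \<in> gr (mk_bis g W) \<longleftrightarrow> (\<exists>\<gamma>\<in>W. (\<gamma>, y) \<in> fd g \<and> z = fm g \<gamma> y)"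
  unfolding slice_graph_mk_bis by auto

text \<open>The map is injective: if \<open>\<gamma> \<cdot> y = \<gamma>' \<cdot> y'\<close>, then \<open>\<gamma>' = \<gamma> \<eta>\<close> and \<open>y = \<eta> \<cdot> y'\<close> for some \<open>\<eta>\<close>. As \<open>\<gamma>\<close> and \<open>\<gamma>'\<close> belong to
  one slice, they are equal, so \<open>\<eta>\<close> is a unit by freeness. Images of open sets are open because the product map is
  open, and preimages because the fibre product that is its domain projects openly to \<open>Z\<close>.\<close>

lemma slice_graph_partial_homeo:
  assumes g: "g \<in> arr C" and U: "U \<in> slices C F g"
  shows "partial_homeo Z (gr (mk_bis g U))"
  unfolding partial_homeo_def
proof (intro conjI allI impI)
  interpret tight_corr "Gr (rng C g)" "Gr (src C g)" "cor F g" by (rule tight_corr_F[OF g])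
  let ?f = "gr (mk_bis g U)"
  have inj: "inj_on (s g) U" "inj_on (r g) U" using U slices_iff g by auto
  show "?f \<subseteq> topspace Z \<times> topspace Z"
    using subsetD[OF part_sub[OF src_obj_C[OF g]]] subsetD[OF part_sub[OF rng_obj_C[OF g]]]
      fmul_part[OF g] by (auto simp: slice_graph_iff fdom_iff)
  show "single_valued ?f"
  proof (rule single_valuedI, unfold slice_graph_iff, elim bexE conjE)
    fix y z z' \<gamma> \<gamma>' assume *: "\<gamma> \<in> U" "(\<gamma>, y) \<in> fd g" "z = fm g \<gamma> y" "\<gamma>' \<in> U" "(\<gamma>', y) \<in> fd g" "z' = fm g \<gamma>' y"
    then have "s g \<gamma> = s g \<gamma>'" by (simp add: fdom_iff)
    then have "\<gamma> = \<gamma>'" by (rule inj_onD[OF inj(1) _ *(1,4)])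
    then show "z = z'" using * by simp
  qed
  show "single_valued (?f\<inverse>)"
  proof (rule single_valuedI, unfold converse_iff slice_graph_iff, elim bexE conjE)
    fix z y y' \<gamma> \<gamma>' assume *: "\<gamma> \<in> U" "(\<gamma>, y) \<in> fd g" "z = fm g \<gamma> y" "\<gamma>' \<in> U" "(\<gamma>', y') \<in> fd g" "z = fm g \<gamma>' y'"
    then obtain \<eta> where \<eta>: "\<eta> \<in> arr (Gr (src C g))" "s g \<gamma> = rng (Gr (src C g)) \<eta>" "\<gamma>' = ra g \<gamma> \<eta>"
      "src (Gr (src C g)) \<eta> = fanch A y'" "y = fm (src C g) \<eta> y'"
      using fmul_cancel[OF g *(2,5)] *(3,6) by metis
    have p: "\<gamma> \<in> pts" using * by (simp add: fdom_iff)
    have so: "s g \<gamma> \<in> obj (Gr (src C g))" using p by (rule sanch_obj)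
    have "r g \<gamma>' = r g \<gamma>" using \<eta> p by (simp add: ract_facts)
    then have "\<gamma>' = \<gamma>" by (rule inj_onD[OF inj(2) _ *(4,1)])
    then have "ra g \<gamma> \<eta> = ra g \<gamma> (s g \<gamma>)" using \<eta>(3) ract_unit[OF p] by simp
    then have "\<eta> = s g \<gamma>"
      by (rule ract_free[OF p \<eta>(1) right.obj_facts(1)[OF so] \<eta>(2) right.obj_facts(3)[OF so, symmetric]])
    then have "\<eta> = fanch A y'" using \<eta>(4) right.obj_facts(2)[OF so] by metis
    then show "y = y'" using \<eta>(5) fmul_unit[OF src_obj_C[OF g]] *(5) by (simp add: fdom_iff)
  qed
  fix W assume W: "openin Z W"
  have UW: "openin (fdtop g) ((U \<times> V) \<inter> fd g)" if "openin Z V" for V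
    using slice_open[OF U] that by (intro openin_subtopology_Int) (simp add: openin_prod_Times_iff)
  have "?f `` W = (\<lambda>(\<gamma>, y). fm g \<gamma> y) ` ((U \<times> W) \<inter> fd g)"
    by (force simp: slice_graph_iff)
  then show "openin Z (?f `` W)" using openin_fmul_image[OF g UW[OF W]] by simp
  have "openin (fdtop g) ({p \<in> fd g. (case p of (\<gamma>, y) \<Rightarrow> fm g \<gamma> y) \<in> W} \<inter> ((U \<times> topspace Z) \<inter> fd g))"
    by (intro openin_Int openin_fmul_vimage[OF g W] UW openin_topspace)
  then have "openin Z (snd ` ({p \<in> fd g. (case p of (\<gamma>, y) \<Rightarrow> fm g \<gamma> y) \<in> W} \<inter> ((U \<times> topspace Z) \<inter> fd g)))"
  proof (rule openin_snd_image_of_fibred)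
    fix N assume N: "openin (ctp g) N"
    have "{y \<in> topspace Z. \<exists>\<gamma>\<in>N. (\<gamma>, y) \<in> fd g} = {y \<in> part A (src C g). fanch A y \<in> s g ` N}"
      using openin_subset[OF N] part_sub[OF src_obj_C[OF g]] by (auto simp: fdom_iff image_iff) metis+
    then show "openin Z {y \<in> topspace Z. \<exists>\<gamma>\<in>N. (\<gamma>, y) \<in> fd g}"
      using openin_fanch_vimage[OF src_obj_C[OF g] openin_sanch_image[OF N]] by simp
  qed
  moreover have "?f\<inverse> `` W = snd ` ({p \<in> fd g. (case p of (\<gamma>, y) \<Rightarrow> fm g \<gamma> y) \<in> W} \<inter> ((U \<times> topspace Z) \<inter> fd g))"
    using part_sub[OF src_obj_C[OF g]] by (force simp: slice_graph_iff fdom_iff)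
  ultimately show "openin Z (?f\<inverse> `` W)" by simp
qed

lemma partial_homeo_Bis: "b \<in> Bis C F \<Longrightarrow> partial_homeo Z (gr b)"
  by (auto simp: Bis_def slice_graph_partial_homeo simp del: slice_graph.simps)

lemma slice_graph_mul:
  assumes "u \<in> Bis C F" "v \<in> Bis C F"
  shows "gr (bis_mul C F u v) = gr v O gr u"
proof (cases u; cases v)
  fix p q assume pq: "u = Some p" "v = Some q"
  obtain g U h V where gU: "p = (g, U)" "q = (h, V)" by force
  have gC: "g \<in> arr C" "h \<in> arr C" and U: "U \<in> slices C F g" and V: "V \<in> slices C F h"
    and ne: "U \<noteq> {}" "V \<noteq> {}"
    using assms pq gU Bis_Some by auto
  have mk: "Some (g, U) = mk_bis g U" "Some (h, V) = mk_bis h V" using ne by (auto simp: mk_bis_def)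
  show ?thesis
  proof (cases "src C g = rng C h")
    case eq: True
    let ?W = "{prd g h \<gamma> \<eta> | \<gamma> \<eta>. \<gamma> \<in> U \<and> \<eta> \<in> V \<and> s g \<gamma> = r h \<eta>}"
    have "gr (mk_bis (cmp C g h) ?W) = gr (mk_bis h V) O gr (mk_bis g U)"
    proof (intro equalityI subrelI)
      fix y z assume "(y, z) \<in> gr (mk_bis (cmp C g h) ?W)"
      then obtain \<gamma> \<eta> where *: "\<gamma> \<in> U" "\<eta> \<in> V" "s g \<gamma> = r h \<eta>" "(prd g h \<gamma> \<eta>, y) \<in> fd (cmp C g h)"
        "z = fm (cmp C g h) (prd g h \<gamma> \<eta>) y"
        by (auto simp: slice_graph_iff)
      have p: "\<gamma> \<in> cpts F g" "\<eta> \<in> cpts F h" using * slice_sub U V by auto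
      have y: "(\<eta>, y) \<in> fd h" using *(4) prd_facts[OF gC eq p *(3)] p cmp_C[OF gC eq] by (simp add: fdom_iff)
      have "(\<gamma>, fm h \<eta> y) \<in> fd g"
        using fmul_part[OF gC(2) y] fmul_anch[OF gC(2) y] p *(3) eq by (simp add: fdom_iff)
      then have "(fm h \<eta> y, z) \<in> gr (mk_bis g U)"
        using fmul_assoc[OF gC eq p(1) y *(3)] *(1,5) by (auto simp: slice_graph_iff)
      moreover have "(y, fm h \<eta> y) \<in> gr (mk_bis h V)" using y *(2) by (auto simp: slice_graph_iff)
      ultimately show "(y, z) \<in> gr (mk_bis h V) O gr (mk_bis g U)" by blast
    next
      fix y z assume "(y, z) \<in> gr (mk_bis h V) O gr (mk_bis g U)"
      then obtain \<gamma> \<eta> where *: "\<gamma> \<in> U" "\<eta> \<in> V" "(\<eta>, y) \<in> fd h" "(\<gamma>, fm h \<eta> y) \<in> fd g" "z = fm g \<gamma> (fm h \<eta> y)"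
        by (auto simp: slice_graph_iff)
      have p: "\<gamma> \<in> cpts F g" "\<eta> \<in> cpts F h" using * slice_sub U V by auto
      have sr: "s g \<gamma> = r h \<eta>" using *(4) fmul_anch[OF gC(2) *(3)] by (simp add: fdom_iff)
      have "(prd g h \<gamma> \<eta>, y) \<in> fd (cmp C g h)"
        using *(3) prd_facts[OF gC eq p sr] cmp_C[OF gC eq] by (simp add: fdom_iff)
      then show "(y, z) \<in> gr (mk_bis (cmp C g h) ?W)"
        using fmul_assoc[OF gC eq p(1) *(3) sr] * sr by (auto simp: slice_graph_iff)
    qed
    moreover have "bis_mul C F u v = mk_bis (cmp C g h) ?W" using eq pq gU by simp
    moreover have "u = mk_bis g U" "v = mk_bis h V" using pq gU mk by simp_all
    ultimately show ?thesis by simp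
  next
    case neq: False
    have "gr (mk_bis h V) O gr (mk_bis g U) = {}"
    proof -
      have False if "(\<eta>, y) \<in> fd h" "(\<gamma>, fm h \<eta> y) \<in> fd g" for \<gamma> \<eta> y
        using neq part_unique[OF src_obj_C[OF gC(1)] rng_obj_C[OF gC(2)]] fmul_part[OF gC(2) that(1)] that(2)
        by (auto simp: fdom_iff)
      then show ?thesis by (auto simp: slice_graph_iff)
    qed
    moreover have "bis_mul C F u v = None" using neq pq gU by simp
    moreover have "u = mk_bis g U" "v = mk_bis h V" using pq gU mk by simp_all
    ultimately show ?thesis by simp
  qed
qed auto

text \<open>That the right-hand side is contained in the left-hand side is the cancellation axiom of an \<open>F\<close>-action.\<close>

lemma slice_graph_inner:
  assumes g: "g \<in> arr C" and U: "U \<in> slices C F g" and V: "V \<in> slices C F g"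
  shows "gr (mk_bis (src C g) (inner_slice (Gr (src C g)) (cor F g) U V)) =
    gr (mk_bis g V) O (gr (mk_bis g U))\<inverse>"
proof -
  interpret tight_corr "Gr (rng C g)" "Gr (src C g)" "cor F g" by (rule tight_corr_F[OF g])
  note W = inner_slice_eq[OF slice_sub[OF U] slice_sub[OF V]]
  note x = src_obj_C[OF g]
  show ?thesis
  proof (intro equalityI subrelI)
    fix y z assume "(y, z) \<in> gr (mk_bis (src C g) (inner_slice (Gr (src C g)) (cor F g) U V))"
    then obtain \<eta> \<gamma> where *: "\<eta> \<in> arr (Gr (src C g))" "\<gamma> \<in> U" "s g \<gamma> = rng (Gr (src C g)) \<eta>" "ra g \<gamma> \<eta> \<in> V"
      "(\<eta>, y) \<in> fd (src C g)" "z = fm (src C g) \<eta> y"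
      unfolding slice_graph_iff W by blast
    have p: "\<gamma> \<in> pts" using * slice_sub[OF U] by blast
    have "(ra g \<gamma> \<eta>, y) \<in> fd g"
      using * p ract_pts[of \<gamma> \<eta>] ract_facts[of \<gamma> \<eta>] fdom_unit_iff[OF x] by (simp add: fdom_iff)
    moreover have "fm g (ra g \<gamma> \<eta>) y = fm g \<gamma> z" "(\<gamma>, z) \<in> fd g"
      using fmul_ract[OF g p *(1,3,5)] *(6) by simp_all
    ultimately show "(y, z) \<in> gr (mk_bis g V) O (gr (mk_bis g U))\<inverse>"
      using *(2,4) unfolding relcomp_unfold converse_iff slice_graph_iff mem_Collect_eq case_prod_conv by metis
  next
    fix y z assume "(y, z) \<in> gr (mk_bis g V) O (gr (mk_bis g U))\<inverse>"
    then obtain \<gamma> \<gamma>' where *: "\<gamma> \<in> U" "\<gamma>' \<in> V" "(\<gamma>, z) \<in> fd g" "(\<gamma>', y) \<in> fd g" "fm g \<gamma> z = fm g \<gamma>' y"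
      unfolding relcomp_unfold converse_iff slice_graph_iff mem_Collect_eq case_prod_conv by metis
    obtain \<eta> where \<eta>: "\<eta> \<in> arr (Gr (src C g))" "s g \<gamma> = rng (Gr (src C g)) \<eta>" "\<gamma>' = ra g \<gamma> \<eta>"
      "src (Gr (src C g)) \<eta> = fanch A y" "z = fm (src C g) \<eta> y"
      using fmul_cancel[OF g *(3,4,5)] .
    have "(\<eta>, y) \<in> fd (src C g)" using \<eta> *(4) fdom_unit_iff[OF x] by (simp add: fdom_iff)
    then show "(y, z) \<in> gr (mk_bis (src C g) (inner_slice (Gr (src C g)) (cor F g) U V))"
      unfolding slice_graph_iff W using \<eta> * by blast
  qed
qed

lemma slice_graph_unit_slice:
  assumes x: "x \<in> obj C" and E: "E \<subseteq> obj (Gr x)"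
  shows "(y, z) \<in> gr (mk_bis x E) \<longleftrightarrow> y \<in> part A x \<and> fanch A y \<in> E \<and> z = y"
proof -
  interpret etale "Gr x" by (rule etale_Gr[OF x])
  have "(e, y) \<in> fd x \<longleftrightarrow> y \<in> part A x \<and> e = fanch A y" if "e \<in> E" for e
    using that E obj_facts[of e] fdom_unit_iff[OF x] by auto
  then show ?thesis unfolding slice_graph_iff using fmul_unit[OF x] by metis
qed

lemma slice_graph_rels:
  assumes "(t, u) \<in> I_rels C F"
  shows "set_isg_term t \<subseteq> Bis C F \<and> set_isg_term u \<subseteq> Bis C F \<and> term_graph gr t = term_graph gr u"
proof (intro conjI)
  show "term_graph gr t = term_graph gr u"
    using assms unfolding I_rels_def by (auto simp: slice_graph_mul slice_graph_inner simp del: slice_graph.simps)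
qed (use I_rels_over[OF assms] in auto)

abbreviation \<theta> where "\<theta> \<equiv> induced_action C F A"

sublocale ind: isg_action "I_sg C F" Z \<theta>
proof -
  have "isg_action (I_sg C F) Z (\<lambda>a. \<Union>t\<in>a. term_graph gr t)"
    unfolding I_sg_def
  proof (rule isg_action_presented[OF partial_homeo_Bis slice_graph_rels])
    fix y assume "y \<in> topspace Z"
    then obtain x where x: "x \<in> obj C" "y \<in> part A x" using part_cover by blast
    interpret G: etale "Gr x" by (rule etale_Gr[OF x(1)])
    have "mk_bis x (obj (Gr x)) \<in> Bis C F"
      using x by (intro mk_bis_Bis unit_slice G.openin_obj obj_C) auto
    moreover have "(y, y) \<in> gr (mk_bis x (obj (Gr x)))"
      using slice_graph_unit_slice[OF x(1) order_refl] x fanch_obj by simp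
    ultimately show "\<exists>b\<in>Bis C F. y \<in> Domain (gr b)" by blast
  qed
  then show "isg_action (I_sg C F) Z \<theta>" unfolding induced_action_def .
qed

lemma induced_class:
  "set_isg_term t \<subseteq> Bis C F \<Longrightarrow> \<theta> (isg_class (I_rels C F) t) = term_graph gr t"
  unfolding induced_action_def by (rule class_graph[OF partial_homeo_Bis slice_graph_rels])

end

section \<open>The universal action\<close>

context tight_diag
begin

abbreviation Om where "Om \<equiv> Omega C F"
abbreviation OmA where "OmA \<equiv> Omega_action C F"

lemma topspace_Omega: "topspace Om = Sigma (obj C) (\<lambda>x. obj (Gr x))"
  unfolding Omega_def using etale.topspace_unit_space[OF etale_Gr] by (auto simp: o_def)

lemma openin_Omega:
  "openin Om U \<longleftrightarrow> U \<subseteq> Sigma (obj C) (\<lambda>x. obj (Gr x)) \<and> (\<forall>x\<in>obj C. openin (gtop (Gr x)) {e. (x, e) \<in> U})"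
proof -
  have *: "Sigma (obj C) (topspace \<circ> (\<lambda>x. unit_space (Gr x))) = Sigma (obj C) (\<lambda>x. obj (Gr x))"
    using topspace_Omega by (simp add: Omega_def)
  show ?thesis
    unfolding Omega_def openin_sum_topology *
    by (rule conj_cong[OF HOL.refl], rule ball_cong[OF HOL.refl]) (auto simp: etale.openin_unit_space[OF etale_Gr])
qed

lemma part_Omega: "x \<in> obj C \<Longrightarrow> part OmA x = {x} \<times> obj (Gr x)"
  by (simp add: Omega_action_def etale.topspace_unit_space[OF etale_Gr])

lemma fanch_Omega: "fanch OmA = snd" by (simp add: Omega_action_def)

lemma fmul_Omega: "fmul OmA g \<gamma> \<omega> = (rng C g, r g \<gamma>)" by (simp add: Omega_action_def)

lemma fdom_Omega: "g \<in> arr C \<Longrightarrow> (\<gamma>, \<omega>) \<in> fdom C F OmA g \<longleftrightarrow> \<gamma> \<in> cpts F g \<and> \<omega> = (src C g, s g \<gamma>)"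
  using s_obj[of g \<gamma>] by (auto simp: fdom_def part_Omega src_obj_C fanch_Omega)

lemma openin_part_Omega: "x \<in> obj C \<Longrightarrow> openin (gtop (Gr x)) V \<Longrightarrow> V \<subseteq> obj (Gr x) \<Longrightarrow> openin Om ({x} \<times> V)"
proof -
  assume x: "x \<in> obj C" "openin (gtop (Gr x)) V" "V \<subseteq> obj (Gr x)"
  have "{e. (x', e) \<in> {x} \<times> V} = (if x' = x then V else {})" for x' by auto
  then show "openin Om ({x} \<times> V)" using x by (auto simp: openin_Omega)
qed

text \<open>Since \<open>\<gamma> \<cdot> \<omega>\<close> is defined only for \<open>\<omega> = s \<gamma>\<close>, the domain of the product map is a copy of \<open>X\<^sub>g\<close>, on which the product
  map is the left anchor map. So the axioms become the properties of the left anchor map that tightness provides.\<close>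

theorem F_action_Omega: "F_action C F Om OmA"
  unfolding F_action_def
proof (intro conjI ballI impI)
  show "(\<Union>x\<in>obj C. part OmA x) = topspace Om" by (auto simp: part_Omega topspace_Omega)
  show "disjoint_family_on (part OmA) (obj C)" by (auto simp: disjoint_family_on_def part_Omega)
next
  fix x assume x: "x \<in> obj C"
  interpret G: etale "Gr x" by (rule etale_Gr[OF x])
  show o: "openin Om (part OmA x)"
    unfolding part_Omega[OF x] by (rule openin_part_Omega[OF x G.openin_obj order_refl])
  have "topspace Om - part OmA x = (\<Union>x'\<in>obj C - {x}. {x'} \<times> obj (Gr x'))"
    by (auto simp: part_Omega[OF x] topspace_Omega)
  also have "openin Om \<dots>"
    by (intro openin_Union) (auto intro!: openin_part_Omega etale.openin_obj etale_Gr)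
  finally show "closedin Om (part OmA x)"
    using openin_subset[OF o] by (simp add: closedin_def)
  show "continuous_map (subtopology Om (part OmA x)) (unit_space (Gr x)) (fanch OmA)"
    unfolding continuous_map_def
  proof (intro conjI allI impI)
    show "fanch OmA \<in> topspace (subtopology Om (part OmA x)) \<rightarrow> topspace (unit_space (Gr x))"
      by (auto simp: fanch_Omega part_Omega[OF x] G.topspace_unit_space)
    fix V assume V: "openin (unit_space (Gr x)) V"
    then have "{y \<in> topspace (subtopology Om (part OmA x)). fanch OmA y \<in> V} = {x} \<times> V"
      using x by (auto simp: fanch_Omega part_Omega[OF x] topspace_Omega G.openin_unit_space)
    moreover have "openin Om ({x} \<times> V)" "{x} \<times> V \<subseteq> part OmA x"
      using V x by (auto simp: G.openin_unit_space part_Omega intro: openin_part_Omega)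
    ultimately show "openin (subtopology Om (part OmA x)) {y \<in> topspace (subtopology Om (part OmA x)). fanch OmA y \<in> V}"
      using openin_open_subtopology[OF o] by simp
  qed
next
  fix g assume g: "g \<in> arr C"
  interpret tight_corr "Gr (rng C g)" "Gr (src C g)" "cor F g" by (rule tight_corr_F[OF g])
  let ?D = "subtopology (prod_topology (ctp g) Om) (fdom C F OmA g)"
  let ?E = "subtopology Om (part OmA (rng C g))"
  let ?m = "\<lambda>(\<gamma>, y). fmul OmA g \<gamma> y"
  have tD: "topspace ?D = {(\<gamma>, (src C g, s g \<gamma>)) | \<gamma>. \<gamma> \<in> cpts F g}"
    using g s_obj[OF g] by (auto simp: fdom_Omega topspace_Omega src_obj_C)
  have tE: "topspace ?E = {rng C g} \<times> obj (Gr (rng C g))"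
    using g by (auto simp: part_Omega topspace_Omega rng_obj_C)
  have oE: "openin ?E ({rng C g} \<times> V)" if "openin (gtop (Gr (rng C g))) V" "V \<subseteq> obj (Gr (rng C g))" for V
    using that g openin_part_Omega[OF rng_obj_C[OF g] that]
      openin_part_Omega[OF rng_obj_C[OF g] left.openin_obj order_refl]
    by (simp add: openin_open_subtopology part_Omega rng_obj_C)
      (auto)
  have cont: "continuous_map ?D ?E ?m"
    unfolding continuous_map_def
  proof (intro conjI allI impI)
    show "?m \<in> topspace ?D \<rightarrow> topspace ?E" unfolding tD tE using r_obj[OF g] by (auto simp: fmul_Omega)
    fix V assume "openin ?E V"
    then obtain V' where V': "openin Om V'" "V = V' \<inter> part OmA (rng C g)" by (auto simp: openin_subtopology)
    let ?N = "{\<gamma> \<in> cpts F g. r g \<gamma> \<in> {e. (rng C g, e) \<in> V'}}"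
    have "openin (ctp g) ?N"
      using V' rng_obj_C[OF g] openin_Omega by (intro openin_continuous_map_preimage[OF continuous_ranch']) auto
    then have "openin ?D ((?N \<times> topspace Om) \<inter> fdom C F OmA g)"
      by (intro openin_subtopology_Int) (simp add: openin_prod_Times_iff)
    moreover have "(?N \<times> topspace Om) \<inter> fdom C F OmA g = {p \<in> topspace ?D. ?m p \<in> V}"
      unfolding tD V' using r_obj[OF g] s_obj[OF g] g
      by (auto simp: fmul_Omega part_Omega rng_obj_C fdom_Omega topspace_Omega src_obj_C)
    ultimately show "openin ?D {p \<in> topspace ?D. ?m p \<in> V}" by simp
  qed
  have "open_map ?D ?E ?m"
    unfolding open_map_def
  proof (intro allI impI)
    fix W assume W: "openin ?D W"
    have "openin (ctp g) (fst ` W)"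
    proof (rule openin_fst_image_of_fibred[OF W])
      fix V assume V: "openin Om V"
      have "{\<gamma> \<in> cpts F g. \<exists>y\<in>V. (\<gamma>, y) \<in> fdom C F OmA g} = {\<gamma> \<in> cpts F g. s g \<gamma> \<in> {e. (src C g, e) \<in> V}}"
        using g by (auto simp: fdom_Omega)
      moreover have "openin (ctp g) {\<gamma> \<in> cpts F g. s g \<gamma> \<in> {e. (src C g, e) \<in> V}}"
        using V src_obj_C[OF g] openin_Omega by (intro openin_continuous_map_preimage[OF continuous_sanch']) auto
      ultimately show "openin (ctp g) {\<gamma> \<in> cpts F g. \<exists>y\<in>V. (\<gamma>, y) \<in> fdom C F OmA g}" by simp
    qed
    moreover have "?m ` W = {rng C g} \<times> r g ` (fst ` W)" by (force simp: fmul_Omega)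
    moreover have "r g ` (fst ` W) \<subseteq> obj (Gr (rng C g))"
      using openin_subset[OF W] r_obj[OF g] unfolding tD by auto
    ultimately show "openin ?E (?m ` W)" using oE openin_ranch_image by simp
  qed
  moreover have "?m ` topspace ?D = topspace ?E"
    unfolding tD tE using ranch_surj by (force simp: fmul_Omega)
  ultimately show "let D = ?D; E = ?E; m = ?m
      in continuous_map D E m \<and> open_map D E m \<and> m ` topspace D = topspace E"
    using cont by simp
  show "case p of (\<gamma>, y) \<Rightarrow> fanch OmA (fmul OmA g \<gamma> y) = r g \<gamma>" for p
    by (simp add: fanch_Omega fmul_Omega split: prod.split)
  fix p assume "p \<in> fdom C F OmA g"
  then obtain \<gamma> where p: "p = (\<gamma>, (src C g, s g \<gamma>))" "\<gamma> \<in> cpts F g"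
    using g by (cases p) (simp add: fdom_Omega)
  show "case p of (\<gamma>, y) \<Rightarrow> \<forall>(\<gamma>', y')\<in>fdom C F OmA g. fmul OmA g \<gamma> y = fmul OmA g \<gamma>' y' \<longrightarrow>
        (\<exists>\<eta>\<in>arr (Gr (src C g)). s g \<gamma> = rng (Gr (src C g)) \<eta> \<and> \<gamma>' = ra g \<gamma> \<eta> \<and>
           src (Gr (src C g)) \<eta> = fanch OmA y' \<and> y = fmul OmA (src C g) \<eta> y')"
    unfolding p(1) prod.case
  proof (intro ballI)
    fix q assume "q \<in> fdom C F OmA g"
    then obtain \<gamma>' where q: "q = (\<gamma>', (src C g, s g \<gamma>'))" "\<gamma>' \<in> cpts F g"
      using g by (cases q) (simp add: fdom_Omega)
    have "\<exists>\<eta>\<in>arr (Gr (src C g)). s g \<gamma> = rng (Gr (src C g)) \<eta> \<and> \<gamma>' = ra g \<gamma> \<eta> \<and>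
        src (Gr (src C g)) \<eta> = s g \<gamma>' \<and> (src C g, s g \<gamma>) = (rng C (src C g), r (src C g) \<eta>)"
      if "r g \<gamma> = r g \<gamma>'"
      using ranch_eqD[OF p(2) q(2) that] unit_cor(3)[OF src_obj_C[OF g]] arr_C(4)[OF g] by metis
    then show "case q of (\<gamma>', y') \<Rightarrow> fmul OmA g \<gamma> (src C g, s g \<gamma>) = fmul OmA g \<gamma>' y' \<longrightarrow>
        (\<exists>\<eta>\<in>arr (Gr (src C g)). s g \<gamma> = rng (Gr (src C g)) \<eta> \<and> \<gamma>' = ra g \<gamma> \<eta> \<and>
           src (Gr (src C g)) \<eta> = fanch OmA y' \<and> (src C g, s g \<gamma>) = fmul OmA (src C g) \<eta> y')"
      unfolding q(1) by (simp add: fmul_Omega fanch_Omega)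
  qed
next
  fix g h \<gamma> p assume gh: "g \<in> arr C" "h \<in> arr C" "src C g = rng C h" and \<gamma>: "\<gamma> \<in> cpts F g" and p: "p \<in> fdom C F OmA h"
  obtain \<eta> y where \<eta>: "p = (\<eta>, y)" "\<eta> \<in> cpts F h" using p gh by (cases p) (simp add: fdom_Omega)
  show "case p of (\<eta>, y) \<Rightarrow> s g \<gamma> = r h \<eta> \<longrightarrow>
      fmul OmA g \<gamma> (fmul OmA h \<eta> y) = fmul OmA (cmp C g h) (prd g h \<gamma> \<eta>) y"
    using prd_facts[OF gh \<gamma> \<eta>(2)] cmp_C[OF gh] \<eta>(1) by (simp add: fmul_Omega)
qed

sublocale Om: diag_action C F Om OmA
  by unfold_locales (rule F_action_Omega)

end

context diag_action
begin

definition piece :: "'y \<Rightarrow> 'c" where "piece y = (THE x. x \<in> obj C \<and> y \<in> part A x)"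

definition to_Omega :: "'y \<Rightarrow> 'c \<times> 'a" where "to_Omega y = (piece y, fanch A y)"

lemma to_Omega_eq: "x \<in> obj C \<Longrightarrow> y \<in> part A x \<Longrightarrow> to_Omega y = (x, fanch A y)"
  unfolding to_Omega_def piece_def using part_unique by (auto intro!: the_equality)

lemma to_Omega_space: "y \<in> topspace Z \<Longrightarrow> to_Omega y \<in> topspace Om"
  using part_cover to_Omega_eq fanch_obj by (auto simp: topspace_Omega)

lemma to_Omega_iff:
  assumes "y \<in> topspace Z"
  shows "to_Omega y = (x, e) \<longleftrightarrow> x \<in> obj C \<and> y \<in> part A x \<and> fanch A y = e"
  using assms part_cover to_Omega_eq by (metis Pair_inject)

lemma to_Omega_fmul: "g \<in> arr C \<Longrightarrow> (\<gamma>, y) \<in> fd g \<Longrightarrow> to_Omega (fm g \<gamma> y) = (rng C g, r g \<gamma>)"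
  using to_Omega_eq[OF rng_obj_C fmul_part] fmul_anch by simp

lemma fdom_iff_to_Omega:
  assumes "g \<in> arr C"
  shows "(\<gamma>, y) \<in> fd g \<longleftrightarrow> \<gamma> \<in> cpts F g \<and> y \<in> topspace Z \<and> to_Omega y = (src C g, s g \<gamma>)"
  using to_Omega_iff[of y "src C g" "s g \<gamma>"] src_obj_C[OF assms] part_sub[OF src_obj_C[OF assms]]
  by (auto simp: fdom_iff)

lemma continuous_to_Omega: "continuous_map Z Om to_Omega"
  unfolding continuous_map_def
proof (intro conjI allI impI)
  show "to_Omega \<in> topspace Z \<rightarrow> topspace Om" using to_Omega_space by blast
  fix V assume V: "openin Om V"
  have "{y \<in> topspace Z. to_Omega y \<in> V} = (\<Union>x\<in>obj C. {y \<in> part A x. fanch A y \<in> {e. (x, e) \<in> V}})" (is "?L = ?R")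
  proof
    show "?L \<subseteq> ?R" using part_cover to_Omega_eq by fastforce
    show "?R \<subseteq> ?L" using part_cover to_Omega_eq by auto
  qed
  also have "openin Z \<dots>"
  proof (intro openin_Union ballI, elim imageE, hypsubst)
    fix x assume x: "x \<in> obj C"
    show "openin Z {y \<in> part A x. fanch A y \<in> {e. (x, e) \<in> V}}"
      using V x by (intro openin_fanch_vimage[OF x]) (simp add: openin_Omega)
  qed
  finally show "openin Z {y \<in> topspace Z. to_Omega y \<in> V}" .
qed

text \<open>An equivariant map preserves the piece and the anchor of a point, and these are the coordinates of its
  image. The products impose no further condition, as a product in \<open>Omega\<close> is determined by its first factor.\<close>

lemma F_equivariant_to_Omega_iff:
  "F_equivariant C F A OmA \<phi> \<longleftrightarrow> (\<forall>y\<in>topspace Z. \<phi> y = to_Omega y)"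
proof
  assume \<phi>: "F_equivariant C F A OmA \<phi>"
  show "\<forall>y\<in>topspace Z. \<phi> y = to_Omega y"
  proof
    fix y assume "y \<in> topspace Z"
    then obtain x where x: "x \<in> obj C" "y \<in> part A x" using part_cover by blast
    then have "\<phi> y \<in> {x} \<times> obj (Gr x)" "snd (\<phi> y) = fanch A y"
      using \<phi> part_Omega[OF x(1)] fanch_Omega unfolding F_equivariant_def by (blast, metis)
    then show "\<phi> y = to_Omega y" using to_Omega_eq[OF x] by auto
  qed
next
  assume *: "\<forall>y\<in>topspace Z. \<phi> y = to_Omega y"
  show "F_equivariant C F A OmA \<phi>"
    unfolding F_equivariant_def
  proof (intro conjI ballI)
    fix x assume x: "x \<in> obj C"
    have **: "\<phi> y = (x, fanch A y)" if "y \<in> part A x" for y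
      using * to_Omega_eq[OF x that] part_sub[OF x] that by auto
    then show "\<phi> ` part A x \<subseteq> part OmA x" using part_Omega[OF x] fanch_obj[OF x] by auto
    show "fanch OmA (\<phi> y) = fanch A y" if "y \<in> part A x" for y
      using **[OF that] by (simp add: fanch_Omega)
  next
    fix g p assume g: "g \<in> arr C" and "p \<in> fd g"
    then have "\<phi> (fm g \<gamma> y) = (rng C g, r g \<gamma>)" if "p = (\<gamma>, y)" for \<gamma> y
      using * to_Omega_fmul[OF g, of \<gamma> y] fmul_part[OF g, of \<gamma> y] part_sub[OF rng_obj_C[OF g]] that by auto
    then show "case p of (\<gamma>, y) \<Rightarrow> \<phi> (fm g \<gamma> y) = fmul OmA g \<gamma> (\<phi> y)"
      by (auto simp: fmul_Omega)
  qed
qed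

text \<open>The heart of the proof: the equivariant map to \<open>Omega\<close> reflects domains and ranges. For the range of
  a slice \<open>U\<close>, a point over \<open>r \<gamma>\<close> with \<open>\<gamma> \<in> U\<close> is some product \<open>\<gamma>' \<cdot> y\<close> with \<open>r \<gamma>' = r \<gamma>\<close>; tightness
  gives \<open>\<gamma>' = \<gamma> \<eta>\<close>, so that the point is \<open>\<gamma> \<cdot> (\<eta> \<cdot> y)\<close>.\<close>

lemma slice_graph_to_Omega:
  assumes "b \<in> Bis C F"
  shows "(z, z') \<in> gr b \<Longrightarrow> (to_Omega z, to_Omega z') \<in> Om.gr b"
    and "z \<in> topspace Z \<Longrightarrow> (to_Omega z, w) \<in> Om.gr b \<Longrightarrow> \<exists>z'. (z, z') \<in> gr b \<and> to_Omega z' = w"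
    and "z' \<in> topspace Z \<Longrightarrow> (w, to_Omega z') \<in> Om.gr b \<Longrightarrow> \<exists>z. (z, z') \<in> gr b \<and> to_Omega z = w"
proof -
  obtain g U where b: "b = mk_bis g U" and g: "g \<in> arr C" and U: "U \<in> slices C F g"
    using assms by (auto simp: Bis_def)
  interpret tight_corr "Gr (rng C g)" "Gr (src C g)" "cor F g" by (rule tight_corr_F[OF g])
  note iff = slice_graph_iff fdom_iff_to_Omega[OF g]
  have Om_iff: "(v, w) \<in> Om.gr b \<longleftrightarrow> (\<exists>\<gamma>\<in>U. \<gamma> \<in> cpts F g \<and> v = (src C g, s g \<gamma>) \<and> w = (rng C g, r g \<gamma>))" for v w
    unfolding b Om.slice_graph_iff fdom_Omega[OF g] fmul_Omega by blast
  show "(to_Omega z, to_Omega z') \<in> Om.gr b" if "(z, z') \<in> gr b"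
    using that[unfolded b] to_Omega_fmul[OF g] unfolding Om_iff by (auto simp: iff)
  show "\<exists>z'. (z, z') \<in> gr b \<and> to_Omega z' = w" if z: "z \<in> topspace Z" "(to_Omega z, w) \<in> Om.gr b"
  proof -
    obtain \<gamma> where \<gamma>: "\<gamma> \<in> U" "\<gamma> \<in> cpts F g" "to_Omega z = (src C g, s g \<gamma>)" "w = (rng C g, r g \<gamma>)"
      using z(2) unfolding Om_iff by blast
    then have "(\<gamma>, z) \<in> fd g" using z by (simp add: fdom_iff_to_Omega[OF g])
    then show ?thesis
      using \<gamma> to_Omega_fmul[OF g] unfolding b slice_graph_iff by (intro exI[of _ "fm g \<gamma> z"]) blast
  qed
  show "\<exists>z. (z, z') \<in> gr b \<and> to_Omega z = w" if z: "z' \<in> topspace Z" "(w, to_Omega z') \<in> Om.gr b"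
  proof -
    obtain \<gamma> where \<gamma>: "\<gamma> \<in> U" "\<gamma> \<in> cpts F g" "w = (src C g, s g \<gamma>)" "to_Omega z' = (rng C g, r g \<gamma>)"
      using z(2) unfolding Om_iff by blast
    then have z': "z' \<in> part A (rng C g)" "fanch A z' = r g \<gamma>" using to_Omega_iff[OF z(1)] by auto
    obtain \<gamma>' y where y: "(\<gamma>', y) \<in> fd g" "z' = fm g \<gamma>' y" using fmul_surj[OF g z'(1)] .
    have "r g \<gamma> = r g \<gamma>'" "\<gamma>' \<in> pts" using fmul_anch[OF g y(1)] y z'(2) by (auto simp: fdom_iff)
    then obtain \<eta> where \<eta>: "\<eta> \<in> arr (Gr (src C g))" "s g \<gamma> = rng (Gr (src C g)) \<eta>" "\<gamma>' = ra g \<gamma> \<eta>"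
      "src (Gr (src C g)) \<eta> = s g \<gamma>'"
      using ranch_eqD[OF \<gamma>(2)] by metis
    have "(\<eta>, y) \<in> fd (src C g)"
      using \<eta> y(1) fdom_unit_iff[OF src_obj_C[OF g]] by (simp add: fdom_iff)
    then have "z' = fm g \<gamma> (fm (src C g) \<eta> y)" "(\<gamma>, fm (src C g) \<eta> y) \<in> fd g"
      using fmul_ract[OF g \<gamma>(2) \<eta>(1,2)] y(2) \<eta>(3) by simp_all
    then show ?thesis using \<gamma> unfolding b
      by (intro exI[of _ "fm (src C g) \<eta> y"]) (auto simp: iff)
  qed
qed

lemma term_graph_to_Omega:
  assumes "set_isg_term t \<subseteq> Bis C F"
  shows "(z, z') \<in> term_graph gr t \<Longrightarrow> (to_Omega z, to_Omega z') \<in> term_graph Om.gr t"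
    and "z \<in> topspace Z \<Longrightarrow> (to_Omega z, w) \<in> term_graph Om.gr t \<Longrightarrow> \<exists>z'. (z, z') \<in> term_graph gr t \<and> to_Omega z' = w"
    and "z \<in> topspace Z \<Longrightarrow> (w, to_Omega z) \<in> term_graph Om.gr t \<Longrightarrow> \<exists>z'. (z', z) \<in> term_graph gr t \<and> to_Omega z' = w"
  using assms
proof (induction t arbitrary: z z' w)
  case (Gen b)
  {
    case 1
    then show ?case using slice_graph_to_Omega(1)[of b] by simp
  next
    case 2
    then show ?case using slice_graph_to_Omega(2)[of b] by simp
  next
    case 3
    then show ?case using slice_graph_to_Omega(3)[of b] by simp
  }
next
  case (Mul t u)
  have sub: "set_isg_term t \<subseteq> Bis C F" "set_isg_term u \<subseteq> Bis C F"
    if "set_isg_term (Mul t u) \<subseteq> Bis C F" using that by auto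
  have space: "z \<in> topspace Z \<and> z' \<in> topspace Z" if "(z, z') \<in> term_graph gr v" "set_isg_term v \<subseteq> Bis C F" for z z' v
  proof -
    have "partial_homeo Z (term_graph gr v)"
      using partial_homeo_Bis that(2) by (rule partial_homeo_term_graph)
    then have "term_graph gr v \<subseteq> topspace Z \<times> topspace Z" unfolding partial_homeo_def by (elim conjE)
    then show ?thesis using that(1) by blast
  qed
  {
    case 1
    note S = sub[OF 1(2)]
    obtain z1 where z1: "(z, z1) \<in> term_graph gr u" "(z1, z') \<in> term_graph gr t" using 1(1) by auto
    then show ?case using Mul.IH(1)[OF z1(2) S(1)] Mul.IH(4)[OF z1(1) S(2)] by auto
  next
    case 2
    note S = sub[OF 2(3)]
    obtain v where v: "(to_Omega z, v) \<in> term_graph Om.gr u" "(v, w) \<in> term_graph Om.gr t" using 2(2) by auto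
    obtain z1 where z1: "(z, z1) \<in> term_graph gr u" "to_Omega z1 = v" using Mul.IH(5)[OF 2(1) v(1) S(2)] by blast
    have "z1 \<in> topspace Z" using space[OF z1(1) S(2)] by simp
    then obtain z2 where "(z1, z2) \<in> term_graph gr t" "to_Omega z2 = w"
      using Mul.IH(2)[of z1 w] v(2) z1(2) S(1) by blast
    then show ?case using z1 by auto
  next
    case 3
    note S = sub[OF 3(3)]
    obtain v where v: "(w, v) \<in> term_graph Om.gr u" "(v, to_Omega z) \<in> term_graph Om.gr t" using 3(2) by auto
    obtain z1 where z1: "(z1, z) \<in> term_graph gr t" "to_Omega z1 = v" using Mul.IH(3)[OF 3(1) v(2) S(1)] by blast
    have "z1 \<in> topspace Z" using space[OF z1(1) S(1)] by simp
    then obtain z2 where "(z2, z1) \<in> term_graph gr u" "to_Omega z2 = w"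
      using Mul.IH(6)[of z1 w] v(1) z1(2) S(2) by blast
    then show ?case using z1 by auto
  }
next
  case (Star t)
  {
    case 1
    then show ?case using Star.IH(1) by auto
  next
    case 2
    then show ?case using Star.IH(3)[of z w] by auto
  next
    case 3
    then show ?case using Star.IH(2)[of z w] by auto
  }
qed

lemma theta_to_Omega:
  assumes "a \<in> elems (I_sg C F)"
  shows "(z, z') \<in> \<theta> a \<Longrightarrow> (to_Omega z, to_Omega z') \<in> Om.\<theta> a"
    and "z \<in> topspace Z \<Longrightarrow> (to_Omega z, w) \<in> Om.\<theta> a \<Longrightarrow> \<exists>z'. (z, z') \<in> \<theta> a"
proof -
  obtain t where t: "a = isg_class (I_rels C F) t" "set_isg_term t \<subseteq> Bis C F"
    using assms unfolding I_sg_def by (rule isg_class_elemsE)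
  show "(z, z') \<in> \<theta> a \<Longrightarrow> (to_Omega z, to_Omega z') \<in> Om.\<theta> a"
    using term_graph_to_Omega(1)[OF t(2)] by (simp add: t induced_class Om.induced_class)
  show "z \<in> topspace Z \<Longrightarrow> (to_Omega z, w) \<in> Om.\<theta> a \<Longrightarrow> \<exists>z'. (z, z') \<in> \<theta> a"
    using term_graph_to_Omega(2)[OF t(2), of z w] unfolding t(1) induced_class[OF t(2)] Om.induced_class[OF t(2)]
    by blast
qed

end

context tight_diag
begin

theorem universal_Omega: "universal_F_action C F Om OmA TYPE('y)"
  unfolding universal_F_action_def
proof (intro conjI allI impI F_action_Omega)
  fix Y :: "'y topology" and A assume "F_action C F Y A"
  then interpret diag_action C F Y A by unfold_locales
  show "\<exists>!\<phi>. \<phi> \<in> extensional (topspace Y) \<and> continuous_map Y Om \<phi> \<and> F_equivariant C F A OmA \<phi>"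
  proof (rule ex1I)
    have "continuous_map Y Om (restrict to_Omega (topspace Y))"
      by (rule continuous_map_eq[OF continuous_to_Omega]) simp
    then show "restrict to_Omega (topspace Y) \<in> extensional (topspace Y) \<and>
        continuous_map Y Om (restrict to_Omega (topspace Y)) \<and> F_equivariant C F A OmA (restrict to_Omega (topspace Y))"
      by (simp add: F_equivariant_to_Omega_iff)
    fix \<phi> assume "\<phi> \<in> extensional (topspace Y) \<and> continuous_map Y Om \<phi> \<and> F_equivariant C F A OmA \<phi>"
    then show "\<phi> = restrict to_Omega (topspace Y)"
      by (intro extensionalityI[of _ "topspace Y"]) (auto simp: F_equivariant_to_Omega_iff)
  qed
qed

end

section \<open>Arrows of the model\<close>

context tight_diag
begin

abbreviation IS where "IS \<equiv> I_sg C F"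
abbreviation U_F where "U_F \<equiv> transformation_groupoid IS Om Om.\<theta>"
abbreviation ug where "ug \<equiv> Om.ind.unit_germ"
abbreviation gmO where "gmO \<equiv> germ IS Om.\<theta>"

definition Theta :: "'c \<Rightarrow> 'a set \<Rightarrow> ('c, 'a) bis isg_term set" where
  "Theta g U = isg_class (I_rels C F) (Gen (mk_bis g U))"

lemma Theta_elems: "g \<in> arr C \<Longrightarrow> U \<in> slices C F g \<Longrightarrow> Theta g U \<in> elems IS"
  unfolding Theta_def I_sg_def by (rule isg_class_elems) (simp add: mk_bis_Bis)

lemma Theta_mult:
  assumes "u \<in> Bis C F" "v \<in> Bis C F"
  shows "smul IS (isg_class (I_rels C F) (Gen u)) (isg_class (I_rels C F) (Gen v)) =
    isg_class (I_rels C F) (Gen (bis_mul C F u v))"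
  unfolding I_sg_def smul_isg_class isg_class_eq_iff
  by (rule isg_cong.sym, rule isg_cong.rel) (use assms in \<open>auto simp: I_rels_def\<close>)

lemma Theta_mul:
  assumes "g \<in> arr C" "h \<in> arr C" "src C g = rng C h" "U \<in> slices C F g" "V \<in> slices C F h"
  shows "smul IS (Theta g U) (Theta h V) =
    Theta (cmp C g h) {prd g h \<gamma> \<eta> | \<gamma> \<eta>. \<gamma> \<in> U \<and> \<eta> \<in> V \<and> s g \<gamma> = r h \<eta>}"
proof -
  have "bis_mul C F (mk_bis g U) (mk_bis h V) =
      mk_bis (cmp C g h) {prd g h \<gamma> \<eta> | \<gamma> \<eta>. \<gamma> \<in> U \<and> \<eta> \<in> V \<and> s g \<gamma> = r h \<eta>}"
    using assms(3) by (auto simp: mk_bis_def)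
  then show ?thesis unfolding Theta_def using assms by (simp add: Theta_mult mk_bis_Bis)
qed

text \<open>Multiplying by a slice of units restricts a slice. This makes the germ of a slice at a point
  independent of the slice.\<close>

lemma Theta_restrict:
  assumes g: "g \<in> arr C" and U: "U \<in> slices C F g"
    and E: "openin (gtop (Gr (src C g))) E" "E \<subseteq> obj (Gr (src C g))"
  shows "smul IS (Theta g U) (Theta (src C g) E) = Theta g {\<gamma> \<in> U. s g \<gamma> \<in> E}"
proof -
  note x = src_obj_C[OF g]
  interpret tight_corr "Gr (rng C g)" "Gr (src C g)" "cor F g" by (rule tight_corr_F[OF g])
  have "{prd g (src C g) \<gamma> \<eta> | \<gamma> \<eta>. \<gamma> \<in> U \<and> \<eta> \<in> E \<and> s g \<gamma> = r (src C g) \<eta>} = {\<gamma> \<in> U. s g \<gamma> \<in> E}"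
    (is "?L = ?R")
  proof -
    have *: "r (src C g) \<eta> = \<eta>" if "\<eta> \<in> E" for \<eta>
      using that E(2) unit_cor(3)[OF x, of \<eta>] right.obj_facts[of \<eta>] by auto
    have **: "prd g (src C g) \<gamma> (s g \<gamma>) = \<gamma>" if "\<gamma> \<in> U" for \<gamma>
    proof -
      have p: "\<gamma> \<in> pts" using that slice_sub[OF U] by blast
      note so = right.obj_facts[OF sanch_obj[OF p]]
      show ?thesis using prd_unit_right[OF g p so(1) so(3)[symmetric]] ract_unit[OF p] by simp
    qed
    show ?thesis
    proof
      show "?L \<subseteq> ?R" using * ** by force
      show "?R \<subseteq> ?L"
      proof
        fix \<gamma> assume "\<gamma> \<in> ?R"
        then show "\<gamma> \<in> ?L" using * ** by (intro CollectI exI[of _ \<gamma>] exI[of _ "s g \<gamma>"]) simp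
      qed
    qed
  qed
  then show ?thesis
    using Theta_mul[OF g obj_C(1)[OF x] obj_C(3)[OF x, symmetric] U unit_slice[OF x E]] g
    by (simp add: arr_C)
qed

lemma Theta_unit_idem:
  assumes x: "x \<in> obj C" and E: "openin (gtop (Gr x)) E" "E \<subseteq> obj (Gr x)"
  shows "Theta x E \<in> idems IS"
proof -
  interpret etale "Gr x" by (rule etale_Gr[OF x])
  have "{e \<in> E. s x e \<in> E} = E" using E(2) unit_cor(4)[OF x] obj_facts by auto
  then show ?thesis
    using Theta_restrict[of x E E] Theta_elems[OF obj_C(1)[OF x] unit_slice[OF x E]] unit_slice[OF x E] E obj_C[OF x]
    by (simp add: idems_def)
qed

lemma theta_Theta:
  assumes "g \<in> arr C" "U \<in> slices C F g"
  shows "(v, w) \<in> Om.\<theta> (Theta g U) \<longleftrightarrow> (\<exists>\<gamma>\<in>U. v = (src C g, s g \<gamma>) \<and> w = (rng C g, r g \<gamma>))"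
proof -
  have "Om.\<theta> (Theta g U) = Om.gr (mk_bis g U)"
    unfolding Theta_def using assms by (subst Om.induced_class) (simp_all add: mk_bis_Bis)
  then show ?thesis
    unfolding \<open>Om.\<theta> (Theta g U) = Om.gr (mk_bis g U)\<close> Om.slice_graph_iff fdom_Omega[OF assms(1)] fmul_Omega
    using slice_sub[OF assms(2)] by blast
qed

text \<open>The arrow of the transformation groupoid that a point of a correspondence represents: the germ of a slice
  through the point. By \<open>arrow_eq\<close> any such slice may be used.\<close>

definition arrow :: "'c \<Rightarrow> 'a \<Rightarrow> (('c, 'a) bis isg_term set \<times> ('c \<times> 'a)) set" where
  "arrow g \<gamma> = gmO (Theta g (SOME U. U \<in> slices C F g \<and> \<gamma> \<in> U)) (src C g, s g \<gamma>)"

lemma germ_Theta_cong: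
  assumes g: "g \<in> arr C" and U: "U \<in> slices C F g" "\<gamma> \<in> U" and V: "V \<in> slices C F g" "\<gamma> \<in> V"
  shows "gmO (Theta g U) (src C g, s g \<gamma>) = gmO (Theta g V) (src C g, s g \<gamma>)"
proof -
  note x = src_obj_C[OF g]
  interpret tight_corr "Gr (rng C g)" "Gr (src C g)" "cor F g" by (rule tight_corr_F[OF g])
  define E where "E = s g ` (U \<inter> V)"
  have E: "openin (gtop (Gr (src C g))) E" "E \<subseteq> obj (Gr (src C g))"
    unfolding E_def using openin_sanch_image[OF openin_Int[OF slice_open[OF U(1)] slice_open[OF V(1)]]]
      sanch_obj slice_sub[OF U(1)] by auto
  have inj: "inj_on (s g) U" "inj_on (s g) V" using U V slices_iff[OF g] by auto
  have "{\<gamma> \<in> U. s g \<gamma> \<in> E} = U \<inter> V" "{\<gamma> \<in> V. s g \<gamma> \<in> E} = U \<inter> V"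
    unfolding E_def using inj_onD[OF inj(1)] inj_onD[OF inj(2)] by blast+
  then have "smul IS (Theta g U) (Theta (src C g) E) = smul IS (Theta g V) (Theta (src C g) E)"
    using Theta_restrict[OF g _ E] U V by simp
  moreover have "(src C g, s g \<gamma>) \<in> Domain (Om.\<theta> (Theta (src C g) E))"
  proof -
    have e: "s g \<gamma> \<in> E" using U V by (auto simp: E_def)
    then have so: "s g \<gamma> \<in> obj (Gr (src C g))" using E(2) by blast
    have "s (src C g) (s g \<gamma>) = s g \<gamma>"
      using unit_cor(4)[OF x right.obj_facts(1)[OF so]] right.obj_facts(2)[OF so] by simp
    then have "((src C g, s g \<gamma>), (rng C (src C g), r (src C g) (s g \<gamma>))) \<in> Om.\<theta> (Theta (src C g) E)"
      unfolding theta_Theta[OF obj_C(1)[OF x] unit_slice[OF x E]] using e obj_C(2)[OF x]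
      by (intro bexI[of _ "s g \<gamma>"]) simp_all
    then show ?thesis by blast
  qed
  ultimately have "Om.ind.germ_equiv (Theta g U) (Theta g V) (src C g, s g \<gamma>)"
    unfolding Om.ind.germ_equiv_def using Theta_unit_idem[OF x E] by blast
  then show ?thesis
    using U V theta_Theta[OF g] Theta_elems[OF g] by (subst Om.ind.germ_eq_iff) (auto simp: Domain_iff)
qed

lemma arrow_eq:
  assumes "g \<in> arr C" "U \<in> slices C F g" "\<gamma> \<in> U"
  shows "arrow g \<gamma> = gmO (Theta g U) (src C g, s g \<gamma>)"
proof -
  have "(SOME U. U \<in> slices C F g \<and> \<gamma> \<in> U) \<in> slices C F g \<and> \<gamma> \<in> (SOME U. U \<in> slices C F g \<and> \<gamma> \<in> U)"
    by (rule someI[of _ U]) (use assms in blast)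
  then show ?thesis unfolding arrow_def using assms by (intro germ_Theta_cong) auto
qed

lemma arrow_germ:
  assumes "g \<in> arr C" "\<gamma> \<in> cpts F g"
  obtains U where "U \<in> slices C F g" "\<gamma> \<in> U" "arrow g \<gamma> = gmO (Theta g U) (src C g, s g \<gamma>)"
    "Theta g U \<in> elems IS" "((src C g, s g \<gamma>), (rng C g, r g \<gamma>)) \<in> Om.\<theta> (Theta g U)"
proof -
  obtain U where U: "U \<in> slices C F g" "\<gamma> \<in> U" using slice_at[OF assms] .
  show ?thesis
    by (rule that[OF U arrow_eq[OF assms(1) U] Theta_elems[OF assms(1) U(1)]])
      (use U in \<open>auto simp: theta_Theta[OF assms(1) U(1)]\<close>)
qed

lemma arrow_facts:
  assumes "g \<in> arr C" "\<gamma> \<in> cpts F g"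
  shows "arrow g \<gamma> \<in> arr U_F" "src U_F (arrow g \<gamma>) = ug (src C g, s g \<gamma>)"
    "rng U_F (arrow g \<gamma>) = ug (rng C g, r g \<gamma>)"
  by (rule arrow_germ[OF assms], simp add: Om.ind.arr_germ Om.ind.src_germ Om.ind.rng_germ)+

lemma arrow_mult:
  assumes gh: "g \<in> arr C" "h \<in> arr C" "src C g = rng C h"
    and \<gamma>: "\<gamma> \<in> cpts F g" "\<eta> \<in> cpts F h" "s g \<gamma> = r h \<eta>"
  shows "cmp U_F (arrow g \<gamma>) (arrow h \<eta>) = arrow (cmp C g h) (prd g h \<gamma> \<eta>)"
proof -
  obtain U where U: "U \<in> slices C F g" "\<gamma> \<in> U" "arrow g \<gamma> = gmO (Theta g U) (src C g, s g \<gamma>)"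
    "Theta g U \<in> elems IS" "((src C g, s g \<gamma>), (rng C g, r g \<gamma>)) \<in> Om.\<theta> (Theta g U)"
    by (rule arrow_germ[OF gh(1) \<gamma>(1)])
  obtain V where V: "V \<in> slices C F h" "\<eta> \<in> V" "arrow h \<eta> = gmO (Theta h V) (src C h, s h \<eta>)"
    "Theta h V \<in> elems IS" "((src C h, s h \<eta>), (rng C h, r h \<eta>)) \<in> Om.\<theta> (Theta h V)"
    by (rule arrow_germ[OF gh(2) \<gamma>(2)])
  have "cmp U_F (arrow g \<gamma>) (arrow h \<eta>) = gmO (smul IS (Theta g U) (Theta h V)) (src C h, s h \<eta>)"
    unfolding U(3) V(3) gh(3) \<gamma>(3) using U(5) gh(3) \<gamma>(3)
    by (intro Om.ind.cmp_germ[OF V(4,5) U(4), of "(rng C g, r g \<gamma>)"]) simp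
  also have "\<dots> = arrow (cmp C g h) (prd g h \<gamma> \<eta>)"
    unfolding Theta_mul[OF gh U(1) V(1)]
    using arrow_eq[OF cmp_C(1)[OF gh] prd_slice[OF gh U(1) V(1)], of "prd g h \<gamma> \<eta>"] U(2) V(2) \<gamma>(3)
      prd_facts(3)[OF gh \<gamma>] cmp_C(2)[OF gh] by auto
  finally show ?thesis .
qed

lemma Domain_Theta: "g \<in> arr C \<Longrightarrow> U \<in> slices C F g \<Longrightarrow> Domain (Om.\<theta> (Theta g U)) = {src C g} \<times> s g ` U"
  unfolding Domain_iff set_eq_iff theta_Theta by auto

text \<open>On a slice \<open>U\<close>, the map \<open>arrow g\<close> is the right anchor map followed by the homeomorphism \<open>v \<mapsto> [Theta g U, v]\<close> onto a
  bisection.\<close>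

lemma openin_arrow_image:
  assumes g: "g \<in> arr C" and N: "openin (ctp g) N"
  shows "openin (gtop U_F) (arrow g ` N)"
proof (subst openin_subopen, intro ballI)
  fix a assume "a \<in> arrow g ` N"
  then obtain \<gamma> where \<gamma>: "\<gamma> \<in> N" "a = arrow g \<gamma>" by blast
  then have "\<gamma> \<in> cpts F g" using openin_subset[OF N] by blast
  then obtain V where V: "V \<in> slices C F g" "\<gamma> \<in> V" using slice_at[OF g] by blast
  let ?U = "V \<inter> N"
  have U: "?U \<in> slices C F g" using slice_openin_sub[OF V(1) N] .
  have "arrow g ` ?U = gmO (Theta g ?U) ` Domain (Om.\<theta> (Theta g ?U))"
    unfolding Domain_Theta[OF g U] using arrow_eq[OF g U] by force
  then have "openin (gtop U_F) (arrow g ` ?U)"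
    using Om.ind.openin_germ_image[OF Theta_elems[OF g U] Om.ind.openin_Domain[OF Theta_elems[OF g U]]] by simp
  then show "\<exists>T. openin (gtop U_F) T \<and> a \<in> T \<and> T \<subseteq> arrow g ` N" using \<gamma> V by blast
qed

lemma continuous_arrow:
  assumes g: "g \<in> arr C"
  shows "continuous_map (ctp g) (gtop U_F) (arrow g)"
  unfolding continuous_map_def
proof (intro conjI allI impI)
  interpret tight_corr "Gr (rng C g)" "Gr (src C g)" "cor F g" by (rule tight_corr_F[OF g])
  show "arrow g \<in> pts \<rightarrow> topspace (gtop U_F)"
    using arrow_facts(1)[OF g] by (simp add: Om.ind.topspace_TG)
  fix N assume N: "openin (gtop U_F) N"
  show "openin (ctp g) {\<gamma> \<in> pts. arrow g \<gamma> \<in> N}"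
  proof (subst openin_subopen, intro ballI)
    fix \<gamma> assume \<gamma>: "\<gamma> \<in> {\<gamma> \<in> pts. arrow g \<gamma> \<in> N}"
    then obtain U where U: "U \<in> slices C F g" "\<gamma> \<in> U" using slice_at[OF g] by blast
    define M where "M = {v \<in> Domain (Om.\<theta> (Theta g U)). gmO (Theta g U) v \<in> N}"
    have "openin Om M" unfolding M_def by (rule Om.ind.openin_germ_vimage[OF Theta_elems[OF g U(1)] N])
    then have "openin (gtop (Gr (src C g))) {e. (src C g, e) \<in> M}" using openin_Omega src_obj_C[OF g] by blast
    then have "openin (ctp g) (U \<inter> {\<gamma> \<in> pts. s g \<gamma> \<in> {e. (src C g, e) \<in> M}})"
      by (intro openin_Int slice_open[OF U(1)] openin_continuous_map_preimage[OF continuous_sanch'])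
    moreover have "U \<inter> {\<gamma> \<in> pts. s g \<gamma> \<in> {e. (src C g, e) \<in> M}} \<subseteq> {\<gamma> \<in> pts. arrow g \<gamma> \<in> N}"
      using arrow_eq[OF g U(1)] by (auto simp: M_def)
    moreover have "\<gamma> \<in> U \<inter> {\<gamma> \<in> pts. s g \<gamma> \<in> {e. (src C g, e) \<in> M}}"
      using \<gamma> U arrow_eq[OF g U] by (auto simp: M_def Domain_Theta[OF g U(1)])
    ultimately show "\<exists>T. openin (ctp g) T \<and> \<gamma> \<in> T \<and> T \<subseteq> {\<gamma> \<in> pts. arrow g \<gamma> \<in> N}" by blast
  qed
qed

text \<open>The arrows coming from the correspondences generate the groupoid, because slices generate the inverse
  semigroup.\<close>

lemma arrow_induct:
  assumes a: "a \<in> arr U_F"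
    and arrow: "\<And>g \<gamma>. g \<in> arr C \<Longrightarrow> \<gamma> \<in> cpts F g \<Longrightarrow> P (arrow g \<gamma>)"
    and cmp: "\<And>a b. a \<in> arr U_F \<Longrightarrow> b \<in> arr U_F \<Longrightarrow> src U_F a = rng U_F b \<Longrightarrow> P a \<Longrightarrow> P b \<Longrightarrow> P (cmp U_F a b)"
    and ginv: "\<And>a. a \<in> arr U_F \<Longrightarrow> P a \<Longrightarrow> P (ginv U_F a)"
  shows "P a"
proof -
  let ?c = "isg_class (I_rels C F)"
  have el: "?c t \<in> elems IS" if "set_isg_term t \<subseteq> Bis C F" for t
    unfolding I_sg_def using that by (rule isg_class_elems)
  have "P (gmO (?c t) v)" if "set_isg_term t \<subseteq> Bis C F" "(v, w) \<in> term_graph Om.gr t" for t v w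
    using that
  proof (induction t arbitrary: v w)
    case (Gen b)
    have "b \<in> Bis C F" using Gen by simp
    then obtain g U where b: "b = mk_bis g U" "g \<in> arr C" "U \<in> slices C F g" by (auto simp: Bis_def)
    then have "(v, w) \<in> Om.\<theta> (Theta g U)"
      using Gen(2) Om.induced_class[OF Gen(1)] by (simp add: Theta_def)
    then obtain \<gamma> where \<gamma>: "\<gamma> \<in> U" "v = (src C g, s g \<gamma>)" using theta_Theta[OF b(2,3)] by blast
    then show ?case
      using arrow_eq[OF b(2,3) \<gamma>(1)] arrow[OF b(2), of \<gamma>] slice_sub[OF b(3)] by (auto simp: Theta_def b(1))
  next
    case (Mul t u)
    then have S: "set_isg_term t \<subseteq> Bis C F" "set_isg_term u \<subseteq> Bis C F" by auto
    obtain x where x: "(v, x) \<in> term_graph Om.gr u" "(x, w) \<in> term_graph Om.gr t" using Mul.prems(2) by auto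
    have th: "(v, x) \<in> Om.\<theta> (?c u)" "(x, w) \<in> Om.\<theta> (?c t)"
      using x S by (simp_all add: Om.induced_class)
    have "cmp U_F (gmO (?c t) x) (gmO (?c u) v) = gmO (smul IS (?c t) (?c u)) v"
      using th by (intro Om.ind.cmp_germ[where w = w] el S)
    moreover have "smul IS (?c t) (?c u) = ?c (Mul t u)" unfolding I_sg_def by simp
    moreover have "P (cmp U_F (gmO (?c t) x) (gmO (?c u) v))"
      using th el S Mul.IH x
      by (intro cmp) (auto simp: Om.ind.src_germ[where z = w] Om.ind.rng_germ intro: Om.ind.arr_germ)
    ultimately show ?case by simp
  next
    case (Star t)
    then have S: "set_isg_term t \<subseteq> Bis C F" by simp
    have x: "(w, v) \<in> term_graph Om.gr t" using Star.prems(2) by simp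
    have th: "(w, v) \<in> Om.\<theta> (?c t)" using x S by (simp add: Om.induced_class)
    have "ginv U_F (gmO (?c t) w) = gmO (sstar IS (?c t)) v" by (rule Om.ind.ginv_germ[OF el[OF S] th])
    moreover have "sstar IS (?c t) = ?c (Star t)" unfolding I_sg_def by simp
    moreover have "P (ginv U_F (gmO (?c t) w))"
      using Om.ind.arr_germ[OF el[OF S] th] Star.IH[OF S x] by (rule ginv)
    ultimately show ?case by simp
  qed
  moreover obtain t v w where t: "a = gmO t v" "t \<in> elems IS" "(v, w) \<in> Om.\<theta> t" by (rule Om.ind.arrE[OF a])
  moreover obtain t' where "t = ?c t'" "set_isg_term t' \<subseteq> Bis C F"
    using t(2) unfolding I_sg_def by (rule isg_class_elemsE)
  ultimately show ?thesis using Om.induced_class by simp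
qed

lemma arrow_ract:
  assumes "g \<in> arr C" "\<gamma> \<in> cpts F g" "\<eta> \<in> arr (Gr (src C g))" "s g \<gamma> = rng (Gr (src C g)) \<eta>"
  shows "cmp U_F (arrow g \<gamma>) (arrow (src C g) \<eta>) = arrow g (ra g \<gamma> \<eta>)"
  using arrow_mult[of g "src C g" \<gamma> \<eta>] assms unit_cor(2,3)[OF src_obj_C[OF assms(1)]]
  by (simp add: arr_C prd_unit_right)

end

section \<open>From actions of the model to actions of the diagram\<close>

locale left_action = etale G
  for G :: "'g tgroupoid" and Y :: "'y topology" and anch :: "'y \<Rightarrow> 'g" and act :: "'g \<Rightarrow> 'y \<Rightarrow> 'y" +
  assumes left: "left_space G Y anch act"
begin

abbreviation act_dom :: "('g \<times> 'y) topology" where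
  "act_dom \<equiv> subtopology (prod_topology (gtop G) Y) {(u, y). src G u = anch y}"

lemma continuous_anch: "continuous_map Y (gtop G) anch"
  using left by (simp add: left_space_def unit_space_def continuous_map_in_subtopology)

lemma continuous_act: "continuous_map act_dom Y (\<lambda>(u, y). act u y)"
  using left by (simp add: left_space_def)

lemma anch_obj: "y \<in> topspace Y \<Longrightarrow> anch y \<in> obj G"
  using left topspace_unit_space by (auto simp: left_space_def continuous_map_def)

lemma act_space: "y \<in> topspace Y \<Longrightarrow> u \<in> arr G \<Longrightarrow> src G u = anch y \<Longrightarrow> act u y \<in> topspace Y"
  using funcset_mem[OF continuous_map_funspace[OF continuous_act], of "(u, y)"] by (simp add: topspace_gtop)

lemma anch_act: "y \<in> topspace Y \<Longrightarrow> u \<in> arr G \<Longrightarrow> src G u = anch y \<Longrightarrow> anch (act u y) = rng G u"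
  using left by (simp add: left_space_def)

lemma act_cmp:
  "y \<in> topspace Y \<Longrightarrow> u \<in> arr G \<Longrightarrow> v \<in> arr G \<Longrightarrow> src G u = rng G v \<Longrightarrow> src G v = anch y \<Longrightarrow>
    act u (act v y) = act (cmp G u v) y"
  using left by (simp add: left_space_def)

lemma act_unit: "y \<in> topspace Y \<Longrightarrow> act (anch y) y = y"
  using left by (simp add: left_space_def)

lemma act_ginv:
  assumes "y \<in> topspace Y" "u \<in> arr G" "src G u = anch y"
  shows "act (ginv G u) (act u y) = y"
  using assms act_cmp[of y "ginv G u" u] act_unit[of y] by (simp add: arr_facts)

lemma act_ginv':
  assumes "y \<in> topspace Y" "u \<in> arr G" "rng G u = anch y"
  shows "act u (act (ginv G u) y) = y"
  using act_ginv[of y "ginv G u"] assms by (simp add: arr_facts ginv_ginv)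

lemma act_inj:
  assumes "y \<in> topspace Y" "z \<in> topspace Y" "u \<in> arr G" "src G u = anch y" "src G u = anch z" "act u y = act u z"
  shows "y = z"
  using act_ginv[of y u] act_ginv[of z u] assms by simp

text \<open>Translating by the inverse arrow turns the action map into the projection of a fibre product.\<close>

lemma openin_act_image:
  assumes W: "openin act_dom W"
  shows "openin Y ((\<lambda>(u, y). act u y) ` W)"
proof -
  let ?t = "\<lambda>p. ((ginv G \<circ> fst) p, (\<lambda>(u, y). act u y) p)"
  have "continuous_map act_dom (gtop G) (ginv G \<circ> fst)"
    by (rule continuous_map_compose[OF continuous_map_from_subtopology[OF continuous_map_fst] continuous_ginv])
  from continuous_map_pairedI[OF this continuous_act]
  have "continuous_map act_dom act_dom ?t"
    unfolding continuous_map_in_subtopology by (auto simp: topspace_gtop arr_facts anch_act)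
  then have "openin act_dom {p \<in> topspace act_dom. ?t p \<in> W}"
    using W by (rule openin_continuous_map_preimage)
  then have "openin Y (snd ` {p \<in> topspace act_dom. ?t p \<in> W})"
  proof (rule openin_snd_image_of_fibred)
    fix N assume N: "openin (gtop G) N"
    have "{y \<in> topspace Y. \<exists>u\<in>N. (u, y) \<in> {(u, y). src G u = anch y}} = {y \<in> topspace Y. anch y \<in> src G ` N}"
      by force
    then show "openin Y {y \<in> topspace Y. \<exists>u\<in>N. (u, y) \<in> {(u, y). src G u = anch y}}"
      using openin_continuous_map_preimage[OF continuous_anch openin_src_image[OF N]] by simp
  qed
  moreover have "snd ` {p \<in> topspace act_dom. ?t p \<in> W} = (\<lambda>(u, y). act u y) ` W" (is "?L = ?R")
  proof
    show "?L \<subseteq> ?R"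
    proof
      fix z assume "z \<in> ?L"
      then obtain u where u: "u \<in> arr G" "z \<in> topspace Y" "src G u = anch z" "(ginv G u, act u z) \<in> W"
        by (auto simp: topspace_gtop)
      then show "z \<in> ?R" using act_ginv[of z u] by (intro image_eqI[of _ _ "(ginv G u, act u z)"]) simp_all
    qed
    show "?R \<subseteq> ?L"
    proof
      fix z assume "z \<in> ?R"
      then obtain u y where u: "(u, y) \<in> W" "z = act u y" by auto
      then have uy: "u \<in> arr G" "y \<in> topspace Y" "src G u = anch y"
        using openin_subset[OF W] by (auto simp: topspace_gtop)
      then show "z \<in> ?L" using u act_ginv[OF uy(2,1,3)]
        by (intro image_eqI[of _ _ "(ginv G u, z)"]) (simp_all add: topspace_gtop arr_facts ginv_ginv act_space anch_act)
    qed
  qed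
  ultimately show ?thesis by simp
qed

end

context tight_diag
begin

sublocale UF: etale U_F
  by unfold_locales (rule Om.ind.etale_transformation_groupoid)

definition base_point :: "((('c, 'a) bis isg_term set \<times> ('c \<times> 'a)) set, 'y) gaction \<Rightarrow> 'y \<Rightarrow> 'c \<times> 'a" where
  "base_point a y = (THE \<omega>. \<omega> \<in> topspace Om \<and> ganch a y = ug \<omega>)"

text \<open>The values outside the domains are those that the normalisation in \<open>F_actions\<close> requires.\<close>

definition to_F_action ::
  "'y topology \<Rightarrow> ((('c, 'a) bis isg_term set \<times> ('c \<times> 'a)) set, 'y) gaction \<Rightarrow> ('c, 'a, 'y) faction" where
  "to_F_action Y a =
    \<lparr> part = (\<lambda>x. if x \<in> obj C then {y \<in> topspace Y. fst (base_point a y) = x} else {}),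
      fanch = restrict (\<lambda>y. snd (base_point a y)) (topspace Y),
      fmul = (\<lambda>g \<gamma> y. if g \<in> arr C \<and> \<gamma> \<in> cpts F g \<and> y \<in> topspace Y \<and> ganch a y = ug (src C g, s g \<gamma>)
        then gact a (arrow g \<gamma>) y else undefined) \<rparr>"

end

locale model_action = tight_diag C F
  for C :: "'c category" and F :: "('c, 'a) diag" +
  fixes Y :: "'y topology" and a :: "((('c, 'a) bis isg_term set \<times> ('c \<times> 'a)) set, 'y) gaction"
  assumes a: "a \<in> left_actions U_F Y"
begin

sublocale act: left_action U_F Y "ganch a" "gact a"
  by unfold_locales (use a in \<open>simp add: left_actions_def\<close>)

abbreviation pos where "pos \<equiv> base_point a"
abbreviation A where "A \<equiv> to_F_action Y a"

lemma pos_eq: "\<omega> \<in> topspace Om \<Longrightarrow> ganch a y = ug \<omega> \<Longrightarrow> pos y = \<omega>"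
  unfolding base_point_def by (rule the_equality) (use Om.ind.unit_germ_inj in auto)

lemma pos_space:
  assumes "y \<in> topspace Y"
  shows "pos y \<in> topspace Om" "ganch a y = ug (pos y)"
proof -
  obtain \<omega> where "\<omega> \<in> topspace Om" "ganch a y = ug \<omega>"
    using act.anch_obj[OF assms] by (auto simp: Om.ind.obj_TG)
  then show "pos y \<in> topspace Om" "ganch a y = ug (pos y)" using pos_eq by auto
qed

lemma anch_eq_iff:
  assumes "y \<in> topspace Y" "\<omega> \<in> topspace Om"
  shows "ganch a y = ug \<omega> \<longleftrightarrow> pos y = \<omega>"
  using pos_eq[OF assms(2)] pos_space[OF assms(1)] by auto

lemma openin_pos_vimage:
  assumes "openin Om V"
  shows "openin Y {y \<in> topspace Y. pos y \<in> V}"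
proof -
  have "{y \<in> topspace Y. pos y \<in> V} = {y \<in> topspace Y. ganch a y \<in> ug ` V}"
  proof (intro equalityI subsetI)
    fix y assume "y \<in> {y \<in> topspace Y. pos y \<in> V}"
    then show "y \<in> {y \<in> topspace Y. ganch a y \<in> ug ` V}" using pos_space(2)[of y] by simp
  next
    fix y assume "y \<in> {y \<in> topspace Y. ganch a y \<in> ug ` V}"
    then obtain \<omega> where "y \<in> topspace Y" "\<omega> \<in> V" "ganch a y = ug \<omega>" by blast
    moreover have "\<omega> \<in> topspace Om" using openin_subset[OF assms] \<open>\<omega> \<in> V\<close> by blast
    ultimately show "y \<in> {y \<in> topspace Y. pos y \<in> V}" using pos_eq by simp
  qed
  then show ?thesis
    by (simp only: openin_continuous_map_preimage[OF act.continuous_anch Om.ind.openin_unit_germ_image[OF assms]])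
qed

lemma continuous_pos: "continuous_map Y Om pos"
  using openin_pos_vimage pos_space(1) by (auto simp: continuous_map_def)

lemma arrow_source_space: "g \<in> arr C \<Longrightarrow> \<gamma> \<in> cpts F g \<Longrightarrow> (src C g, s g \<gamma>) \<in> topspace Om"
  using s_obj by (simp add: topspace_Omega src_obj_C)

lemma arrow_range_space: "g \<in> arr C \<Longrightarrow> \<gamma> \<in> cpts F g \<Longrightarrow> (rng C g, r g \<gamma>) \<in> topspace Om"
  using r_obj by (simp add: topspace_Omega rng_obj_C)

lemma part_A: "x \<in> obj C \<Longrightarrow> part A x = {y \<in> topspace Y. fst (pos y) = x}"
  by (simp add: to_F_action_def)

lemma fanch_A: "y \<in> topspace Y \<Longrightarrow> fanch A y = snd (pos y)"
  by (simp add: to_F_action_def)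

lemma fdom_A:
  assumes "g \<in> arr C"
  shows "(\<gamma>, y) \<in> fdom C F A g \<longleftrightarrow> \<gamma> \<in> cpts F g \<and> y \<in> topspace Y \<and> pos y = (src C g, s g \<gamma>)"
proof -
  have "fst (pos y) = src C g \<and> s g \<gamma> = snd (pos y) \<longleftrightarrow> pos y = (src C g, s g \<gamma>)"
    by (cases "pos y") auto
  moreover have "(\<gamma>, y) \<in> fdom C F A g \<longleftrightarrow>
      \<gamma> \<in> cpts F g \<and> y \<in> topspace Y \<and> fst (pos y) = src C g \<and> s g \<gamma> = fanch A y"
    unfolding fdom_def by (simp add: part_A[OF src_obj_C[OF assms]])
  ultimately show ?thesis using fanch_A by metis
qed

lemma fmul_A_cases: "fmul A g \<gamma> y =
    (if g \<in> arr C \<and> \<gamma> \<in> cpts F g \<and> y \<in> topspace Y \<and> ganch a y = ug (src C g, s g \<gamma>)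
     then gact a (arrow g \<gamma>) y else undefined)"
  by (simp add: to_F_action_def)

lemma fmul_A:
  assumes "g \<in> arr C" "(\<gamma>, y) \<in> fdom C F A g"
  shows "fmul A g \<gamma> y = gact a (arrow g \<gamma>) y"
  using assms(2) pos_space(2)[of y] unfolding fdom_A[OF assms(1)] fmul_A_cases using assms(1) by simp

lemma arrow_act:
  assumes "g \<in> arr C" "(\<gamma>, y) \<in> fdom C F A g"
  shows "\<gamma> \<in> cpts F g" "y \<in> topspace Y" "arrow g \<gamma> \<in> arr U_F" "src U_F (arrow g \<gamma>) = ganch a y"
    "gact a (arrow g \<gamma>) y \<in> topspace Y" "pos (gact a (arrow g \<gamma>) y) = (rng C g, r g \<gamma>)"
proof -
  show *: "\<gamma> \<in> cpts F g" "y \<in> topspace Y" using assms by (simp_all add: fdom_A)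
  show **: "arrow g \<gamma> \<in> arr U_F" "src U_F (arrow g \<gamma>) = ganch a y"
    using arrow_facts[OF assms(1) *(1)] pos_space(2)[OF *(2)] assms by (simp_all add: fdom_A)
  show "gact a (arrow g \<gamma>) y \<in> topspace Y" using * ** by (intro act.act_space)
  show "pos (gact a (arrow g \<gamma>) y) = (rng C g, r g \<gamma>)"
    using act.anch_act[OF *(2) **] arrow_facts(3)[OF assms(1) *(1)] arrow_range_space[OF assms(1) *(1)]
    by (intro pos_eq) simp_all
qed

lemma mult_A_continuous:
  assumes g: "g \<in> arr C"
  shows "continuous_map (subtopology (prod_topology (ctp g) Y) (fdom C F A g)) Y (\<lambda>(\<gamma>, y). fmul A g \<gamma> y)"
    (is "continuous_map ?D _ _")
proof -
  have tD: "topspace ?D = fdom C F A g" using fdom_A[OF g] by auto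
  have "continuous_map ?D (gtop U_F) (arrow g \<circ> fst)"
    by (rule continuous_map_compose[OF continuous_map_from_subtopology[OF continuous_map_fst] continuous_arrow[OF g]])
  from continuous_map_pairedI[OF this continuous_map_from_subtopology[OF continuous_map_snd]]
  have "continuous_map ?D act.act_dom (\<lambda>p. ((arrow g \<circ> fst) p, snd p))"
    unfolding continuous_map_in_subtopology tD using arrow_act(4)[OF g] by auto
  from continuous_map_compose[OF this act.continuous_act]
  show ?thesis
    by (rule continuous_map_eq) (auto simp: tD fmul_A[OF g])
qed

text \<open>The product map is the action map of the groupoid after \<open>arrow g \<times> id\<close>. The domain of the former is the full
  preimage of the domain of the latter, so \<open>arrow g \<times> id\<close> restricts to an open map between them.\<close>

lemma mult_A_open:
  assumes g: "g \<in> arr C" and W: "openin (subtopology (prod_topology (ctp g) Y) (fdom C F A g)) W"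
  shows "openin Y ((\<lambda>(\<gamma>, y). fmul A g \<gamma> y) ` W)"
proof -
  have sub: "W \<subseteq> fdom C F A g" using openin_subset[OF W] by simp
  let ?W = "(\<lambda>(\<gamma>, y). (arrow g \<gamma>, y)) ` W"
  have "openin act.act_dom ?W"
  proof (subst openin_subopen, intro ballI)
    fix q assume "q \<in> ?W"
    then obtain \<gamma> y where q: "q = (arrow g \<gamma>, y)" "(\<gamma>, y) \<in> W" by auto
    obtain T where T: "openin (prod_topology (ctp g) Y) T" "W = T \<inter> fdom C F A g"
      using W by (auto simp: openin_subtopology)
    have "(\<gamma>, y) \<in> T" using q T by blast
    then obtain M N where MN: "openin (ctp g) M" "openin Y N" "\<gamma> \<in> M" "y \<in> N" "M \<times> N \<subseteq> T"
      using T(1) unfolding openin_prod_topology_alt by metis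
    let ?T = "(arrow g ` M \<times> N) \<inter> {(u, y). src U_F u = ganch a y}"
    have "openin act.act_dom ?T"
      using openin_arrow_image[OF g MN(1)] MN(2) by (intro openin_subtopology_Int) (simp add: openin_prod_Times_iff)
    moreover have "q \<in> ?T" using q MN arrow_act(4)[OF g] sub by auto
    moreover have "?T \<subseteq> ?W"
    proof
      fix p assume "p \<in> ?T"
      then obtain \<gamma>' y' where p: "p = (arrow g \<gamma>', y')" "\<gamma>' \<in> M" "y' \<in> N" "src U_F (arrow g \<gamma>') = ganch a y'"
        by auto
      have \<gamma>': "\<gamma>' \<in> cpts F g" "y' \<in> topspace Y" using p openin_subset MN by blast+
      then have "pos y' = (src C g, s g \<gamma>')"
        using p(4) arrow_facts(2)[OF g \<gamma>'(1)] arrow_source_space[OF g \<gamma>'(1)] by (intro pos_eq) simp_all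
      then have "(\<gamma>', y') \<in> W" using \<gamma>' p MN(5) T(2) fdom_A[OF g] by auto
      then show "p \<in> ?W" using p(1) by force
    qed
    ultimately show "\<exists>T. openin act.act_dom T \<and> q \<in> T \<and> T \<subseteq> ?W" by blast
  qed
  then have "openin Y ((\<lambda>(u, y). gact a u y) ` ?W)" by (rule act.openin_act_image)
  moreover have "(\<lambda>(u, y). gact a u y) ` ?W = (\<lambda>(\<gamma>, y). fmul A g \<gamma> y) ` W"
    unfolding image_comp using sub fmul_A[OF g] by (intro image_cong) auto
  ultimately show ?thesis by simp
qed

theorem F_action_A: "F_action C F Y A"
  unfolding F_action_def
proof (intro conjI ballI impI)
  show "(\<Union>x\<in>obj C. part A x) = topspace Y"
  proof -
    have "fst (pos y) \<in> obj C" if "y \<in> topspace Y" for y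
      using pos_space(1)[OF that] by (auto simp: topspace_Omega)
    then show ?thesis by (auto simp: part_A)
  qed
  show "disjoint_family_on (part A) (obj C)" by (auto simp: disjoint_family_on_def part_A)
next
  fix x assume x: "x \<in> obj C"
  have px: "part A x = {y \<in> topspace Y. pos y \<in> part OmA x}"
  proof -
    have *: "fst (pos y) = x \<longleftrightarrow> pos y \<in> {x} \<times> obj (Gr x)" if "y \<in> topspace Y" for y
      using pos_space(1)[OF that] by (auto simp: topspace_Omega)
    show ?thesis
      unfolding part_A[OF x] part_Omega[OF x] by (intro Collect_cong conj_cong HOL.refl) (rule *)
  qed
  have "openin Om (part OmA x)" "closedin Om (part OmA x)"
    using F_action_Omega x by (simp_all add: F_action_def)
  then show "openin Y (part A x)" "closedin Y (part A x)"
    unfolding px by (auto intro: openin_pos_vimage closedin_continuous_map_preimage[OF continuous_pos])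
  have "continuous_map (subtopology Y (part A x)) (subtopology Om (part OmA x)) pos"
    unfolding continuous_map_in_subtopology using continuous_map_from_subtopology[OF continuous_pos] by (auto simp: px)
  from continuous_map_compose[OF this Om.continuous_fanch[OF x]]
  show "continuous_map (subtopology Y (part A x)) (unit_space (Gr x)) (fanch A)"
    by (rule continuous_map_eq) (simp add: fanch_A fanch_Omega)
next
  fix g assume g: "g \<in> arr C"
  interpret tight_corr "Gr (rng C g)" "Gr (src C g)" "cor F g" by (rule tight_corr_F[OF g])
  let ?D = "subtopology (prod_topology (ctp g) Y) (fdom C F A g)"
  let ?E = "subtopology Y (part A (rng C g))"
  let ?m = "\<lambda>(\<gamma>, y). fmul A g \<gamma> y"
  have tD: "topspace ?D = fdom C F A g" using fdom_A[OF g] by auto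
  have tE: "topspace ?E = part A (rng C g)" using g by (auto simp: part_A rng_obj_C)
  have into: "?m p \<in> part A (rng C g)" if "p \<in> fdom C F A g" for p
    using that arrow_act(5,6)[OF g] by (cases p) (simp add: fmul_A[OF g] part_A rng_obj_C[OF g])
  have "continuous_map ?D ?E ?m"
    unfolding continuous_map_in_subtopology tD using mult_A_continuous[OF g] into by blast
  moreover have "open_map ?D ?E ?m"
    unfolding open_map_def
  proof (intro allI impI)
    fix W assume W: "openin ?D W"
    have "?m ` W \<subseteq> part A (rng C g)" using openin_subset[OF W] into unfolding tD by blast
    then show "openin ?E (?m ` W)"
      using mult_A_open[OF g W] by (metis openin_subtopology_Int inf.absorb1)
  qed
  moreover have "?m ` topspace ?D = topspace ?E"
    unfolding tD tE
  proof (intro equalityI subsetI)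
    fix z assume "z \<in> part A (rng C g)"
    then have z: "z \<in> topspace Y" "fst (pos z) = rng C g" by (simp_all add: part_A rng_obj_C[OF g])
    then have "snd (pos z) \<in> obj (Gr (rng C g))" using pos_space(1)[OF z(1)] by (auto simp: topspace_Omega)
    then obtain \<gamma> where \<gamma>: "\<gamma> \<in> pts" "snd (pos z) = r g \<gamma>" using ranch_surj by blast
    then have anch: "ganch a z = rng U_F (arrow g \<gamma>)"
      using pos_space(2)[OF z(1)] z(2) arrow_facts(3)[OF g \<gamma>(1)] by (metis prod.collapse)
    note ar = arrow_facts(1)[OF g \<gamma>(1)]
    define y where "y = gact a (ginv U_F (arrow g \<gamma>)) z"
    have y: "y \<in> topspace Y" "ganch a y = ug (src C g, s g \<gamma>)"
      unfolding y_def using z anch ar arrow_facts(2)[OF g \<gamma>(1)]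
      by (simp_all add: act.act_space act.anch_act UF.arr_facts)
    then have fd: "(\<gamma>, y) \<in> fdom C F A g"
      using pos_eq[OF arrow_source_space[OF g \<gamma>(1)]] \<gamma>(1) by (simp add: fdom_A[OF g])
    have "fmul A g \<gamma> y = z"
      using fmul_A[OF g fd] act.act_ginv'[OF z(1) ar anch[symmetric]] by (simp add: y_def)
    then show "z \<in> ?m ` fdom C F A g" using fd by force
  qed (use into in blast)
  ultimately show "let D = ?D; E = ?E; m = ?m
      in continuous_map D E m \<and> open_map D E m \<and> m ` topspace D = topspace E" by simp
  fix p assume p: "p \<in> fdom C F A g"
  then show "case p of (\<gamma>, y) \<Rightarrow> fanch A (fmul A g \<gamma> y) = r g \<gamma>"
    using arrow_act(5,6)[OF g] by (cases p) (simp add: fmul_A[OF g] fanch_A)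
  show "case p of (\<gamma>, y) \<Rightarrow> \<forall>(\<gamma>', y')\<in>fdom C F A g. fmul A g \<gamma> y = fmul A g \<gamma>' y' \<longrightarrow>
        (\<exists>\<eta>\<in>arr (Gr (src C g)). s g \<gamma> = rng (Gr (src C g)) \<eta> \<and> \<gamma>' = ra g \<gamma> \<eta> \<and>
           src (Gr (src C g)) \<eta> = fanch A y' \<and> y = fmul A (src C g) \<eta> y')"
  proof (cases p, hypsubst, unfold prod.case, intro ballI, unfold split_paired_all prod.case, intro impI)
    fix \<gamma> y \<gamma>' y' assume py: "p = (\<gamma>, y)" and y': "(\<gamma>', y') \<in> fdom C F A g" and eq: "fmul A g \<gamma> y = fmul A g \<gamma>' y'"
    have y: "(\<gamma>, y) \<in> fdom C F A g" using p py by simp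
    note fy = arrow_act[OF g y] and fy' = arrow_act[OF g y']
    have eq': "gact a (arrow g \<gamma>) y = gact a (arrow g \<gamma>') y'" using eq by (simp add: fmul_A[OF g] y y')
    then have "r g \<gamma> = r g \<gamma>'" using fy(6) fy'(6) by simp
    then obtain \<eta> where \<eta>: "\<eta> \<in> arr (Gr (src C g))" "s g \<gamma> = rng (Gr (src C g)) \<eta>" "\<gamma>' = ra g \<gamma> \<eta>"
      "src (Gr (src C g)) \<eta> = s g \<gamma>'"
      using ranch_eqD[OF fy(1) fy'(1)] by metis
    note x = src_obj_C[OF g]
    have fd: "(\<eta>, y') \<in> fdom C F A (src C g)"
      using y' \<eta> unit_cor[OF x] by (simp add: fdom_A[OF g] fdom_A[OF obj_C(1)[OF x]] obj_C[OF x])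
    note f\<eta> = arrow_act[OF obj_C(1)[OF x] fd]
    have pe: "pos (gact a (arrow (src C g) \<eta>) y') = (src C g, s g \<gamma>)"
      using f\<eta>(6) \<eta>(1,2) unit_cor(3)[OF x] obj_C(3)[OF x] by simp
    have ae: "ganch a (gact a (arrow (src C g) \<eta>) y') = src U_F (arrow g \<gamma>)"
      using pos_space(2)[OF f\<eta>(5)] pe arrow_facts(2)[OF g fy(1)] by simp
    have "gact a (arrow g \<gamma>) (gact a (arrow (src C g) \<eta>) y') = gact a (cmp U_F (arrow g \<gamma>) (arrow (src C g) \<eta>)) y'"
      using fy(3) f\<eta>(2-4) ae act.anch_act[OF f\<eta>(2-4)] by (intro act.act_cmp) simp_all
    also have "\<dots> = gact a (arrow g \<gamma>) y"
      unfolding arrow_ract[OF g fy(1) \<eta>(1,2)] eq' \<eta>(3) ..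
    finally have "y = gact a (arrow (src C g) \<eta>) y'"
      using act.act_inj[OF fy(2) f\<eta>(5) fy(3,4)] ae by simp
    then have "y = fmul A (src C g) \<eta> y'" by (simp add: fmul_A[OF obj_C(1)[OF x] fd])
    moreover have "src (Gr (src C g)) \<eta> = fanch A y'"
      using \<eta>(4) y' fy'(2) by (simp add: fdom_A[OF g] fanch_A)
    ultimately show "\<exists>\<eta>\<in>arr (Gr (src C g)). s g \<gamma> = rng (Gr (src C g)) \<eta> \<and> \<gamma>' = ra g \<gamma> \<eta> \<and>
           src (Gr (src C g)) \<eta> = fanch A y' \<and> y = fmul A (src C g) \<eta> y'"
      using \<eta> by blast
  qed
next
  fix g h \<gamma> p assume gh: "g \<in> arr C" "h \<in> arr C" "src C g = rng C h" and \<gamma>: "\<gamma> \<in> cpts F g" and p: "p \<in> fdom C F A h"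
  obtain \<eta> y where \<eta>: "p = (\<eta>, y)" by force
  show "case p of (\<eta>, y) \<Rightarrow> s g \<gamma> = r h \<eta> \<longrightarrow>
      fmul A g \<gamma> (fmul A h \<eta> y) = fmul A (cmp C g h) (prd g h \<gamma> \<eta>) y"
    unfolding \<eta> prod.case
  proof
    assume sr: "s g \<gamma> = r h \<eta>"
    have y: "(\<eta>, y) \<in> fdom C F A h" using p \<eta> by simp
    note fy = arrow_act[OF gh(2) y] and fp = prd_facts[OF gh \<gamma> arrow_act(1)[OF gh(2) y] sr]
    have d1: "(\<gamma>, gact a (arrow h \<eta>) y) \<in> fdom C F A g"
      using \<gamma> fy gh(3) sr by (simp add: fdom_A[OF gh(1)])
    have d2: "(prd g h \<gamma> \<eta>, y) \<in> fdom C F A (cmp C g h)"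
      using y fp cmp_C[OF gh] by (simp add: fdom_A[OF gh(2)] fdom_A[OF cmp_C(1)[OF gh]])
    have "gact a (arrow g \<gamma>) (gact a (arrow h \<eta>) y) = gact a (cmp U_F (arrow g \<gamma>) (arrow h \<eta>)) y"
      using arrow_act(3,4)[OF gh(1) d1] fy act.anch_act[OF fy(2-4)] by (intro act.act_cmp) simp_all
    then show "fmul A g \<gamma> (fmul A h \<eta> y) = fmul A (cmp C g h) (prd g h \<gamma> \<eta>) y"
      unfolding fmul_A[OF gh(2) y] fmul_A[OF gh(1) d1] fmul_A[OF cmp_C(1)[OF gh] d2] arrow_mult[OF gh \<gamma> fy(1) sr] .
  qed
qed

lemma A_normalised: "A \<in> F_actions C F Y"
proof -
  have "fmul A g \<gamma> y = undefined" if *: "\<not> (g \<in> arr C \<and> (\<gamma>, y) \<in> fdom C F A g)" for g \<gamma> y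
  proof (rule ccontr)
    assume "fmul A g \<gamma> y \<noteq> undefined"
    then have y: "g \<in> arr C" "\<gamma> \<in> cpts F g" "y \<in> topspace Y" "ganch a y = ug (src C g, s g \<gamma>)"
      unfolding fmul_A_cases by (simp_all split: if_splits)
    then have "(\<gamma>, y) \<in> fdom C F A g"
      using pos_eq[OF arrow_source_space[OF y(1,2)] y(4)] by (simp add: fdom_A)
    then show False using * y(1) by simp
  qed
  moreover have "part A x = {}" if "x \<notin> obj C" for x using that by (simp add: to_F_action_def)
  moreover have "fanch A \<in> extensional (topspace Y)" by (simp add: to_F_action_def)
  ultimately show ?thesis
    unfolding F_actions_def mem_Collect_eq using F_action_A by blast
qed

end

section \<open>From actions of the diagram to actions of the model\<close>

context diag_action
begin

definition model_act :: "(('c, 'a) bis isg_term set \<times> ('c \<times> 'a)) set \<Rightarrow> 'y \<Rightarrow> 'y" where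
  "model_act u z = (if u \<in> arr U_F \<and> z \<in> topspace Z \<and> src U_F u = ug (to_Omega z)
     then app (\<theta> (fst (SOME p. p \<in> u))) z else undefined)"

definition model_anch :: "'y \<Rightarrow> (('c, 'a) bis isg_term set \<times> ('c \<times> 'a)) set" where
  "model_anch = restrict (\<lambda>y. ug (to_Omega y)) (topspace Z)"

lemma model_anch_eq: "y \<in> topspace Z \<Longrightarrow> model_anch y = ug (to_Omega y)"
  by (simp add: model_anch_def)

text \<open>The value does not depend on the representative of the germ: two representatives agree on an idempotent that
  is defined at \<open>to_Omega z\<close>, and this idempotent is also defined at \<open>z\<close>.\<close>

lemma model_act_germ:
  assumes t: "t \<in> elems IS" and z: "(z, z') \<in> \<theta> t"
  shows "model_act (gmO t (to_Omega z)) z = z'"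
proof -
  have O: "(to_Omega z, to_Omega z') \<in> Om.\<theta> t" by (rule theta_to_Omega(1)[OF t z])
  have zs: "z \<in> topspace Z" using ind.theta_space[OF t z] by simp
  obtain u where u: "(SOME p. p \<in> gmO t (to_Omega z)) = (u, to_Omega z)" "u \<in> elems IS"
    "Om.ind.germ_equiv t u (to_Omega z)"
    by (rule Om.ind.germ_representative[OF t O])
  obtain e where e: "e \<in> idems IS" "to_Omega z \<in> Domain (Om.\<theta> e)" "smul IS t e = smul IS u e"
    using u(3) unfolding Om.ind.germ_equiv_def by blast
  have "z \<in> Domain (\<theta> e)"
    using theta_to_Omega(2)[OF Om.ind.idem_elems[OF e(1)] zs] e(2) by blast
  then have "ind.germ_equiv t u z" unfolding ind.germ_equiv_def using e(1,3) by blast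
  then have "(z, z') \<in> \<theta> u" using ind.germ_equiv_theta[OF t u(2) _ z] by blast
  then have "app (\<theta> u) z = z'" by (rule partial_homeo_app[OF ind.homeo[OF u(2)]])
  then show ?thesis
    unfolding model_act_def using Om.ind.arr_germ[OF t O] Om.ind.src_germ[OF t O] zs u(1) by simp
qed

lemma arrow_at:
  assumes "u \<in> arr U_F" "z \<in> topspace Z" "src U_F u = ug (to_Omega z)"
  obtains t z' where "t \<in> elems IS" "u = gmO t (to_Omega z)" "(z, z') \<in> \<theta> t" "(to_Omega z, to_Omega z') \<in> Om.\<theta> t"
proof -
  obtain t v w where t: "u = gmO t v" "t \<in> elems IS" "(v, w) \<in> Om.\<theta> t" by (rule Om.ind.arrE[OF assms(1)])
  have "ug v = ug (to_Omega z)" using assms(3) unfolding t(1) Om.ind.src_germ[OF t(2,3)] .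
  then have v: "v = to_Omega z"
    using Om.ind.theta_space[OF t(2,3)] to_Omega_space[OF assms(2)] by (intro Om.ind.unit_germ_inj) auto
  obtain z' where z': "(z, z') \<in> \<theta> t" using theta_to_Omega(2)[OF t(2) assms(2)] t(3) v by blast
  show ?thesis by (rule that[OF t(2) _ z' theta_to_Omega(1)[OF t(2) z']]) (simp add: t(1) v)
qed

lemma continuous_model_anch: "continuous_map Z (unit_space U_F) model_anch"
proof -
  have "continuous_map Om (gtop U_F) ug"
    unfolding continuous_map_def Om.ind.topspace_TG
    using Om.ind.openin_unit_germ_vimage Om.ind.unit_germ_arr by blast
  from continuous_map_compose[OF continuous_to_Omega this]
  have "continuous_map Z (gtop U_F) model_anch"
    by (rule continuous_map_eq) (simp add: model_anch_eq)
  then show ?thesis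
    unfolding unit_space_def continuous_map_in_subtopology
    using to_Omega_space by (auto simp: model_anch_eq Om.ind.obj_TG)
qed

lemma continuous_model_act:
  "continuous_map (subtopology (prod_topology (gtop U_F) Z) {(u, y). src U_F u = model_anch y}) Z
    (\<lambda>(u, y). model_act u y)" (is "continuous_map ?D _ _")
proof -
  have at: "\<exists>t z'. t \<in> elems IS \<and> u = gmO t (to_Omega z) \<and> (z, z') \<in> \<theta> t \<and> (to_Omega z, to_Omega z') \<in> Om.\<theta> t"
    if uz: "(u, z) \<in> topspace ?D" for u z
  proof -
    have "u \<in> arr U_F" "z \<in> topspace Z" "src U_F u = ug (to_Omega z)"
      using uz by (auto simp: Om.ind.topspace_TG model_anch_eq)
    then obtain t z' where "t \<in> elems IS" "u = gmO t (to_Omega z)" "(z, z') \<in> \<theta> t" "(to_Omega z, to_Omega z') \<in> Om.\<theta> t"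
      by (rule arrow_at)
    then show ?thesis by blast
  qed
  show ?thesis
    unfolding continuous_map_def
  proof (intro conjI allI impI)
    show "(\<lambda>(u, y). model_act u y) \<in> topspace ?D \<rightarrow> topspace Z"
    proof
      fix p assume p: "p \<in> topspace ?D"
      obtain u z where uz: "p = (u, z)" by force
      then obtain t z' where t: "t \<in> elems IS" "u = gmO t (to_Omega z)" "(z, z') \<in> \<theta> t" using at p by blast
      then show "(\<lambda>(u, y). model_act u y) p \<in> topspace Z"
        using model_act_germ[OF t(1,3)] ind.theta_space[OF t(1,3)] uz by simp
    qed
    fix N assume N: "openin Z N"
    show "openin ?D {p \<in> topspace ?D. (\<lambda>(u, y). model_act u y) p \<in> N}" (is "openin _ ?M")
    proof (subst openin_subopen, intro ballI)
      fix p assume p: "p \<in> ?M"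
      obtain u z where uz: "p = (u, z)" by force
      then obtain t z' where t: "t \<in> elems IS" "u = gmO t (to_Omega z)" "(z, z') \<in> \<theta> t" "(to_Omega z, to_Omega z') \<in> Om.\<theta> t"
        using at p by blast
      have z'N: "z' \<in> N" using p uz model_act_germ[OF t(1,3)] t(2) by simp
      let ?G = "gmO t ` Domain (Om.\<theta> t)"
      let ?V = "(\<theta> t)\<inverse> `` N"
      let ?T = "(?G \<times> ?V) \<inter> {(u, y). src U_F u = model_anch y}"
      have "openin (gtop U_F) ?G" "openin Z ?V"
        using Om.ind.openin_germ_image[OF t(1) Om.ind.openin_Domain[OF t(1)]] ind.openin_theta_vimage[OF t(1) N]
        by simp_all
      then have "openin ?D ?T" by (intro openin_subtopology_Int) (simp add: openin_prod_Times_iff)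
      moreover have "p \<in> ?T" using uz t z'N p by auto
      moreover have "?T \<subseteq> ?M"
      proof
        fix q assume q: "q \<in> ?T"
        then obtain v w y y' where q': "q = (gmO t v, y)" "(v, w) \<in> Om.\<theta> t" "(y, y') \<in> \<theta> t" "y' \<in> N"
          "src U_F (gmO t v) = model_anch y" by auto
        have ys: "y \<in> topspace Z" using ind.theta_space[OF t(1) q'(3)] by simp
        have "ug v = ug (to_Omega y)" using q'(5) Om.ind.src_germ[OF t(1) q'(2)] model_anch_eq[OF ys] by simp
        then have "v = to_Omega y"
          using Om.ind.theta_space[OF t(1) q'(2)] to_Omega_space[OF ys] by (intro Om.ind.unit_germ_inj) auto
        then have "model_act (gmO t v) y = y'" using model_act_germ[OF t(1) q'(3)] by simp
        then show "q \<in> ?M"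
          using q'(1,4,5) ys Om.ind.arr_germ[OF t(1) q'(2)] by (simp add: Om.ind.topspace_TG)
      qed
      ultimately show "\<exists>T. openin ?D T \<and> p \<in> T \<and> T \<subseteq> ?M" by blast
    qed
  qed
qed

theorem left_space_model: "left_space U_F Z model_anch model_act"
  unfolding left_space_def
proof (intro conjI ballI impI continuous_model_anch continuous_model_act)
  fix x h assume x: "x \<in> topspace Z" and h: "h \<in> arr U_F" "src U_F h = model_anch x"
  then have "src U_F h = ug (to_Omega x)" by (simp add: model_anch_eq)
  then obtain t z where t: "t \<in> elems IS" "h = gmO t (to_Omega x)" "(x, z) \<in> \<theta> t" "(to_Omega x, to_Omega z) \<in> Om.\<theta> t"
    by (rule arrow_at[OF h(1) x])
  have zs: "z \<in> topspace Z" using ind.theta_space[OF t(1,3)] by simp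
  show "model_anch (model_act h x) = rng U_F h"
    unfolding t(2) model_act_germ[OF t(1,3)] Om.ind.rng_germ[OF t(1,4)] by (rule model_anch_eq[OF zs])
next
  fix x g h assume x: "x \<in> topspace Z" and g: "g \<in> arr U_F" and h: "h \<in> arr U_F"
    and *: "src U_F g = rng U_F h \<and> src U_F h = model_anch x"
  then have "src U_F h = ug (to_Omega x)" by (simp add: model_anch_eq)
  then obtain t z where t: "t \<in> elems IS" "h = gmO t (to_Omega x)" "(x, z) \<in> \<theta> t" "(to_Omega x, to_Omega z) \<in> Om.\<theta> t"
    by (rule arrow_at[OF h x])
  have zs: "z \<in> topspace Z" using ind.theta_space[OF t(1,3)] by simp
  have "src U_F g = ug (to_Omega z)" using * unfolding t(2) Om.ind.rng_germ[OF t(1,4)] by simp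
  then obtain u w where u: "u \<in> elems IS" "g = gmO u (to_Omega z)" "(z, w) \<in> \<theta> u" "(to_Omega z, to_Omega w) \<in> Om.\<theta> u"
    by (rule arrow_at[OF g zs])
  have "cmp U_F g h = gmO (smul IS u t) (to_Omega x)"
    unfolding t(2) u(2) by (rule Om.ind.cmp_germ[OF t(1,4) u(1,4)])
  moreover have "model_act (gmO (smul IS u t) (to_Omega x)) x = w"
    by (rule model_act_germ[OF Om.ind.mul_closed[OF u(1) t(1)] ind.theta_mul[OF t(1) u(1) t(3) u(3)]])
  moreover have "model_act h x = z" "model_act g z = w"
    unfolding t(2) u(2) by (rule model_act_germ[OF t(1,3)], rule model_act_germ[OF u(1,3)])
  ultimately show "model_act g (model_act h x) = model_act (cmp U_F g h) x" by simp
next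
  fix x assume x: "x \<in> topspace Z"
  obtain e where e: "e \<in> idems IS" "x \<in> Domain (\<theta> e)" by (rule ind.idem_at[OF x])
  have xx: "(x, x) \<in> \<theta> e" by (rule ind.theta_idem_Domain[OF e])
  have el: "e \<in> elems IS" by (rule Om.ind.idem_elems[OF e(1)])
  have "ug (to_Omega x) = gmO e (to_Omega x)"
    using theta_to_Omega(1)[OF el xx] by (intro Om.ind.unit_germ_eq[OF e(1)]) blast
  then show "model_act (model_anch x) x = x"
    using model_act_germ[OF el xx] by (simp add: model_anch_eq[OF x])
qed

lemma model_left_action: "\<lparr>ganch = model_anch, gact = model_act\<rparr> \<in> left_actions U_F Z"
proof -
  have "model_act u y = undefined" if "\<not> (u \<in> arr U_F \<and> y \<in> topspace Z \<and> src U_F u = model_anch y)" for u y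
    using that model_anch_eq[of y] unfolding model_act_def by (simp split: if_splits) metis
  then show ?thesis
    unfolding left_actions_def using left_space_model by (simp add: model_anch_def)
qed

lemma model_act_arrow:
  assumes g: "g \<in> arr C" and y: "(\<gamma>, y) \<in> fd g"
  shows "model_act (arrow g \<gamma>) y = fm g \<gamma> y"
proof -
  have \<gamma>: "\<gamma> \<in> cpts F g" "to_Omega y = (src C g, s g \<gamma>)" using y by (simp_all add: fdom_iff_to_Omega[OF g])
  obtain U where U: "U \<in> slices C F g" "\<gamma> \<in> U" "arrow g \<gamma> = gmO (Theta g U) (src C g, s g \<gamma>)"
    "Theta g U \<in> elems IS"
    by (rule arrow_germ[OF g \<gamma>(1)])
  have "\<theta> (Theta g U) = gr (mk_bis g U)"
    unfolding Theta_def using g U(1) by (subst induced_class) (simp_all add: mk_bis_Bis)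
  then have "(y, fm g \<gamma> y) \<in> \<theta> (Theta g U)" using U(2) y by (auto simp: slice_graph_iff)
  from model_act_germ[OF U(4) this] show ?thesis unfolding U(3) \<gamma>(2) .
qed

lemma to_F_action_model:
  assumes norm: "A \<in> F_actions C F Z"
  shows "to_F_action Z \<lparr>ganch = model_anch, gact = model_act\<rparr> = A"
proof -
  define a where "a = \<lparr>ganch = model_anch, gact = model_act\<rparr>"
  interpret M: model_action C F Z a
    by unfold_locales (unfold a_def, rule model_left_action)
  have pos: "base_point a y = to_Omega y" if "y \<in> topspace Z" for y
    using M.pos_eq[OF to_Omega_space[OF that]] model_anch_eq[OF that] by (simp add: a_def)
  have "part (to_F_action Z a) = part A"
  proof
    fix x
    show "part (to_F_action Z a) x = part A x"
    proof (cases "x \<in> obj C")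
      case True
      have "fst (to_Omega y) = x \<longleftrightarrow> y \<in> part A x" if "y \<in> topspace Z" for y
        using to_Omega_iff[OF that, of x "fanch A y"] True by (cases "to_Omega y") (auto simp: to_Omega_def)
      then have "y \<in> topspace Z \<and> fst (base_point a y) = x \<longleftrightarrow> y \<in> part A x" for y
        using pos[of y] part_sub[OF True] by (metis subsetD)
      then show ?thesis unfolding M.part_A[OF True] by blast
    qed (use norm in \<open>simp add: to_F_action_def F_actions_def\<close>)
  qed
  moreover have "fanch (to_F_action Z a) = fanch A"
  proof (rule extensionalityI[of _ "topspace Z"])
    show "fanch (to_F_action Z a) y = fanch A y" if "y \<in> topspace Z" for y
      using M.fanch_A[OF that] pos[OF that] by (simp add: to_Omega_def)
  qed (use norm in \<open>simp_all add: to_F_action_def F_actions_def\<close>)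
  moreover have "fmul (to_F_action Z a) = fmul A"
  proof (intro ext)
    fix g \<gamma> y
    have eq: "g \<in> arr C \<and> (\<gamma>, y) \<in> fdom C F (to_F_action Z a) g \<longleftrightarrow> g \<in> arr C \<and> (\<gamma>, y) \<in> fd g"
      using M.fdom_A[of g \<gamma> y] fdom_iff_to_Omega[of g \<gamma> y] pos[of y] by auto
    show "fmul (to_F_action Z a) g \<gamma> y = fmul A g \<gamma> y"
    proof (cases "g \<in> arr C \<and> (\<gamma>, y) \<in> fd g")
      case True
      then show ?thesis using M.fmul_A[of g \<gamma> y] eq model_act_arrow[of g \<gamma> y] by (simp add: a_def)
    next
      case False
      then have "fmul A g \<gamma> y = undefined" using norm by (simp add: F_actions_def)
      moreover have "fmul (to_F_action Z a) g \<gamma> y = undefined"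
        using M.A_normalised False eq unfolding F_actions_def mem_Collect_eq by metis
      ultimately show ?thesis by simp
    qed
  qed
  ultimately show ?thesis unfolding a_def[symmetric] by simp
qed

end

section \<open>Naturality and the groupoid model\<close>

locale model_action_pair = Y1: model_action C F Y a + Y2: model_action C F Y' a'
  for C :: "'c category" and F :: "('c, 'a) diag" and Y :: "'y topology" and a
    and Y' :: "'z topology" and a' +
  fixes \<phi> :: "'y \<Rightarrow> 'z"
  assumes space: "y \<in> topspace Y \<Longrightarrow> \<phi> y \<in> topspace Y'"
begin

lemma anch_preserved_iff:
  assumes "y \<in> topspace Y"
  shows "ganch a' (\<phi> y) = ganch a y \<longleftrightarrow> Y2.pos (\<phi> y) = Y1.pos y"
  using Y2.anch_eq_iff[OF space[OF assms] Y1.pos_space(1)[OF assms]] Y1.pos_space(2)[OF assms] by simp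

lemma F_equivariant_if_G_equivariant:
  assumes eq: "G_equivariant Y1.U_F Y a a' \<phi>"
  shows "F_equivariant C F Y1.A Y2.A \<phi>"
  unfolding F_equivariant_def
proof (intro conjI ballI)
  have pos: "Y2.pos (\<phi> y) = Y1.pos y" if "y \<in> topspace Y" for y
    using eq anch_preserved_iff[OF that] that by (simp add: G_equivariant_def)
  show "\<phi> ` part Y1.A x \<subseteq> part Y2.A x" if "x \<in> obj C" for x
    using pos space by (auto simp: Y1.part_A[OF that] Y2.part_A[OF that])
  show "fanch Y2.A (\<phi> y) = fanch Y1.A y" if "x \<in> obj C" "y \<in> part Y1.A x" for x y
    using that pos[of y] space[of y] by (simp add: Y1.part_A Y1.fanch_A Y2.fanch_A)
  fix g p assume g: "g \<in> arr C" and p: "p \<in> fdom C F Y1.A g"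
  obtain \<gamma> y where py: "p = (\<gamma>, y)" by force
  have y: "(\<gamma>, y) \<in> fdom C F Y1.A g" using p py by simp
  note f = Y1.arrow_act[OF g y]
  have y2: "(\<gamma>, \<phi> y) \<in> fdom C F Y2.A g"
    using y pos[OF f(2)] space[OF f(2)] by (simp add: Y1.fdom_A[OF g] Y2.fdom_A[OF g])
  have "\<phi> (gact a (Y1.arrow g \<gamma>) y) = gact a' (Y1.arrow g \<gamma>) (\<phi> y)"
    using eq f(2-4) by (simp add: G_equivariant_def)
  then show "case p of (\<gamma>, y) \<Rightarrow> \<phi> (fmul Y1.A g \<gamma> y) = fmul Y2.A g \<gamma> (\<phi> y)"
    unfolding py prod.case Y1.fmul_A[OF g y] Y2.fmul_A[OF g y2] .
qed

text \<open>The arrows with which \<open>\<phi>\<close> commutes contain those of the correspondences and are closed under products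
  and inverses, so they are all arrows.\<close>

lemma G_equivariant_if_F_equivariant:
  assumes eq: "F_equivariant C F Y1.A Y2.A \<phi>"
  shows "G_equivariant Y1.U_F Y a a' \<phi>"
proof -
  have pos: "Y2.pos (\<phi> y) = Y1.pos y" if y: "y \<in> topspace Y" for y
  proof -
    define x where "x = fst (Y1.pos y)"
    have x: "x \<in> obj C" using Y1.pos_space(1)[OF y] by (auto simp: x_def Y1.topspace_Omega)
    have p: "y \<in> part Y1.A x" unfolding Y1.part_A[OF x] using y by (simp add: x_def)
    then have "\<phi> y \<in> part Y2.A x" "fanch Y2.A (\<phi> y) = fanch Y1.A y"
      using eq x unfolding F_equivariant_def by blast+
    then have "fst (Y2.pos (\<phi> y)) = x" "snd (Y2.pos (\<phi> y)) = snd (Y1.pos y)"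
      using y space[OF y] unfolding Y2.part_A[OF x] by (simp_all add: Y1.fanch_A Y2.fanch_A)
    then have "fst (Y2.pos (\<phi> y)) = fst (Y1.pos y)" "snd (Y2.pos (\<phi> y)) = snd (Y1.pos y)"
      by (simp_all add: x_def)
    then show ?thesis by (rule prod_eqI)
  qed
  have anch: "ganch a' (\<phi> y) = ganch a y" if "y \<in> topspace Y" for y
    using anch_preserved_iff[OF that] pos[OF that] by simp
  have "\<forall>y\<in>topspace Y. src Y1.U_F u = ganch a y \<longrightarrow> \<phi> (gact a u y) = gact a' u (\<phi> y)" if "u \<in> arr Y1.U_F" for u
    using that
  proof (rule Y1.arrow_induct)
    fix g \<gamma> assume g: "g \<in> arr C" "\<gamma> \<in> cpts F g"
    show "\<forall>y\<in>topspace Y. src Y1.U_F (Y1.arrow g \<gamma>) = ganch a y \<longrightarrow>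
        \<phi> (gact a (Y1.arrow g \<gamma>) y) = gact a' (Y1.arrow g \<gamma>) (\<phi> y)"
    proof (intro ballI impI)
      fix y assume y: "y \<in> topspace Y" and "src Y1.U_F (Y1.arrow g \<gamma>) = ganch a y"
      then have "Y1.pos y = (src C g, Y1.s g \<gamma>)"
        using Y1.arrow_facts(2)[OF g] by (intro Y1.pos_eq[OF Y1.arrow_source_space[OF g]]) simp
      then have d: "(\<gamma>, y) \<in> fdom C F Y1.A g" "(\<gamma>, \<phi> y) \<in> fdom C F Y2.A g"
        using y g(2) pos[OF y] space[OF y] by (simp_all add: Y1.fdom_A[OF g(1)] Y2.fdom_A[OF g(1)])
      have "\<phi> (fmul Y1.A g \<gamma> y) = fmul Y2.A g \<gamma> (\<phi> y)"
        using eq g(1) d(1) unfolding F_equivariant_def by blast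
      then show "\<phi> (gact a (Y1.arrow g \<gamma>) y) = gact a' (Y1.arrow g \<gamma>) (\<phi> y)"
        unfolding Y1.fmul_A[OF g(1) d(1)] Y2.fmul_A[OF g(1) d(2)] .
    qed
  next
    fix u v assume u: "u \<in> arr Y1.U_F" and v: "v \<in> arr Y1.U_F" and uv: "src Y1.U_F u = rng Y1.U_F v"
      and IHu: "\<forall>y\<in>topspace Y. src Y1.U_F u = ganch a y \<longrightarrow> \<phi> (gact a u y) = gact a' u (\<phi> y)"
      and IHv: "\<forall>y\<in>topspace Y. src Y1.U_F v = ganch a y \<longrightarrow> \<phi> (gact a v y) = gact a' v (\<phi> y)"
    show "\<forall>y\<in>topspace Y. src Y1.U_F (cmp Y1.U_F u v) = ganch a y \<longrightarrow>
        \<phi> (gact a (cmp Y1.U_F u v) y) = gact a' (cmp Y1.U_F u v) (\<phi> y)"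
    proof (intro ballI impI)
      fix y assume y: "y \<in> topspace Y" and "src Y1.U_F (cmp Y1.U_F u v) = ganch a y"
      then have sv: "src Y1.U_F v = ganch a y" using Y1.UF.cmp_facts(2)[OF u v uv] by simp
      have sv': "src Y1.U_F v = ganch a' (\<phi> y)" using sv anch[OF y] by simp
      have "\<phi> (gact a u (gact a v y)) = gact a' u (\<phi> (gact a v y))"
        using IHu Y1.act.act_space[OF y v sv] Y1.act.anch_act[OF y v sv] uv by simp
      also have "\<phi> (gact a v y) = gact a' v (\<phi> y)" using IHv y sv by simp
      finally show "\<phi> (gact a (cmp Y1.U_F u v) y) = gact a' (cmp Y1.U_F u v) (\<phi> y)"
        unfolding Y1.act.act_cmp[OF y u v uv sv] Y2.act.act_cmp[OF space[OF y] u v uv sv'] .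
    qed
  next
    fix u assume u: "u \<in> arr Y1.U_F"
      and IH: "\<forall>y\<in>topspace Y. src Y1.U_F u = ganch a y \<longrightarrow> \<phi> (gact a u y) = gact a' u (\<phi> y)"
    show "\<forall>y\<in>topspace Y. src Y1.U_F (ginv Y1.U_F u) = ganch a y \<longrightarrow>
        \<phi> (gact a (ginv Y1.U_F u) y) = gact a' (ginv Y1.U_F u) (\<phi> y)"
    proof (intro ballI impI)
      fix y assume y: "y \<in> topspace Y" and si: "src Y1.U_F (ginv Y1.U_F u) = ganch a y"
      note iu = Y1.UF.arr_facts(9)[OF u]
      have ru: "rng Y1.U_F u = ganch a y" using si Y1.UF.arr_facts(10)[OF u] by simp
      define x where "x = gact a (ginv Y1.U_F u) y"
      have x: "x \<in> topspace Y" "src Y1.U_F u = ganch a x"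
        unfolding x_def using Y1.act.act_space[OF y iu si] Y1.act.anch_act[OF y iu si] Y1.UF.arr_facts(11)[OF u]
        by simp_all
      have "\<phi> y = gact a' u (\<phi> x)"
        using IH[rule_format, OF x] Y1.act.act_ginv'[OF y u ru] unfolding x_def by simp
      then show "\<phi> (gact a (ginv Y1.U_F u) y) = gact a' (ginv Y1.U_F u) (\<phi> y)"
        using Y2.act.act_ginv[OF space[OF x(1)] u] x anch[OF x(1)] by (simp add: x_def)
    qed
  qed
  then show ?thesis unfolding G_equivariant_def using anch by blast
qed

end

context tight_diag
begin

lemma equivariant_iff:
  assumes "a \<in> left_actions U_F Y" "a' \<in> left_actions U_F Y'" "\<phi> \<in> topspace Y \<rightarrow> topspace Y'"
  shows "G_equivariant U_F Y a a' \<phi> \<longleftrightarrow> F_equivariant C F (to_F_action Y a) (to_F_action Y' a') \<phi>"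
proof -
  interpret model_action_pair C F Y a Y' a' \<phi>
    by unfold_locales (use assms in auto)
  show ?thesis using F_equivariant_if_G_equivariant G_equivariant_if_F_equivariant by blast
qed

text \<open>Injectivity of the correspondence between actions is naturality for the identity map.\<close>

lemma inj_to_F_action: "inj_on (to_F_action Y) (left_actions U_F Y)"
proof (rule inj_onI)
  fix a b
  assume a: "a \<in> left_actions U_F Y" and b: "b \<in> left_actions U_F Y" and eq: "to_F_action Y a = to_F_action Y b"
  have "F_equivariant C F (to_F_action Y a) (to_F_action Y b) id"
    unfolding eq by (simp add: F_equivariant_def)
  then have "G_equivariant U_F Y a b id" using equivariant_iff[OF a b, of id] by simp
  then have anch: "\<And>y. y \<in> topspace Y \<Longrightarrow> ganch b y = ganch a y"
    and act: "\<And>u y. u \<in> arr U_F \<Longrightarrow> y \<in> topspace Y \<Longrightarrow> src U_F u = ganch a y \<Longrightarrow> gact a u y = gact b u y"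
    by (simp_all add: G_equivariant_def)
  have "ganch a = ganch b"
    by (rule extensionalityI[of _ "topspace Y"]) (use a b anch in \<open>simp_all add: left_actions_def\<close>)
  moreover have "gact a = gact b"
  proof (intro ext)
    fix u y
    show "gact a u y = gact b u y"
    proof (cases "u \<in> arr U_F \<and> y \<in> topspace Y \<and> src U_F u = ganch a y")
      case False
      then have "gact a u y = undefined" "gact b u y = undefined"
        using a b calculation unfolding left_actions_def by auto
      then show ?thesis by simp
    qed (use act in blast)
  qed
  ultimately show "a = b" by simp
qed

lemma bij_to_F_action: "bij_betw (to_F_action Y) (left_actions U_F Y) (F_actions C F Y)"
  unfolding bij_betw_def
proof (intro conjI inj_to_F_action equalityI subsetI)
  fix B assume "B \<in> to_F_action Y ` left_actions U_F Y"
  then obtain a where aB: "a \<in> left_actions U_F Y" "B = to_F_action Y a" by blast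
  interpret model_action C F Y a by unfold_locales (rule aB(1))
  show "B \<in> F_actions C F Y" unfolding aB(2) by (rule A_normalised)
next
  fix B assume B: "B \<in> F_actions C F Y"
  interpret diag_action C F Y B by unfold_locales (use B in \<open>simp add: F_actions_def\<close>)
  show "B \<in> to_F_action Y ` left_actions U_F Y"
    using to_F_action_model[OF B] model_left_action by (metis imageI)
qed

theorem groupoid_model_U_F: "groupoid_model C F U_F TYPE('y)"
  unfolding groupoid_model_def
proof (intro conjI exI[of _ to_F_action] allI ballI impI)
  show "etale_groupoid U_F" by (rule Om.ind.etale_transformation_groupoid)
  show "bij_betw (to_F_action Y) (left_actions U_F Y) (F_actions C F Y)" for Y :: "'y topology"
    by (rule bij_to_F_action)
  show "G_equivariant U_F Y a a' \<phi> \<longleftrightarrow> F_equivariant C F (to_F_action Y a) (to_F_action Y' a') \<phi>"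
    if "a \<in> left_actions U_F Y" "a' \<in> left_actions U_F Y'" "continuous_map Y Y' \<phi>"
    for Y Y' :: "'y topology" and a a' \<phi>
    using that(1,2) continuous_map_funspace[OF that(3)] by (rule equivariant_iff)
qed

end

theorem theorem6p1:
  fixes C :: "'c category" and F :: "('c, 'a) diag"
  assumes "small_category C" and "tight_diagram C F"
  shows "F_action C F (Omega C F) (Omega_action C F) \<and>
    universal_F_action C F (Omega C F) (Omega_action C F) TYPE('y) \<and>
    groupoid_model C F
      (transformation_groupoid (I_sg C F) (Omega C F) (induced_action C F (Omega_action C F)))
      TYPE('y)"
proof -
  interpret tight_diag C F by unfold_locales (rule assms)+
  show ?thesis using F_action_Omega universal_Omega groupoid_model_U_F by blast
qed

end
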